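(* Every non-cyclic endomorphism of $B_4$ is, up to a transvection by a homomorphism $B_4\to Z(B_4)$ and post-composing by an automorphism of $B_4$, of one of the following three types. \begin{enumerate} \item[(i)] The identity. \item[(ii)] The homomorphism $R_*\colon B_4\twoheadrightarrow B_3$, followed by an endomorphism of $B_3$, followed by the standard inclusion $B_3\hookrightarrow B_4$. \item[(iii)] The homomorphism $R_*\colon B_4\twoheadrightarrow B_3$, followed by a homomorphism $B_3\to B_4$ given by $\alpha\mapsto g\beta_4g^{-1}$, $\beta\mapsto\alpha_4^2$ for some $g\in B_4$. \end{enumerate}
   Context: $B_n$ is the braid group on $n$ strands with Artin generators $\sigma_1,\dots,\sigma_{n-1}$ and center $Z(B_n)$. Put $\alpha_n=\sigma_1\cdots\sigma_{n-1}$ and $\beta_n=\alpha_n\sigma_1$, and $\alpha=\alpha_3$, $\beta=\beta_3$, so $B_3=\langle\alpha,\beta\mid\alpha^3=\beta^2\rangle$. $R_*\colon B_4\to B_3$ is the surjective homomorphism $\sigma_1,\sigma_3\mapsto\sigma_1$, $\sigma_2\mapsto\sigma_2$. The standard inclusion $B_3\hookrightarrow B_4$ is $\sigma_i\mapsto\sigma_i$, $i=1,2$. A homomorphism is cyclic if its image is a cyclic group. The transvection of $\varphi\colon G\to H$ by a cyclic homomorphism $t$ from $G$ to the centralizer of $\varphi(G)$ in $H$ is $\varphi^t(g)=\varphi(g)t(g)$. *)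

theory Defs
  imports "HOL-Algebra.Elementary_Groups"
begin

section \<open>Groups given by generators and relations\<close>

text \<open>The letter \<open>(x, True)\<close> stands for the generator \<open>x\<close>, the letter \<open>(x, False)\<close> for its inverse.\<close>

type_synonym 'a gword = "('a \<times> bool) list"

definition gwords :: "'a set \<Rightarrow> 'a gword set" where
  "gwords S = lists (S \<times> UNIV)"

text \<open>The smallest congruence on the words over \<open>S\<close> that contains free cancellation and
  identifies the two sides of every relation in \<open>R\<close>.  It is meant for
  \<open>R \<subseteq> gwords S \<times> gwords S\<close>.\<close>

inductive gword_eq :: "'a set \<Rightarrow> ('a gword \<times> 'a gword) set \<Rightarrow> 'a gword \<Rightarrow> 'a gword \<Rightarrow> bool"
  for S R where
  gword_refl: "u \<in> gwords S \<Longrightarrow> gword_eq S R u u"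
| gword_sym: "gword_eq S R u v \<Longrightarrow> gword_eq S R v u"
| gword_trans: "gword_eq S R u v \<Longrightarrow> gword_eq S R v w \<Longrightarrow> gword_eq S R u w"
| gword_cancel: "u \<in> gwords S \<Longrightarrow> v \<in> gwords S \<Longrightarrow> x \<in> S \<Longrightarrow>
    gword_eq S R (u @ [(x, b), (x, \<not> b)] @ v) (u @ v)"
| gword_rel: "u \<in> gwords S \<Longrightarrow> v \<in> gwords S \<Longrightarrow> (r, s) \<in> R \<Longrightarrow>
    gword_eq S R (u @ r @ v) (u @ s @ v)"

definition gword_rel_set :: "'a set \<Rightarrow> ('a gword \<times> 'a gword) set \<Rightarrow> ('a gword \<times> 'a gword) set" where
  "gword_rel_set S R = {(u, v). gword_eq S R u v}"

definition presented_group :: "'a set \<Rightarrow> ('a gword \<times> 'a gword) set \<Rightarrow> 'a gword set monoid" where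
  "presented_group S R =
    \<lparr>carrier = gwords S // gword_rel_set S R,
     mult = (\<lambda>X Y. \<Union>u\<in>X. \<Union>v\<in>Y. gword_rel_set S R `` {u @ v}),
     one = gword_rel_set S R `` {[]}\<rparr>"

definition presented_gen :: "'a set \<Rightarrow> ('a gword \<times> 'a gword) set \<Rightarrow> 'a \<Rightarrow> 'a gword set" where
  "presented_gen S R x = gword_rel_set S R `` {[(x, True)]}"

fun gword_eval :: "('b, 'c) monoid_scheme \<Rightarrow> ('a \<Rightarrow> 'b) \<Rightarrow> 'a gword \<Rightarrow> 'b" where
  "gword_eval H f [] = \<one>\<^bsub>H\<^esub>"
| "gword_eval H f ((x, b) # w) = (if b then f x else inv\<^bsub>H\<^esub> (f x)) \<otimes>\<^bsub>H\<^esub> gword_eval H f w"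

text \<open>The homomorphism from a presented group to \<open>H\<close> that sends each generator \<open>x\<close> to \<open>f x\<close>.
  It does not depend on the chosen representative as soon as \<open>f\<close> respects the relations; see
  \<open>presented_lift_hom\<close> and \<open>presented_lift_gen\<close> below.\<close>

definition presented_lift :: "('b, 'c) monoid_scheme \<Rightarrow> ('a \<Rightarrow> 'b) \<Rightarrow> 'a gword set \<Rightarrow> 'b" where
  "presented_lift H f X = gword_eval H f (SOME w. w \<in> X)"

lemma gwords_append [simp]: "u @ v \<in> gwords S \<longleftrightarrow> u \<in> gwords S \<and> v \<in> gwords S"
  by (auto simp: gwords_def)

lemma gwords_Nil [simp]: "[] \<in> gwords S"
  by (simp add: gwords_def)

lemma gwords_Cons [simp]: "p # v \<in> gwords S \<longleftrightarrow> fst p \<in> S \<and> v \<in> gwords S"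
  by (cases p) (auto simp: gwords_def)

locale presentation =
  fixes S :: "'a set" and R :: "('a gword \<times> 'a gword) set"
  assumes relations: "R \<subseteq> gwords S \<times> gwords S"
begin

lemma eq_in_gwords: "gword_eq S R u v \<Longrightarrow> u \<in> gwords S \<and> v \<in> gwords S"
  by (induction rule: gword_eq.induct) (use relations in auto)

lemma eq_append: "gword_eq S R u v \<Longrightarrow> a \<in> gwords S \<Longrightarrow> b \<in> gwords S \<Longrightarrow>
    gword_eq S R (a @ u @ b) (a @ v @ b)"
proof (induction rule: gword_eq.induct)
  case (gword_refl u)
  then show ?case by (simp add: gword_eq.gword_refl)
next
  case (gword_sym u v)
  then show ?case using gword_eq.gword_sym by metis
next
  case (gword_trans u v w)
  then show ?case using gword_eq.gword_trans by metis
next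
  case (gword_cancel u v x c)
  then show ?case
    using gword_eq.gword_cancel[of "a @ u" S "v @ b" x R c] by simp
next
  case (gword_rel u v r s)
  then show ?case
    using gword_eq.gword_rel[of "a @ u" S "v @ b" r s R] by simp
qed

lemma equiv_rel: "equiv (gwords S) (gword_rel_set S R)"
proof (rule equivI)
  show "gword_rel_set S R \<subseteq> gwords S \<times> gwords S"
    using eq_in_gwords by (auto simp: gword_rel_set_def)
  show "refl_on (gwords S) (gword_rel_set S R)"
    by (simp add: gword_rel_set_def refl_on_def gword_refl)
  show "sym (gword_rel_set S R)"
    unfolding gword_rel_set_def sym_def using gword_sym by fast
  show "trans (gword_rel_set S R)"
    unfolding gword_rel_set_def trans_def using gword_trans by fast
qed

lemma eq_append2:
  assumes "gword_eq S R u u'" "gword_eq S R v v'"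
  shows "gword_eq S R (u @ v) (u' @ v')"
proof (rule gword_trans)
  show "gword_eq S R (u @ v) (u' @ v)"
    using eq_append[OF assms(1), of "[]" v] eq_in_gwords[OF assms(2)] by simp
  show "gword_eq S R (u' @ v) (u' @ v')"
    using eq_append[OF assms(2), of u' "[]"] eq_in_gwords[OF assms(1)] by simp
qed

abbreviation cls :: "'a gword \<Rightarrow> 'a gword set" where
  "cls w \<equiv> gword_rel_set S R `` {w}"

lemma cls_eq: "u \<in> gwords S \<Longrightarrow> v \<in> gwords S \<Longrightarrow> cls u = cls v \<longleftrightarrow> gword_eq S R u v"
  using eq_equiv_class_iff[OF equiv_rel] by (auto simp: gword_rel_set_def)

lemma mult_cls:
  assumes "u \<in> gwords S" "v \<in> gwords S"
  shows "cls u \<otimes>\<^bsub>presented_group S R\<^esub> cls v = cls (u @ v)"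
proof -
  have eq: "cls (u' @ v') = cls (u @ v)" if "u' \<in> cls u" "v' \<in> cls v" for u' v'
  proof -
    have "gword_eq S R u u'" "gword_eq S R v v'"
      using that by (auto simp: gword_rel_set_def)
    then have "gword_eq S R (u @ v) (u' @ v')" by (rule eq_append2)
    from gword_sym[OF this] show ?thesis
      using cls_eq[of "u' @ v'" "u @ v"] eq_in_gwords by blast
  qed
  have "u \<in> cls u" "v \<in> cls v"
    using assms by (simp_all add: gword_rel_set_def gword_refl)
  then have "(\<Union>u'\<in>cls u. \<Union>v'\<in>cls v. cls (u' @ v')) = cls (u @ v)"
    using eq by blast
  then show ?thesis
    by (simp add: presented_group_def)
qed

lemma carrier_cases:
  assumes "X \<in> carrier (presented_group S R)"
  obtains w where "w \<in> gwords S" "X = cls w"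
proof -
  from assms have "X \<in> gwords S // gword_rel_set S R" by (simp add: presented_group_def)
  then show thesis by (rule quotientE) (rule that)
qed

lemma cls_carrier [simp]: "w \<in> gwords S \<Longrightarrow> cls w \<in> carrier (presented_group S R)"
  by (auto simp: presented_group_def quotientI)

lemma one_cls: "\<one>\<^bsub>presented_group S R\<^esub> = cls []"
  by (simp add: presented_group_def)

lemma ex_inverse_word: "w \<in> gwords S \<Longrightarrow> \<exists>v\<in>gwords S. gword_eq S R (v @ w) []"
proof (induction w)
  case Nil
  have "gword_eq S R ([] @ []) []" by (simp add: gword_refl)
  then show ?case using gwords_Nil by blast
next
  case (Cons p w)
  obtain x b where p: "p = (x, b)" by (cases p)
  from Cons.prems have "w \<in> gwords S" by simp
  from Cons.IH[OF this] obtain v where v: "v \<in> gwords S" "gword_eq S R (v @ w) []" by blast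
  have "gword_eq S R (v @ [(x, \<not> b), (x, \<not> \<not> b)] @ w) (v @ w)"
    using Cons.prems v p by (intro gword_cancel) auto
  from gword_trans[OF this v(2)] have "gword_eq S R ((v @ [(x, \<not> b)]) @ p # w) []"
    using p by simp
  moreover have "v @ [(x, \<not> b)] \<in> gwords S"
    using Cons.prems v p by auto
  ultimately show ?case by blast
qed

lemma group_presented: "group (presented_group S R)"
proof (rule groupI)
  fix X assume "X \<in> carrier (presented_group S R)"
  then obtain w where w: "w \<in> gwords S" "X = cls w" by (rule carrier_cases)
  then show "\<one>\<^bsub>presented_group S R\<^esub> \<otimes>\<^bsub>presented_group S R\<^esub> X = X"
    by (simp add: one_cls mult_cls)
  obtain v where "v \<in> gwords S" "gword_eq S R (v @ w) []"
    using ex_inverse_word[OF w(1)] by blast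
  then show "\<exists>Y\<in>carrier (presented_group S R).
      Y \<otimes>\<^bsub>presented_group S R\<^esub> X = \<one>\<^bsub>presented_group S R\<^esub>"
    using w by (intro bexI[of _ "cls v"]) (auto simp: one_cls mult_cls cls_eq)
qed (auto elim!: carrier_cases simp: mult_cls one_cls)

lemma presented_lift_cls:
  assumes "group H" "\<And>x. x \<in> S \<Longrightarrow> f x \<in> carrier H"
    and "\<And>r s. (r, s) \<in> R \<Longrightarrow> gword_eval H f r = gword_eval H f s"
    and "w \<in> gwords S"
  shows "gword_eval H f w \<in> carrier H" "presented_lift H f (cls w) = gword_eval H f w"
    and "v \<in> gwords S \<Longrightarrow> gword_eval H f (v @ w) = gword_eval H f v \<otimes>\<^bsub>H\<^esub> gword_eval H f w"
proof -
  interpret H: group H by fact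
  have clos: "gword_eval H f u \<in> carrier H" if "u \<in> gwords S" for u
    using that assms(2) by (induction u) auto
  have app: "gword_eval H f (u @ v) = gword_eval H f u \<otimes>\<^bsub>H\<^esub> gword_eval H f v"
    if "u \<in> gwords S" "v \<in> gwords S" for u v
    using that by (induction u) (auto simp: clos assms(2) H.m_assoc)
  have eq: "gword_eval H f u = gword_eval H f v" if "gword_eq S R u v" for u v
    using that
  proof (induction rule: gword_eq.induct)
    case (gword_cancel u v x b)
    then have "gword_eval H f ([(x, b), (x, \<not> b)] @ v) = gword_eval H f v"
      using assms(2)[of x] clos[of v] by (cases b) (auto simp: H.m_assoc[symmetric])
    with gword_cancel show ?case by (simp add: app del: gword_eval.simps append.simps)
  next
    case (gword_rel u v r s)
    then have "r \<in> gwords S" "s \<in> gwords S" using relations by auto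
    with gword_rel show ?case by (simp add: app assms(3))
  qed auto
  show "gword_eval H f w \<in> carrier H" using clos assms(4) .
  show "v \<in> gwords S \<Longrightarrow> gword_eval H f (v @ w) = gword_eval H f v \<otimes>\<^bsub>H\<^esub> gword_eval H f w"
    using app assms(4) by blast
  have "w \<in> cls w" using assms(4) by (auto simp: gword_rel_set_def gword_refl)
  then have "(SOME u. u \<in> cls w) \<in> cls w" by (rule someI)
  then show "presented_lift H f (cls w) = gword_eval H f w"
    unfolding presented_lift_def using eq by (auto simp: gword_rel_set_def)
qed

lemma presented_lift_hom:
  assumes "group H" "\<And>x. x \<in> S \<Longrightarrow> f x \<in> carrier H"
    and "\<And>r s. (r, s) \<in> R \<Longrightarrow> gword_eval H f r = gword_eval H f s"
  shows "presented_lift H f \<in> hom (presented_group S R) H"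
  using assms by (auto intro!: homI elim!: carrier_cases simp: mult_cls presented_lift_cls)

lemma presented_lift_gen:
  assumes "group H" "\<And>x. x \<in> S \<Longrightarrow> f x \<in> carrier H"
    and "\<And>r s. (r, s) \<in> R \<Longrightarrow> gword_eval H f r = gword_eval H f s"
    and "x \<in> S"
  shows "presented_lift H f (presented_gen S R x) = f x"
proof -
  interpret H: group H by fact
  show ?thesis
    using assms by (simp add: presented_gen_def presented_lift_cls)
qed

lemma presented_gen_carrier: "x \<in> S \<Longrightarrow> presented_gen S R x \<in> carrier (presented_group S R)"
  by (simp add: presented_gen_def)

end

section \<open>Braid groups\<close>

definition braid_relations :: "nat \<Rightarrow> (nat gword \<times> nat gword) set" where
  "braid_relations n =
    {([(i, True), (j, True)], [(j, True), (i, True)]) | i j. 1 \<le> i \<and> i + 2 \<le> j \<and> j < n} \<union>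
    {([(i, True), (i + 1, True), (i, True)], [(i + 1, True), (i, True), (i + 1, True)]) | i.
       1 \<le> i \<and> i + 1 < n}"

definition braid_group :: "nat \<Rightarrow> nat gword set monoid" where
  "braid_group n = presented_group {1..<n} (braid_relations n)"

definition braid_sigma :: "nat \<Rightarrow> nat \<Rightarrow> nat gword set" where
  "braid_sigma n i = presented_gen {1..<n} (braid_relations n) i"

definition braid_alpha :: "nat \<Rightarrow> nat gword set" where
  "braid_alpha n =
    foldr (\<lambda>i x. braid_sigma n i \<otimes>\<^bsub>braid_group n\<^esub> x) [1..<n] \<one>\<^bsub>braid_group n\<^esub>"

definition braid_beta :: "nat \<Rightarrow> nat gword set" where
  "braid_beta n = braid_alpha n \<otimes>\<^bsub>braid_group n\<^esub> braid_sigma n 1"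

definition R_star :: "nat gword set \<Rightarrow> nat gword set" where
  "R_star = presented_lift (braid_group 3) (\<lambda>i. braid_sigma 3 (if i = 2 then 2 else 1))"

definition braid_incl_3_4 :: "nat gword set \<Rightarrow> nat gword set" where
  "braid_incl_3_4 = presented_lift (braid_group 4) (braid_sigma 4)"

section \<open>Cyclic homomorphisms and transvections\<close>

definition cyclic_hom :: "('a, 'c) monoid_scheme \<Rightarrow> ('b, 'd) monoid_scheme \<Rightarrow> ('a \<Rightarrow> 'b) \<Rightarrow> bool" where
  "cyclic_hom G H \<phi> \<longleftrightarrow> \<phi> \<in> hom G H \<and> cyclic_group (H\<lparr>carrier := \<phi> ` carrier G\<rparr>)"

definition centralizer :: "('a, 'c) monoid_scheme \<Rightarrow> 'a set \<Rightarrow> 'a set" where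
  "centralizer G A = {x \<in> carrier G. \<forall>a\<in>A. x \<otimes>\<^bsub>G\<^esub> a = a \<otimes>\<^bsub>G\<^esub> x}"

definition group_center :: "('a, 'c) monoid_scheme \<Rightarrow> 'a set" where
  "group_center G = centralizer G (carrier G)"

text \<open>The homomorphisms by which \<open>\<phi>\<close> may be transvected.\<close>

definition transvectors ::
    "('a, 'c) monoid_scheme \<Rightarrow> ('b, 'd) monoid_scheme \<Rightarrow> ('a \<Rightarrow> 'b) \<Rightarrow> ('a \<Rightarrow> 'b) set" where
  "transvectors G H \<phi> = {t. cyclic_hom G (H\<lparr>carrier := centralizer H (\<phi> ` carrier G)\<rparr>) t}"

definition transvection :: "('b, 'd) monoid_scheme \<Rightarrow> ('a \<Rightarrow> 'b) \<Rightarrow> ('a \<Rightarrow> 'b) \<Rightarrow> 'a \<Rightarrow> 'b" where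
  "transvection H \<phi> t = (\<lambda>g. \<phi> g \<otimes>\<^bsub>H\<^esub> t g)"

section \<open>The maps above are the intended ones\<close>

lemma braid_presentation: "presentation {1..<n} (braid_relations n)"
  by unfold_locales (auto simp: braid_relations_def)

lemma group_braid_group: "group (braid_group n)"
  unfolding braid_group_def by (rule presentation.group_presented[OF braid_presentation])

lemma braid_sigma_carrier: "1 \<le> i \<Longrightarrow> i < n \<Longrightarrow> braid_sigma n i \<in> carrier (braid_group n)"
  unfolding braid_group_def braid_sigma_def
  by (rule presentation.presented_gen_carrier[OF braid_presentation]) simp

lemma braid_sigma_commute:
  assumes "1 \<le> i" "i + 2 \<le> j" "j < n"
  shows "braid_sigma n i \<otimes>\<^bsub>braid_group n\<^esub> braid_sigma n j =
    braid_sigma n j \<otimes>\<^bsub>braid_group n\<^esub> braid_sigma n i"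
proof -
  interpret presentation "{1..<n}" "braid_relations n" by (rule braid_presentation)
  have "([(i, True), (j, True)], [(j, True), (i, True)]) \<in> braid_relations n"
    using assms unfolding braid_relations_def by blast
  from gword_rel[OF _ _ this, of "[]" "{1..<n}" "[]"] show ?thesis
    using assms by (simp add: braid_sigma_def presented_gen_def braid_group_def mult_cls cls_eq
        del: One_nat_def)
qed

lemma braid_sigma_braid:
  assumes "1 \<le> i" "i + 1 < n"
  shows "braid_sigma n i \<otimes>\<^bsub>braid_group n\<^esub> (braid_sigma n (i + 1) \<otimes>\<^bsub>braid_group n\<^esub> braid_sigma n i) =
    braid_sigma n (i + 1) \<otimes>\<^bsub>braid_group n\<^esub> (braid_sigma n i \<otimes>\<^bsub>braid_group n\<^esub> braid_sigma n (i + 1))"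
proof -
  interpret presentation "{1..<n}" "braid_relations n" by (rule braid_presentation)
  have "([(i, True), (i + 1, True), (i, True)], [(i + 1, True), (i, True), (i + 1, True)])
      \<in> braid_relations n"
    using assms unfolding braid_relations_def by blast
  from gword_rel[OF _ _ this, of "[]" "{1..<n}" "[]"] show ?thesis
    using assms by (simp add: braid_sigma_def presented_gen_def braid_group_def mult_cls cls_eq
        del: One_nat_def)
qed

lemma R_star_hom: "R_star \<in> hom (braid_group 4) (braid_group 3)"
  and R_star_sigma: "R_star (braid_sigma 4 1) = braid_sigma 3 1"
    "R_star (braid_sigma 4 2) = braid_sigma 3 2" "R_star (braid_sigma 4 3) = braid_sigma 3 1"
proof -
  interpret B: group "braid_group 3" by (rule group_braid_group)
  let ?f = "\<lambda>i::nat. braid_sigma 3 (if i = 2 then 2 else 1)"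
  have c: "?f i \<in> carrier (braid_group 3)" for i
    by (auto intro!: braid_sigma_carrier)
  have r: "gword_eval (braid_group 3) ?f r = gword_eval (braid_group 3) ?f s"
    if "(r, s) \<in> braid_relations 4" for r s
  proof -
    from that consider i j where "r = [(i, True), (j, True)]" "s = [(j, True), (i, True)]"
        "1 \<le> i" "i + 2 \<le> j" "j < 4"
      | i where "r = [(i, True), (i + 1, True), (i, True)]"
        "s = [(i + 1, True), (i, True), (i + 1, True)]" "1 \<le> i" "i + 1 < 4"
      unfolding braid_relations_def by blast
    then show ?thesis
    proof cases
      case 1
      then have "i = 1" "j = 3" by auto
      with 1 show ?thesis by simp
    next
      case 2
      then have "i = 1 \<or> i = 2" by auto
      with 2 show ?thesis
        using braid_sigma_braid[of 1 3] c[of 1] c[of 2] by (auto simp: numeral_2_eq_2)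
    qed
  qed
  note lift = presentation.presented_lift_hom[OF braid_presentation group_braid_group]
    presentation.presented_lift_gen[OF braid_presentation group_braid_group]
  show "R_star \<in> hom (braid_group 4) (braid_group 3)"
    unfolding R_star_def braid_group_def[of 4] by (rule lift(1)) (use c r in auto)
  have "R_star (braid_sigma 4 i) = ?f i" if "i \<in> {1..<4}" for i
    unfolding R_star_def braid_sigma_def[of 4] by (rule lift(2)) (use c r that in auto)
  from this[of 1] this[of 2] this[of 3]
  show "R_star (braid_sigma 4 1) = braid_sigma 3 1"
    "R_star (braid_sigma 4 2) = braid_sigma 3 2" "R_star (braid_sigma 4 3) = braid_sigma 3 1"
    by auto
qed

lemma braid_incl_3_4_hom: "braid_incl_3_4 \<in> hom (braid_group 3) (braid_group 4)"
  and braid_incl_3_4_sigma: "i \<in> {1, 2} \<Longrightarrow> braid_incl_3_4 (braid_sigma 3 i) = braid_sigma 4 i"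
proof -
  interpret B: group "braid_group 4" by (rule group_braid_group)
  have c: "braid_sigma 4 i \<in> carrier (braid_group 4)" if "i \<in> {1..<3}" for i
    using that by (auto intro!: braid_sigma_carrier)
  have r: "gword_eval (braid_group 4) (braid_sigma 4) r = gword_eval (braid_group 4) (braid_sigma 4) s"
    if "(r, s) \<in> braid_relations 3" for r s
  proof -
    from that have "r = [(1, True), (2, True), (1, True)]" "s = [(2, True), (1, True), (2, True)]"
      by (auto simp: braid_relations_def)
    then show ?thesis
      using braid_sigma_braid[of 1 4] c[of 1] c[of 2] by (simp add: numeral_2_eq_2)
  qed
  note lift = presentation.presented_lift_hom[OF braid_presentation group_braid_group]
    presentation.presented_lift_gen[OF braid_presentation group_braid_group]
  show "braid_incl_3_4 \<in> hom (braid_group 3) (braid_group 4)"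
    unfolding braid_incl_3_4_def braid_group_def[of 3] by (rule lift(1)) (use c r in auto)
  show "i \<in> {1, 2} \<Longrightarrow> braid_incl_3_4 (braid_sigma 3 i) = braid_sigma 4 i"
    unfolding braid_incl_3_4_def braid_sigma_def[of 3] by (rule lift(2)) (use c r in auto)
qed

end

(*
  The centre of B_4 is generated by Omega = alpha_4^4. Let P be the free product of three groups of
  order two, with generators U, V, W. The conjugates of alpha_4^2 by the powers of sigma_1 alpha_4
  embed P into B_4/<Omega> as the kernel of B_4/<Omega> -> PSL_2(Z); hence B_4 acts on P, with
  kernel <Omega>, and a braid in the kernel of B_4 -> PSL_2(Z) is a word of P up to <Omega>. Let phi
  be an endomorphism with phi(sigma_1) <> phi(sigma_2), and compare the images of the generators in
  SL_2(Z).

  If phi(sigma_1) and phi(sigma_2) have the same image S, then g = phi(sigma_1)^-1 phi(sigma_2) is a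
  nontrivial even word, and the braid relation reads A(A(g)) g = A(g) for the automorphism A of P
  induced by phi(sigma_1)^-1. Polynomial functions modulo m on the free group of even words (the
  coefficients of the Magnus expansion) do not see g when m divides tr(S)^2 - 4 and is prime to 3.
  This leaves tr(S) = 1 or -1; the second is excluded since the even words are torsion free, and the
  first leads to type (iii).

  Otherwise the braid relations force phi(sigma_1) and phi(sigma_3) to have the same image, and the
  image of phi(sigma_1 sigma_2) to be elliptic of order six, so that phi((sigma_1 sigma_2)^3) is an odd
  word fixed by phi(sigma_1) and phi(sigma_2). The length of a cyclic word is convex on the trivalent
  tree of PSL_2(Z); hence this word is conjugate to a power of the word W V U that represents
  (sigma_1 sigma_2)^3, whose stabilizer is B_3 up to <Omega>. If phi(sigma_1) = phi(sigma_3), this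
  gives type (ii). If not, phi(Omega) lies in <Omega>, phi maps the three involutions to conjugates of
  involutions of P, and comparing their product with W V U shows that phi is the identity up to an
  automorphism and <Omega>.
*)

theory Submission
  imports Defs "HOL-Library.Product_Plus" "HOL-Computational_Algebra.Primes"
begin

section \<open>Groups in multiplicative notation\<close>

text \<open>In the parallel case trace \<open>1\<close> cannot be excluded: the maps of type (iii)
  realise it with a nontrivial g. Every valid argument must let tr(S)^2 - 4 = -3 pass, and the
  exemption of 3 has this origin. The braid relation says that A^2 - A + 1 annihilates g in each
  degree of the polynomial functions. Modulo a divisor m of tr(S)^2 - 4, the square of the matrix of
  A is unipotent, so that A^2 - 1 acts nilpotently in each degree. The resultant of X^2 - X + 1 and
  X^2 - 1 is 3; if 3 is invertible modulo m, no polynomial function separates g from 1, whereas a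
  Magnus coefficient separates every nontrivial g. The even words form a free group F_2 of rank two,
  and P is F_2 extended by an involution that inverts a basis. B_4 acts on F_2 by automorphisms, and
  the matrix of a braid is its action on the abelianization of F_2. Questions on braids thus become
  computations with reduced words, modulo powers of Omega. Equality is recovered from equality
  modulo Omega by the exponent sum, which is 12 on Omega.\<close>

class mult_group = monoid_mult + inverse +
  assumes left_inv [simp]: "inverse x * x = 1"
begin

lemma right_inv [simp]: "x * inverse x = 1"
proof -
  have "x * inverse x = inverse (inverse x) * inverse x * (x * inverse x)"
    by simp
  also have "\<dots> = inverse (inverse x) * (inverse x * x) * inverse x"
    by (simp only: mult.assoc)
  finally show ?thesis by simp
qed

lemma inv_mult_cancel [simp]: "inverse x * (x * y) = y" "x * (inverse x * y) = y"
  by (simp_all flip: mult.assoc)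

lemma mult_left_cancel' [simp]: "x * y = x * z \<longleftrightarrow> y = z"
  by (metis inv_mult_cancel(1))

lemma mult_right_cancel' [simp]: "y * x = z * x \<longleftrightarrow> y = z"
  by (metis mult.assoc mult.right_neutral right_inv)

lemma inv_unique: "x * y = 1 \<Longrightarrow> inverse x = y"
  by (metis inv_mult_cancel(1) mult.right_neutral)

lemma inv_inv [simp]: "inverse (inverse x) = x"
  by (rule inv_unique) simp

lemma inv_mult [simp]: "inverse (x * y) = inverse y * inverse x"
  by (rule inv_unique) (simp add: mult.assoc)

lemma inv_one [simp]: "inverse 1 = 1"
  by (rule inv_unique) simp

lemma inv_eq_iff [simp]: "inverse x = inverse y \<longleftrightarrow> x = y"
  by (metis inv_inv)

lemma inv_eq_one [simp]: "inverse x = 1 \<longleftrightarrow> x = 1"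
  by (metis inv_inv inv_one)

lemma eq_mult_inv_iff: "x = y * inverse z \<longleftrightarrow> x * z = y"
  by (metis inv_mult_cancel(2) mult.assoc mult.right_neutral left_inv)

lemma eq_inv_mult_iff: "x = inverse z * y \<longleftrightarrow> z * x = y"
  by (metis inv_mult_cancel)

lemma inv_power: "inverse (x ^ n) = inverse x ^ n"
  by (induction n) (simp_all add: power_commutes)

lemma conj_power: "(y * x * inverse y) ^ n = y * x ^ n * inverse y"
  by (induction n) (simp_all add: mult.assoc)

lemma commute_inv: "x * y = y * x \<Longrightarrow> inverse x * y = y * inverse x"
  by (metis eq_mult_inv_iff inv_mult_cancel(1) mult.assoc)

end

locale group_morphism =
  fixes f :: "'a::mult_group \<Rightarrow> 'b::mult_group"
  assumes mult [simp]: "f (x * y) = f x * f y"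
begin

lemma one [simp]: "f 1 = 1"
  by (metis mult mult_1_right mult_left_cancel')

lemma inv [simp]: "f (inverse x) = inverse (f x)"
  by (metis inv_unique right_inv mult one)

lemma power [simp]: "f (x ^ n) = f x ^ n"
  by (induction n) auto

end

section \<open>Reduced words in three involutions\<close>

datatype letter = U | V | W

text \<open>Van der Waerden's trick: the letters act on the reduced lists by involutions, and a
  product is evaluated by letting its left factor act. Associativity then needs no confluence
  argument.\<close>

fun push :: "letter \<Rightarrow> letter list \<Rightarrow> letter list" where
  "push a [] = [a]"
| "push a (b # l) = (if a = b then l else a # b # l)"

lemma distinct_adj_push: "distinct_adj l \<Longrightarrow> distinct_adj (push a l)"
  by (cases l) (auto simp: distinct_adj_Cons)

lemma push_push: "distinct_adj l \<Longrightarrow> push a (push a l) = l"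
  by (cases l; cases "tl l") (auto simp: distinct_adj_Cons)

lemma push_reduced: "l = [] \<or> a \<noteq> hd l \<Longrightarrow> push a l = a # l"
  by (cases l) auto

lemma distinct_adj_foldr_push: "distinct_adj m \<Longrightarrow> distinct_adj (foldr push l m)"
  by (induction l) (auto intro: distinct_adj_push)

lemma foldr_push_push:
  "distinct_adj m \<Longrightarrow> foldr push (push a l) m = push a (foldr push l m)"
  by (cases l) (auto simp: push_push distinct_adj_foldr_push)

lemma foldr_push_assoc:
  "distinct_adj m \<Longrightarrow> foldr push (foldr push k l) m = foldr push k (foldr push l m)"
  by (induction k) (auto simp: foldr_push_push)

lemma foldr_push_Nil: "distinct_adj l \<Longrightarrow> foldr push l [] = l"
  by (induction l) (auto simp: push_reduced distinct_adj_Cons)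

lemma foldr_push_rev: "distinct_adj m \<Longrightarrow> foldr push (rev l) (foldr push l m) = m"
  by (induction l arbitrary: m) (auto simp: push_push distinct_adj_foldr_push)

text \<open>The free product of three groups of order two.\<close>

typedef rword = "{l :: letter list. distinct_adj l}"
  morphisms letters Abs_rword
  by (rule exI[of _ "[]"]) simp

setup_lifting type_definition_rword

instantiation rword :: mult_group
begin

lift_definition one_rword :: rword is "[]" by simp
lift_definition times_rword :: "rword \<Rightarrow> rword \<Rightarrow> rword" is "foldr push"
  by (rule distinct_adj_foldr_push)
lift_definition inverse_rword :: "rword \<Rightarrow> rword" is rev by simp

instance
proof
  fix x y z :: rword
  show "x * y * z = x * (y * z)" by transfer (rule foldr_push_assoc)
  show "1 * x = x" by transfer simp
  show "x * 1 = x" by transfer (simp add: foldr_push_Nil)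
  show "inverse x * x = 1" by transfer (metis foldr_push_Nil foldr_push_rev distinct_adj_Nil)
qed

end

lift_definition gen :: "letter \<Rightarrow> rword" is "\<lambda>a. [a]" by simp

definition wd :: "letter list \<Rightarrow> rword" where
  "wd l = prod_list (map gen l)"

lemma wd_simps [simp]: "wd [] = 1" "wd (a # l) = gen a * wd l" "wd (l @ m) = wd l * wd m"
  by (simp_all add: wd_def)

lemma distinct_adj_letters [simp]: "distinct_adj (letters x)"
  using letters by simp

lemma letters_one [simp]: "letters 1 = []" by transfer simp
lemma letters_gen [simp]: "letters (gen a) = [a]" by transfer simp
lemma letters_inverse [simp]: "letters (inverse x) = rev (letters x)" by transfer simp
lemma letters_mult: "letters (x * y) = foldr push (letters x) (letters y)" by transfer simp

lemma gen_gen [simp]: "gen a * gen a = 1" "gen a * (gen a * x) = x" "inverse (gen a) = gen a"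
proof -
  show 1: "gen a * gen a = 1" by transfer simp
  show "gen a * (gen a * x) = x" using 1 by (simp flip: mult.assoc)
  show "inverse (gen a) = gen a" using 1 by (rule inv_unique)
qed

lemma letters_gen_mult: "letters (gen a * x) = push a (letters x)"
  by (simp add: letters_mult)

lemma letters_wd: "letters (wd l) = foldr push l []"
  by (induction l) (simp_all add: letters_gen_mult)

lemma letters_wd_reduced: "distinct_adj l \<Longrightarrow> letters (wd l) = l"
  by (simp add: letters_wd foldr_push_Nil)

lemma wd_letters [simp]: "wd (letters x) = x"
  by (rule letters_inject[THEN iffD1]) (simp add: letters_wd_reduced)

lemma letters_eq_Nil [simp]: "letters x = [] \<longleftrightarrow> x = 1"
  by (metis letters_inject letters_one)

lemma rword_induct [case_names one gen]:
  assumes "P 1" "\<And>a x. P x \<Longrightarrow> P (gen a * x)"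
  shows "P x"
proof -
  have "P (wd l)" for l by (induction l) (auto intro: assms)
  then show ?thesis by (metis wd_letters)
qed

lemma wd_rev: "wd (rev l) = inverse (wd l)"
  by (induction l) simp_all

lemma wd_concat_replicate: "wd (concat (replicate n l)) = wd l ^ n"
  by (induction n) simp_all

section \<open>Parity, cyclically reduced words and roots\<close>

text \<open>The even words form the free group of rank two on \<open>V U\<close> and
  \<open>W U\<close>. Torsion freeness and uniqueness of roots hold only there, since P itself has
  involutions.\<close>

definition even_word :: "rword \<Rightarrow> bool" where
  "even_word x \<longleftrightarrow> even (length (letters x))"

lemma even_length_push: "even (length (push a l)) \<longleftrightarrow> odd (length l)"
  by (cases l) auto

lemma even_word_one [simp]: "even_word 1" by (simp add: even_word_def)
lemma even_word_gen [simp]: "\<not> even_word (gen a)" by (simp add: even_word_def)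
lemma even_word_gen_mult [simp]: "even_word (gen a * x) \<longleftrightarrow> \<not> even_word x"
  by (simp add: even_word_def letters_gen_mult even_length_push)
lemma even_word_mult [simp]: "even_word (x * y) \<longleftrightarrow> (even_word x \<longleftrightarrow> even_word y)"
  by (induction x rule: rword_induct) (auto simp: mult.assoc)
lemma even_word_inverse [simp]: "even_word (inverse x) \<longleftrightarrow> even_word x"
  by (simp add: even_word_def)
lemma even_word_wd: "even_word (wd l) \<longleftrightarrow> even (length l)"
  by (induction l) simp_all

definition cyc_reduced :: "letter list \<Rightarrow> bool" where
  "cyc_reduced l \<longleftrightarrow> distinct_adj l \<and> l \<noteq> [] \<and> hd l \<noteq> last l"

lemma last_concat_replicate:
  "n > 0 \<Longrightarrow> l \<noteq> [] \<Longrightarrow> last (concat (replicate n l)) = last l"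
  by (induction n) (auto simp: last_append)

lemma hd_concat_replicate: "n > 0 \<Longrightarrow> l \<noteq> [] \<Longrightarrow> hd (concat (replicate n l)) = hd l"
  by (cases n) auto

lemma cyc_reduced_concat_replicate:
  assumes "cyc_reduced l" "n > 0"
  shows "cyc_reduced (concat (replicate n l))"
  using assms(2)
proof (induction n)
  case (Suc n)
  show ?case
  proof (cases "n = 0")
    case False
    with Suc have IH: "cyc_reduced (concat (replicate n l))" by simp
    have l: "distinct_adj l" "l \<noteq> []" "hd l \<noteq> last l"
      using assms(1) by (auto simp: cyc_reduced_def)
    have "concat (replicate n l) \<noteq> []" using IH by (simp add: cyc_reduced_def)
    with IH l show ?thesis
      using False by (simp add: cyc_reduced_def distinct_adj_append_iff hd_concat_replicate
        last_concat_replicate)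
  qed (use assms in simp)
qed simp

lemma letters_cyc_power:
  assumes "cyc_reduced l"
  shows "letters (wd l ^ n) = concat (replicate n l)"
proof -
  have "distinct_adj (concat (replicate n l))"
    using cyc_reduced_concat_replicate[OF assms, of n] by (cases n) (auto simp: cyc_reduced_def)
  then show ?thesis
    by (metis letters_wd_reduced wd_concat_replicate)
qed

text \<open>Equal end letters are stripped in pairs. The process stops at a cyclically reduced word
  or at a single letter; in the latter case the word is an involution.\<close>

lemma cyclic_core:
  assumes "distinct_adj l" "l \<noteq> []"
  shows "\<exists>m c. l = m @ c @ rev m \<and> (cyc_reduced c \<or> length c = 1)"
  using assms
proof (induction l rule: length_induct)
  case (1 l)
  show ?case
  proof (cases "cyc_reduced l \<or> length l = 1")
    case True
    then show ?thesis by (intro exI[of _ "[]"] exI[of _ l]) simp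
  next
    case False
    with "1.prems" have eq: "hd l = last l" and "length l \<noteq> 1" by (auto simp: cyc_reduced_def)
    then obtain a t where l: "l = a # t" "t \<noteq> []" using "1.prems" by (cases l) auto
    then obtain s b where "t = s @ [b]" by (metis append_butlast_last_id)
    with l eq have l': "l = a # s @ [a]" by simp
    have s: "distinct_adj s" "s \<noteq> []"
      using "1.prems" unfolding l' by (auto simp: distinct_adj_Cons distinct_adj_append_iff)
    with "1.IH" l' obtain m c where "s = m @ c @ rev m" "cyc_reduced c \<or> length c = 1"
      by (metis length_Cons length_append_singleton less_Suc_eq)
    then show ?thesis using l' by (intro exI[of _ "a # m"] exI[of _ c]) simp
  qed
qed

text \<open>Stripping removes letters in pairs, so parity excludes a core of length one.\<close>

lemma even_core:
  assumes "even_word x" "x \<noteq> 1"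
  obtains m c where "letters x = m @ c @ rev m" "cyc_reduced c" "x = wd m * wd c * inverse (wd m)"
proof -
  obtain m c where mc: "letters x = m @ c @ rev m" "cyc_reduced c \<or> length c = 1"
    using cyclic_core[of "letters x"] assms by auto
  have "length c \<noteq> 1"
  proof
    assume "length c = 1"
    then have "odd (length (letters x))" using mc by simp
    then show False using assms by (simp add: even_word_def)
  qed
  with mc have "cyc_reduced c" by simp
  moreover have "x = wd m * wd c * inverse (wd m)"
    by (metis mc(1) wd_letters wd_simps(3) wd_rev mult.assoc)
  ultimately show thesis using mc that by blast
qed

text \<open>The only new junctions in the power are those between two copies of \<open>c\<close>,
  and nothing cancels there.\<close>

lemma cyc_core_power:
  assumes red: "distinct_adj (m @ c @ rev m)" and c: "cyc_reduced c" and "n > 0"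
  shows "letters ((wd m * wd c * inverse (wd m)) ^ n) = m @ concat (replicate n c) @ rev m"
proof -
  let ?c = "concat (replicate n c)"
  have "cyc_reduced ?c" using c \<open>n > 0\<close> by (rule cyc_reduced_concat_replicate)
  then have d: "distinct_adj ?c" "?c \<noteq> []" by (auto simp: cyc_reduced_def)
  have c': "c \<noteq> []" using c by (simp add: cyc_reduced_def)
  have "distinct_adj (m @ ?c @ rev m)"
    using red d c' \<open>n > 0\<close>
    by (auto simp: distinct_adj_append_iff hd_concat_replicate last_concat_replicate
        simp del: concat_eq_Nil_conv)
  then have "letters (wd (m @ ?c @ rev m)) = m @ ?c @ rev m" by (rule letters_wd_reduced)
  moreover have "wd (m @ ?c @ rev m) = (wd m * wd c * inverse (wd m)) ^ n"
    unfolding conj_power by (simp add: wd_concat_replicate wd_rev mult.assoc)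
  ultimately show ?thesis by simp
qed

lemma even_word_torsion_free:
  assumes "even_word x" "x ^ n = 1" "n > 0"
  shows "x = 1"
proof (rule ccontr)
  assume "x \<noteq> 1"
  with assms(1) obtain m c where mc: "letters x = m @ c @ rev m" "cyc_reduced c"
    "x = wd m * wd c * inverse (wd m)" by (rule even_core)
  have "letters (x ^ n) = m @ concat (replicate n c) @ rev m"
    unfolding mc(3) by (rule cyc_core_power) (use mc assms in \<open>auto simp flip: mc(1)\<close>)
  moreover have "cyc_reduced (concat (replicate n c))"
    using cyc_reduced_concat_replicate mc assms by blast
  ultimately show False using assms by (auto simp: cyc_reduced_def)
qed

lemma concat_replicate_inject:
  assumes "concat (replicate n l) = concat (replicate n m)" "n > 0"
  shows "l = m"
proof -
  have "length (concat (replicate n l)) = length (concat (replicate n m))" using assms by simp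
  then have "length l = length m" using assms(2) by (simp add: length_concat sum_list_replicate)
  moreover obtain k where "n = Suc k" using assms(2) by (cases n) auto
  ultimately show ?thesis using assms(1) by simp
qed

text \<open>A root with a nonempty conjugating prefix passes this prefix on to a nontrivial power,
  and a one-letter root has no powers but \<open>1\<close> and itself. Neither is cyclically
  reduced.\<close>

lemma cyc_reduced_root:
  assumes "cyc_reduced l" "distinct_adj k" "wd k ^ n = wd l" "n > 0"
  shows "cyc_reduced k \<and> l = concat (replicate n k)"
proof -
  have l: "letters (wd l) = l" using assms(1) by (simp add: cyc_reduced_def letters_wd_reduced)
  have "k \<noteq> []" using assms l by (auto simp: cyc_reduced_def)
  obtain m c where mc: "k = m @ c @ rev m" "cyc_reduced c \<or> length c = 1"
    using cyclic_core[OF assms(2) \<open>k \<noteq> []\<close>] by blast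
  have k: "wd k = wd m * wd c * inverse (wd m)" by (simp add: mc wd_rev mult.assoc)
  have "m = []"
  proof (rule ccontr)
    assume "m \<noteq> []"
    have "\<exists>s. l = m @ s @ rev m"
    proof (cases "cyc_reduced c")
      case True
      then have "letters (wd k ^ n) = m @ concat (replicate n c) @ rev m"
        unfolding k using assms mc by (intro cyc_core_power) auto
      then show ?thesis using assms(3) l by auto
    next
      case False
      with mc obtain a where "c = [a]" by (auto simp: length_Suc_conv)
      then have kk: "wd k * wd k = 1" unfolding k by (simp add: mult.assoc)
      have "wd k ^ n = (if even n then 1 else wd k)"
        by (induction n) (use kk in auto)
      then have "wd l = 1 \<or> wd l = wd k" using assms(3) by (auto split: if_splits)
      then have "l = [] \<or> l = k" using l assms(2) by (metis letters_wd_reduced letters_one)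
      then show ?thesis using assms(1) mc(1) by (auto simp: cyc_reduced_def)
    qed
    then show False using assms(1) \<open>m \<noteq> []\<close> by (auto simp: cyc_reduced_def last_rev)
  qed
  with mc have "k = c" by simp
  have "cyc_reduced k"
  proof (rule ccontr)
    assume "\<not> cyc_reduced k"
    with mc \<open>k = c\<close> obtain a where "k = [a]" by (auto simp: length_Suc_conv)
    then have "wd k ^ n = (if even n then 1 else wd k)" by (induction n) auto
    then have "wd l = 1 \<or> wd l = wd [a]" using assms(3) \<open>k = [a]\<close> by (auto split: if_splits)
    then have "l = [] \<or> l = [a]" using l by (metis letters_wd_reduced letters_one distinct_adj_singleton)
    then show False using assms(1) by (auto simp: cyc_reduced_def)
  qed
  moreover have "l = concat (replicate n k)"
    using letters_cyc_power[OF calculation, of n] assms(3) l by simp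
  ultimately show ?thesis by simp
qed

text \<open>After a conjugation the word \<open>c\<close> of \<open>x\<close> is cyclically reduced,
  so the word of the power is literally a repetition of \<open>c\<close>; cutting it into
  \<open>n\<close> equal blocks recovers the root.\<close>

lemma even_word_root_unique:
  assumes "even_word x" "even_word y" "x ^ n = y ^ n" "n > 0"
  shows "x = y"
proof (cases "x = 1")
  case True
  then show ?thesis using assms even_word_torsion_free[of y n] by simp
next
  case False
  with assms(1) obtain m c where mc: "letters x = m @ c @ rev m" "cyc_reduced c"
    "x = wd m * wd c * inverse (wd m)" by (rule even_core)
  let ?y = "inverse (wd m) * y * wd m"
  have y: "?y ^ n = wd c ^ n"
  proof -
    have "?y ^ n = inverse (wd m) * y ^ n * wd m" using conj_power[of "inverse (wd m)" y n] by simp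
    also have "y ^ n = wd m * wd c ^ n * inverse (wd m)" using assms(3) mc(3) conj_power by metis
    finally show ?thesis by (simp add: mult.assoc)
  qed
  have "cyc_reduced (concat (replicate n c))"
    using cyc_reduced_concat_replicate mc assms by blast
  then have "cyc_reduced (letters ?y) \<and> concat (replicate n c) = concat (replicate n (letters ?y))"
    by (rule cyc_reduced_root) (simp_all add: y wd_concat_replicate assms(4))
  then have "c = letters ?y" using concat_replicate_inject[OF _ \<open>n > 0\<close>] by blast
  then have "wd c = ?y" by simp
  then show ?thesis using mc(3) by (simp add: mult.assoc)
qed

section \<open>Commuting words\<close>

text \<open>Both products have the same reduced word, hence the same length, so cancellation occurs
  in both or in neither. Without cancellation the two concatenations are equal as lists.\<close>

lemma commuting_cancel:
  assumes x: "distinct_adj x" "x \<noteq> []" and y: "distinct_adj y" "y \<noteq> []"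
    and comm: "wd x * wd y = wd y * wd x"
  shows "last x = hd y \<longleftrightarrow> last y = hd x"
    and "last x \<noteq> hd y \<Longrightarrow> x @ y = y @ x"
proof -
  have cancel: "length (letters (wd a * wd b)) < length a + length b"
    if ab: "a \<noteq> []" "b \<noteq> []" "last a = hd b" for a b
  proof -
    obtain h b' where b': "b = h # b'" using ab by (cases b) auto
    then obtain a' where a': "a = a' @ [h]" using ab by (metis append_butlast_last_id list.sel(1))
    have "wd a * wd b = wd (a' @ b')" unfolding a' b' by (simp add: mult.assoc)
    then have "length (letters (wd a * wd b)) = length (foldr push (a' @ b') [])"
      by (simp only: letters_wd)
    also have "\<dots> \<le> length (a' @ b')"
    proof -
      have "length (foldr push l []) \<le> length l" for l
      proof (induction l)
        case (Cons z l)
        have "length (push z k) \<le> Suc (length k)" for k by (cases k) auto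
        from this[of "foldr push l []"] Cons show ?case by simp
      qed simp
      then show ?thesis .
    qed
    also have "\<dots> < length a + length b" unfolding a' b' by simp
    finally show ?thesis .
  qed
  have append: "letters (wd a * wd b) = a @ b"
    if "last a \<noteq> hd b" "distinct_adj a" "distinct_adj b" for a b
    using that letters_wd_reduced[of "a @ b"] by (simp add: distinct_adj_append_iff)
  have swap: "last y = hd x" if "last x = hd y" "distinct_adj x" "distinct_adj y" "x \<noteq> []" "y \<noteq> []"
    "wd x * wd y = wd y * wd x" for x y
  proof (rule ccontr)
    assume "last y \<noteq> hd x"
    then have "length (letters (wd x * wd y)) = length y + length x"
      using that append[of y x] by simp
    then show False using cancel[of x y] that by simp
  qed
  show iff: "last x = hd y \<longleftrightarrow> last y = hd x"
    using swap[of x y] swap[of y x] x y comm by auto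
  show "x @ y = y @ x" if "last x \<noteq> hd y"
  proof -
    have "letters (wd x * wd y) = x @ y" using append that x y by simp
    moreover have "letters (wd y * wd x) = y @ x" using append that iff x y by simp
    ultimately show ?thesis using comm by simp
  qed
qed

text \<open>If \<open>x y\<close> or \<open>x y^-1\<close> is reduced as written, the two lists
  commute and are repetitions of one list. Otherwise all four ends are one and the same letter, and
  conjugating by it shortens the pair unless both words are that letter.\<close>

lemma commuting_roots:
  fixes x y :: rword
  assumes "x * y = y * x"
  shows "\<exists>d i j. x = d ^ i \<and> (y = d ^ j \<or> y = inverse d ^ j)"
  using assms
proof (induction "length (letters x) + length (letters y)" arbitrary: x y rule: less_induct)
  case less
  let ?x = "letters x" and ?y = "letters y"
  have trivial: ?case if "y = 1"
    using that by (intro exI[of _ x] exI[of _ 1] exI[of _ 0]) auto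
  have trivial': ?case if "x = 1"
    using that by (intro exI[of _ y] exI[of _ 0] exI[of _ 1]) auto
  show ?case
  proof (cases "x = 1 \<or> y = 1")
    case True
    then show ?thesis using trivial trivial' by blast
  next
    case False
    then have ne: "?x \<noteq> []" "?y \<noteq> []" by auto
    have comm: "wd ?x * wd ?y = wd ?y * wd ?x" using less.prems by simp
    have comm': "wd ?x * wd (rev ?y) = wd (rev ?y) * wd ?x"
      using commute_inv[OF less.prems[symmetric]] by (simp add: wd_rev)
    note c = commuting_cancel[OF _ ne(1) _ ne(2) comm]
    have c': "last ?x = last ?y \<longleftrightarrow> hd ?y = hd ?x" "last ?x \<noteq> last ?y \<Longrightarrow> ?x @ rev ?y = rev ?y @ ?x"
      using commuting_cancel[OF _ ne(1) _ _ comm'] ne by (auto simp: hd_rev last_rev)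
    have root: "\<exists>d i j. wd l = d ^ i \<and> wd m = d ^ j" if "l @ m = m @ l" for l m
    proof -
      obtain i j zs where "concat (replicate i zs) = l" "concat (replicate j zs) = m"
        using comm_append_are_replicate[OF \<open>l @ m = m @ l\<close>] by auto
      then show ?thesis by (metis wd_concat_replicate)
    qed
    consider "last ?x \<noteq> hd ?y" | "last ?x \<noteq> last ?y" | "last ?x = hd ?y" "last ?x = last ?y" by blast
    then show ?thesis
    proof cases
      case 1
      then show ?thesis using root[of ?x ?y] c by auto
    next
      case 2
      then obtain d i j where "x = d ^ i" "inverse y = d ^ j"
        using root[of ?x "rev ?y"] c' by (auto simp: wd_rev)
      then show ?thesis by (metis inv_inv inv_power)
    next
      case 3
      define a where "a = hd ?x"
      have a: "hd ?x = a" "last ?x = a" using 3 c' a_def by auto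
      let ?x' = "gen a * x * gen a" and ?y' = "gen a * y * gen a"
      have len: "z = gen a \<or> length (letters (gen a * z * gen a)) < length (letters z)"
        if z: "hd (letters z) = a" "last (letters z) = a" "letters z \<noteq> []" for z
      proof (cases "length (letters z) = 1")
        case True
        then have "letters z = letters (gen a)" using z by (cases "letters z") auto
        then show ?thesis by (metis letters_inject)
      next
        case False
        obtain t where t: "letters z = a # t" using z by (metis list.exhaust_sel)
        with False have "t \<noteq> []" by auto
        with z t obtain s where s: "letters z = a # s @ [a]"
          by (metis append_butlast_last_id last_ConsR)
        have "z = wd (a # s @ [a])" by (metis s wd_letters)
        then have "gen a * z * gen a = wd s" by (simp add: mult.assoc)
        moreover have "distinct_adj s"
          using distinct_adj_letters[of z] unfolding s
          by (auto simp: distinct_adj_Cons distinct_adj_append_iff)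
        ultimately have "letters (gen a * z * gen a) = s" by (simp add: letters_wd_reduced)
        then show ?thesis using s by simp
      qed
      have ax: "x = gen a \<or> length (letters ?x') < length ?x" using len[of x] a ne by blast
      have ay: "y = gen a \<or> length (letters ?y') < length ?y" using len[of y] a 3 c' ne by auto
      show ?thesis
      proof (cases "x = gen a \<and> y = gen a")
        case True
        then show ?thesis by (intro exI[of _ "gen a"] exI[of _ 1]) auto
      next
        case False
        have le: "length (letters (gen a * gen a * gen a)) = length (letters (gen a))" by simp
        have "length (letters ?x') + length (letters ?y') < length ?x + length ?y"
          using ax ay False le by (metis add_less_mono add_strict_left_mono add_strict_right_mono)
      note len = this
      have "x * (y * t) = y * (x * t)" for t using less.prems by (simp flip: mult.assoc)
      then have "?x' * ?y' = ?y' * ?x'" by (simp add: mult.assoc)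
      with less.hyps[OF len] obtain d i j where "?x' = d ^ i" "?y' = d ^ j \<or> ?y' = inverse d ^ j"
        by blast
      moreover have "(gen a * d * gen a) ^ n = gen a * d ^ n * gen a" for d n
        using conj_power[of "gen a" d n] by simp
      moreover have "x = gen a * ?x' * gen a" "y = gen a * ?y' * gen a"
        by (simp_all add: mult.assoc)
      moreover have "inverse (gen a * d * gen a) = gen a * inverse d * gen a" for d
        by (simp add: mult.assoc)
      ultimately show ?thesis by metis
      qed
    qed
  qed
qed

text \<open>\<open>x\<close> and \<open>c\<close> are powers of one \<open>d\<close> up to sign. As
  \<open>c\<close> is fixed and nontrivial, \<open>f\<close> fixes \<open>d ^ j\<close> for some
  \<open>j > 0\<close>, hence also \<open>x ^ j\<close>; roots of even words being unique, it fixes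
  \<open>x\<close>.\<close>

lemma fixed_by_morphism:
  assumes f: "group_morphism f" and ev: "\<And>x. even_word (f x) \<longleftrightarrow> even_word x"
    and c: "f c = c" "c \<noteq> 1" and x: "even_word x" "x * c = c * x"
  shows "f x = x"
proof -
  interpret group_morphism f by fact
  obtain d i j where d: "x = d ^ i" and "c = d ^ j \<or> c = inverse d ^ j"
    using commuting_roots[OF x(2)] by blast
  then have "d ^ j = c \<or> d ^ j = inverse c" by (metis inv_inv inv_power)
  then have fj: "f d ^ j = d ^ j" and j: "j > 0"
    using c by (auto simp flip: power intro: Nat.gr0I)
  have "f x ^ j = x ^ j"
    using d fj by (metis power power_mult mult.commute)
  then show ?thesis using even_word_root_unique[of "f x" x j] ev x j by simp
qed

section \<open>Polynomial functions on words and automorphisms of order six\<close>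

text \<open>Functions of degree less than \<open>k\<close> modulo \<open>m\<close> on the group of
  even words: all \<open>k\<close>-fold differences vanish modulo \<open>m\<close>. Only the values
  on even words are looked at.\<close>

primrec pol :: "int \<Rightarrow> nat \<Rightarrow> (rword \<Rightarrow> int) \<Rightarrow> bool" where
  "pol m 0 f \<longleftrightarrow> (\<forall>x. even_word x \<longrightarrow> m dvd f x)"
| "pol m (Suc k) f \<longleftrightarrow> (\<forall>h. even_word h \<longrightarrow> pol m k (\<lambda>x. f (x * h) - f x))"

lemma pol_cong: "(\<And>x. even_word x \<Longrightarrow> f x = g x) \<Longrightarrow> pol m k f = pol m k g"
proof (induction k arbitrary: f g)
  case (Suc k)
  have "pol m k (\<lambda>x. f (x * h) - f x) = pol m k (\<lambda>x. g (x * h) - g x)" if "even_word h" for h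
    using that Suc.prems by (intro Suc.IH) simp
  then show ?case by simp
qed simp

lemma pol_add: "pol m k f \<Longrightarrow> pol m k g \<Longrightarrow> pol m k (\<lambda>x. f x + g x)"
proof (induction k arbitrary: f g)
  case (Suc k)
  have "pol m k (\<lambda>x. (f (x * h) - f x) + (g (x * h) - g x))" if "even_word h" for h
    using Suc that by auto
  then show ?case by (simp add: algebra_simps)
qed simp

lemma pol_scale: "pol m k f \<Longrightarrow> pol m k (\<lambda>x. c * f x)"
proof (induction k arbitrary: f)
  case (Suc k)
  have "pol m k (\<lambda>x. c * (f (x * h) - f x))" if "even_word h" for h
    using Suc that by auto
  then show ?case by (simp add: algebra_simps)
qed simp

lemma pol_diff: "pol m k f \<Longrightarrow> pol m k g \<Longrightarrow> pol m k (\<lambda>x. f x - g x)"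
  using pol_add[of m k f "\<lambda>x. - 1 * g x"] pol_scale[of m k g "- 1"] by simp

lemma pol_multiple: "m dvd c \<Longrightarrow> pol m k (\<lambda>x. c * f x)"
proof (induction k arbitrary: f)
  case (Suc k)
  have "pol m k (\<lambda>x. c * (f (x * h) - f x))" if "even_word h" for h
    using Suc that by auto
  then show ?case by (simp add: algebra_simps)
qed simp

lemma pol_comp:
  assumes "group_morphism \<tau>" and ev: "\<And>x. even_word (\<tau> x) \<longleftrightarrow> even_word x"
  shows "pol m k f \<Longrightarrow> pol m k (\<lambda>x. f (\<tau> x))"
proof (induction k arbitrary: f)
  case 0
  then show ?case using ev by simp
next
  case (Suc k)
  interpret group_morphism \<tau> by fact
  have "pol m k (\<lambda>x. f (\<tau> x * \<tau> h) - f (\<tau> x))" if "even_word h" for h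
    using Suc.IH[of "\<lambda>x. f (x * \<tau> h) - f x"] Suc.prems that ev by simp
  then show ?case by simp
qed

section \<open>The Magnus expansion of the free group of even words\<close>

text \<open>A formal power series in noncommuting variables is given by its coefficients; \<open>mul_plus a\<close> is
  left multiplication by \<open>1 + a\<close>.\<close>

definition mul_plus :: "letter \<Rightarrow> (letter list \<Rightarrow> int) \<Rightarrow> letter list \<Rightarrow> int" where
  "mul_plus a P w = P w + (case w of [] \<Rightarrow> 0 | b # t \<Rightarrow> if a = b then P t else 0)"

fun mul_plus_inv :: "letter \<Rightarrow> (letter list \<Rightarrow> int) \<Rightarrow> letter list \<Rightarrow> int" where
  "mul_plus_inv a P [] = P []"
| "mul_plus_inv a P (b # t) = P (b # t) - (if a = b then mul_plus_inv a P t else 0)"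

definition mul_letter :: "bool \<Rightarrow> letter \<Rightarrow> (letter list \<Rightarrow> int) \<Rightarrow> letter list \<Rightarrow> int" where
  "mul_letter s a = (if s then mul_plus a else mul_plus_inv a)"

lemma mul_letter_inverse: "mul_letter s a (mul_letter (\<not> s) a P) = P"
proof -
  have 1: "mul_plus_inv a (mul_plus a P) w = P w" for w
    by (induction w) (auto simp: mul_plus_def)
  have 2: "mul_plus a (mul_plus_inv a P) w = P w" for w
    by (cases w) (auto simp: mul_plus_def)
  show ?thesis using 1 2 by (cases s) (auto simp: mul_letter_def)
qed

lemma mul_letter_diff:
  "mul_letter s a (\<lambda>w. P w - Q w) = (\<lambda>w. mul_letter s a P w - mul_letter s a Q w)"
proof
  fix w
  show "mul_letter s a (\<lambda>w. P w - Q w) w = mul_letter s a P w - mul_letter s a Q w"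
    by (induction w; cases s) (auto simp: mul_letter_def mul_plus_def)
qed

definition order_ge :: "nat \<Rightarrow> (letter list \<Rightarrow> int) \<Rightarrow> bool" where
  "order_ge j P \<longleftrightarrow> (\<forall>w. length w < j \<longrightarrow> P w = 0)"

lemma order_ge_mul_letter:
  assumes "order_ge j P"
  shows "order_ge j (mul_letter s a P)" "order_ge (Suc j) (\<lambda>w. mul_letter s a P w - P w)"
proof -
  have 0: "mul_letter s a P w = 0" if "length w < j" for w
    using that assms
    by (induction w; cases s) (auto simp: mul_letter_def mul_plus_def order_ge_def)
  then show "order_ge j (mul_letter s a P)" by (simp add: order_ge_def)
  have "mul_letter s a P w = P w" if "length w < Suc j" for w
    using that assms 0
    by (cases w; cases s) (auto simp: mul_letter_def mul_plus_def order_ge_def)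
  then show "order_ge (Suc j) (\<lambda>w. mul_letter s a P w - P w)" by (simp add: order_ge_def)
qed

text \<open>The Magnus representation of the free group of even words: a word \<open>a b c d \<dots>\<close> acts as
  \<open>(1 + a) (1 + b)\<^sup>-\<^sup>1 (1 + c) (1 + d)\<^sup>-\<^sup>1 \<dots>\<close>, which respects the cancellation of equal neighbours.\<close>

fun magnus_list :: "bool \<Rightarrow> letter list \<Rightarrow> (letter list \<Rightarrow> int) \<Rightarrow> letter list \<Rightarrow> int" where
  "magnus_list s [] P = P"
| "magnus_list s (a # l) P = mul_letter s a (magnus_list (\<not> s) l P)"

definition magnus :: "bool \<Rightarrow> rword \<Rightarrow> (letter list \<Rightarrow> int) \<Rightarrow> letter list \<Rightarrow> int" where
  "magnus s x = magnus_list s (letters x)"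

lemma magnus_one [simp]: "magnus s 1 P = P" by (simp add: magnus_def)

lemma magnus_gen: "magnus s (gen a * x) P = mul_letter s a (magnus (\<not> s) x P)"
proof -
  have "magnus_list s (push a l) P = mul_letter s a (magnus_list (\<not> s) l P)" for l
    using mul_letter_inverse[of s a] by (cases l) auto
  then show ?thesis by (simp add: magnus_def letters_gen_mult)
qed

lemma magnus_mult:
  "magnus s (x * y) P = magnus s x (magnus (if even_word x then s else \<not> s) y P)"
  by (induction x arbitrary: s rule: rword_induct) (simp_all add: magnus_gen mult.assoc)

lemma magnus_diff:
  "magnus s x (\<lambda>w. P w - Q w) = (\<lambda>w. magnus s x P w - magnus s x Q w)"
  by (induction x arbitrary: s rule: rword_induct) (simp_all add: magnus_gen mul_letter_diff)

lemma order_ge_magnus: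
  assumes "order_ge j P"
  shows "order_ge j (magnus s x P)" "order_ge (Suc j) (\<lambda>w. magnus s x P w - P w)"
proof (induction x arbitrary: s rule: rword_induct)
  case one
  case 1 show ?case using assms by simp
  case 2 show ?case by (simp add: order_ge_def)
next
  case (gen a x)
  case 1 show ?case using gen order_ge_mul_letter by (simp add: magnus_gen)
  case 2
  have "order_ge (Suc j) (\<lambda>w. mul_letter s a (magnus (\<not> s) x P) w - magnus (\<not> s) x P w)"
    using gen order_ge_mul_letter by blast
  with gen(2)[of "\<not> s"] show ?case by (simp add: magnus_gen order_ge_def)
qed

text \<open>The difference along \<open>h\<close> replaces the series \<open>P\<close> by
  \<open>h P - P\<close>, whose order is larger by one. After \<open>k\<close> differences the order
  exceeds the length of \<open>w\<close>.\<close>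

lemma pol_magnus:
  "order_ge j P \<Longrightarrow> length w < j + k \<Longrightarrow> pol m k (\<lambda>x. magnus True x P w)"
proof (induction k arbitrary: j P)
  case 0
  then show ?case using order_ge_magnus(1)[OF 0(1)] by (simp add: order_ge_def)
next
  case (Suc k)
  have "pol m k (\<lambda>x. magnus True (x * h) P w - magnus True x P w)" if "even_word h" for h
  proof -
    have "pol m k (\<lambda>x. magnus True x (\<lambda>w. magnus True h P w - P w) w)"
      using order_ge_magnus(2) Suc.prems by (intro Suc.IH[of "Suc j"]) auto
    then show ?thesis
      by (subst pol_cong) (auto simp: magnus_mult magnus_diff)
  qed
  then show ?case by simp
qed

definition unit_series :: "letter list \<Rightarrow> int" where
  "unit_series w = (if w = [] then 1 else 0)"

text \<open>A word contributes to the coefficient at an index word of its own length only through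
  the linear terms \<open>a\<close> or \<open>- a\<close> of all its factors. The coefficient of a
  reduced word at itself is therefore a unit modulo every \<open>m\<close>.\<close>

lemma magnus_leading:
  "distinct_adj w \<Longrightarrow> length l < length w \<Longrightarrow> magnus_list s l unit_series w = 0"
  "distinct_adj w \<Longrightarrow> \<bar>magnus_list s w unit_series w\<bar> = 1"
proof -
  \<comment> \<open>As neighbours in the index word differ, only the terms \<open>1 - a\<close> of
    the series \<open>(1 + a)^-1 = 1 - a + a^2 - ...\<close> can contribute.\<close>
  have red: "mul_letter s a P (b # t) = P (b # t) + (if a = b then (if s then 1 else - 1) * P t else 0)"
    if "distinct_adj (b # t)" for s a b t P
    using that by (cases t; cases s) (auto simp: mul_letter_def mul_plus_def)
  show 1: "magnus_list s l unit_series w = 0" if "distinct_adj w" "length l < length w" for l w s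
    using that
  proof (induction l arbitrary: w s)
    case Nil
    then show ?case by (auto simp: unit_series_def)
  next
    case (Cons a l)
    then obtain b t where w: "w = b # t" by (cases w) auto
    then have "distinct_adj t" using Cons.prems by (auto simp: distinct_adj_Cons)
    with Cons w red show ?case by auto
  qed
  show "\<bar>magnus_list s w unit_series w\<bar> = 1" if "distinct_adj w"
    using that
  proof (induction w arbitrary: s)
    case Nil
    then show ?case by (simp add: unit_series_def)
  next
    case (Cons a w)
    then have "distinct_adj w" by (auto simp: distinct_adj_Cons)
    then show ?case using Cons red[OF Cons.prems] 1[OF Cons.prems, of w] by simp
  qed
qed

section \<open>The abelianization of the even words\<close>

text \<open>The letter \<open>a\<close> acts on the plane as the point reflection through half of \<open>letter_vec a\<close>;
  even words act as translations.\<close>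

fun letter_vec :: "letter \<Rightarrow> int \<times> int" where
  "letter_vec U = (0, 0)" | "letter_vec V = (1, 0)" | "letter_vec W = (0, 1)"

fun list_vec :: "letter list \<Rightarrow> int \<times> int" where
  "list_vec [] = (0, 0)"
| "list_vec (a # l) = letter_vec a - list_vec l"

definition word_vec :: "rword \<Rightarrow> int \<times> int" where
  "word_vec x = list_vec (letters x)"

lemma word_vec_one [simp]: "word_vec 1 = 0" by (simp add: word_vec_def zero_prod_def)

lemma word_vec_gen_mult [simp]: "word_vec (gen a * x) = letter_vec a - word_vec x"
proof -
  have "list_vec (push a l) = letter_vec a - list_vec l" for l by (cases l) auto
  then show ?thesis by (simp add: word_vec_def letters_gen_mult)
qed

lemma word_vec_gen [simp]: "word_vec (gen a) = letter_vec a"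
  using word_vec_gen_mult[of a 1] by simp

lemma word_vec_mult:
  "word_vec (x * y) = word_vec x + (if even_word x then word_vec y else - word_vec y)"
  by (induction x rule: rword_induct) (auto simp: mult.assoc)

lemma word_vec_inverse: "even_word x \<Longrightarrow> word_vec (inverse x) = - word_vec x"
  using word_vec_mult[of "inverse x" x] by (simp add: eq_neg_iff_add_eq_0)

lemma even_word_induct [consumes 1, case_names one gen]:
  assumes "even_word x" "P 1" "\<And>a b x. even_word x \<Longrightarrow> P x \<Longrightarrow> P (gen a * gen b * x)"
  shows "P x"
proof -
  have "P (wd l)" if "even (length l)" for l
    using that
  proof (induction l rule: induct_list012)
    case (3 a b l)
    then show ?case using assms(3)[of "wd l" a b] by (simp add: even_word_wd mult.assoc)
  qed (use assms in auto)
  from this[of "letters x"] show ?thesis using assms(1) by (simp add: even_word_def)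
qed

definition pol_eq :: "int \<Rightarrow> nat \<Rightarrow> (rword \<Rightarrow> int) \<Rightarrow> (rword \<Rightarrow> int) \<Rightarrow> bool" where
  "pol_eq m k f g \<longleftrightarrow> pol m k (\<lambda>x. f x - g x)"

lemma pol_eq_refl [simp]: "pol_eq m k f f"
  using pol_multiple[of m 0 k] by (simp add: pol_eq_def)

lemma pol_eq_sym: "pol_eq m k f g \<Longrightarrow> pol_eq m k g f"
  unfolding pol_eq_def using pol_scale[of m k "\<lambda>x. f x - g x" "- 1"] by simp

lemma pol_eq_trans [trans]: "pol_eq m k f g \<Longrightarrow> pol_eq m k g h \<Longrightarrow> pol_eq m k f h"
  unfolding pol_eq_def using pol_add[of m k "\<lambda>x. f x - g x" "\<lambda>x. g x - h x"] by simp

lemma pol_eq_add: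
  "pol_eq m k f g \<Longrightarrow> pol_eq m k f' g' \<Longrightarrow> pol_eq m k (\<lambda>x. f x + f' x) (\<lambda>x. g x + g' x)"
  unfolding pol_eq_def using pol_add[of m k "\<lambda>x. f x - g x" "\<lambda>x. f' x - g' x"]
  by (simp add: algebra_simps)

lemma pol_eq_pol: "pol_eq m k f g \<Longrightarrow> pol m k g \<Longrightarrow> pol m k f"
  unfolding pol_eq_def using pol_add[of m k "\<lambda>x. f x - g x" g] by simp

definition shift_diff :: "rword \<Rightarrow> (rword \<Rightarrow> int) \<Rightarrow> rword \<Rightarrow> int" where
  "shift_diff h f x = f (x * h) - f x"

lemma pol_shift_diff: "pol m (Suc k) f \<Longrightarrow> even_word h \<Longrightarrow> pol m k (shift_diff h f)"
  by (simp add: shift_diff_def[abs_def])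

lemma pol_SucI: "(\<And>h. even_word h \<Longrightarrow> pol m k (shift_diff h f)) \<Longrightarrow> pol m (Suc k) f"
  by (simp add: shift_diff_def[abs_def])

text \<open>The discrepancy is a second difference, which lowers the degree by two.\<close>

lemma shift_diff_mult:
  assumes "pol m (Suc (Suc k)) f" "even_word h" "even_word h'"
  shows "pol_eq m k (shift_diff (h * h') f) (\<lambda>x. shift_diff h f x + shift_diff h' f x)"
proof -
  have "pol m k (shift_diff h (shift_diff h' f))"
    using assms by (intro pol_shift_diff)
  moreover have "shift_diff (h * h') f x - (shift_diff h f x + shift_diff h' f x)
      = shift_diff h (shift_diff h' f) x" for x
    by (simp add: shift_diff_def mult.assoc)
  ultimately show ?thesis by (simp add: pol_eq_def)
qed

text \<open>Modulo lower degree the difference is additive in \<open>h\<close>, so it depends only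
  on the class of \<open>h\<close> in the abelianization; \<open>V U\<close> and \<open>W U\<close>
  have the vectors \<open>(1, 0)\<close> and \<open>(0, 1)\<close>.\<close>

lemma shift_diff_word_vec:
  assumes f: "pol m (Suc (Suc k)) f" and h: "even_word h"
  shows "pol_eq m k (shift_diff h f)
    (\<lambda>x. fst (word_vec h) * shift_diff (gen V * gen U) f x
        + snd (word_vec h) * shift_diff (gen W * gen U) f x)"
proof -
  let ?v = "gen V * gen U" and ?w = "gen W * gen U"
  let ?L = "\<lambda>i j x. i * shift_diff ?v f x + j * shift_diff ?w f x"
  have add: "pol_eq m k (shift_diff (h * h') f) (?L (i + i') (j + j'))"
    if "even_word h" "even_word h'" "pol_eq m k (shift_diff h f) (?L i j)"
      "pol_eq m k (shift_diff h' f) (?L i' j')" for h h' i i' j j'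
  proof -
    have "pol_eq m k (shift_diff (h * h') f) (\<lambda>x. shift_diff h f x + shift_diff h' f x)"
      using shift_diff_mult f that by blast
    also have "pol_eq m k \<dots> (\<lambda>x. ?L i j x + ?L i' j' x)" using that by (intro pol_eq_add)
    finally show ?thesis by (simp add: algebra_simps)
  qed
  have one: "pol_eq m k (shift_diff 1 f) (?L 0 0)" by (simp add: shift_diff_def[abs_def])
  have inv: "pol_eq m k (shift_diff (inverse h) f) (?L (- i) (- j))"
    if "even_word h" "pol_eq m k (shift_diff h f) (?L i j)" for h i j
  proof -
    have "pol_eq m k (\<lambda>x. shift_diff h f x + shift_diff (inverse h) f x) (shift_diff 1 f)"
      using pol_eq_sym[OF shift_diff_mult[OF f, of h "inverse h"]] that by simp
    also have "pol_eq m k \<dots> (?L 0 0)" by (rule one)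
    finally have "pol_eq m k (\<lambda>x. shift_diff h f x + shift_diff (inverse h) f x) (?L 0 0)" .
    moreover have "pol_eq m k (\<lambda>x. - 1 * shift_diff h f x) (\<lambda>x. - 1 * ?L i j x)"
      using pol_scale[of m k "\<lambda>x. shift_diff h f x - ?L i j x" "- 1"] that
      by (simp add: pol_eq_def algebra_simps)
    ultimately have "pol_eq m k (\<lambda>x. (shift_diff h f x + shift_diff (inverse h) f x)
        + - 1 * shift_diff h f x) (\<lambda>x. ?L 0 0 x + - 1 * ?L i j x)"
      by (rule pol_eq_add)
    then show ?thesis by (simp add: algebra_simps)
  qed
  have v: "pol_eq m k (shift_diff ?v f) (?L 1 0)" and w: "pol_eq m k (shift_diff ?w f) (?L 0 1)"
    by simp_all
  have "pol_eq m k (shift_diff (gen V * gen U * inverse (gen W * gen U)) f) (?L (1 + - 0) (0 + - 1))"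
    by (intro add inv v w) simp_all
  then have vw: "pol_eq m k (shift_diff (gen V * gen W) f) (?L 1 (- 1))"
    by (simp add: mult.assoc)
  have pair: "pol_eq m k (shift_diff (gen a * gen b) f)
      (?L (fst (word_vec (gen a * gen b))) (snd (word_vec (gen a * gen b))))" for a b
  proof (cases "a = b")
    case True
    then show ?thesis using one by simp
  next
    case False
    then show ?thesis
      using v w vw inv[OF _ v] inv[OF _ w] inv[OF _ vw] by (cases a; cases b) simp_all
  qed
  show ?thesis
    using h
  proof (induction h rule: even_word_induct)
    case one
    show ?case using \<open>pol_eq m k (shift_diff 1 f) (?L 0 0)\<close> by simp
  next
    case (gen a b x)
    from add[OF _ this(1) pair[of a b] this(2)] show ?case
      by (simp add: word_vec_mult[of "gen a * gen b" x])
  qed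
qed

section \<open>Polynomial functions and automorphisms with a given trace\<close>

locale even_automorphism = group_morphism A for A :: "rword \<Rightarrow> rword" +
  fixes a b c d :: int
  assumes even [simp]: "even_word (A x) \<longleftrightarrow> even_word x"
    and vec: "even_word x \<Longrightarrow> word_vec (A x) =
      (a * fst (word_vec x) + b * snd (word_vec x), c * fst (word_vec x) + d * snd (word_vec x))"
    and det: "a * d - b * c = 1"
begin

definition sq_diff :: "(rword \<Rightarrow> int) \<Rightarrow> rword \<Rightarrow> int" where
  "sq_diff f x = f (A (A x)) - f x"

lemma pol_A: "pol m k f \<Longrightarrow> pol m k (\<lambda>x. f (A x))"
  by (rule pol_comp) (simp_all add: group_morphism_axioms)

lemma pol_sq_diff: "pol m k f \<Longrightarrow> pol m k (sq_diff f)"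
  unfolding sq_diff_def[abs_def]
  by (rule pol_diff[OF pol_A[OF pol_A, of m k f]]) simp_all

lemma pol_sq_diff_funpow: "pol m k f \<Longrightarrow> pol m k ((sq_diff ^^ n) f)"
  by (induction n) (auto intro: pol_sq_diff)

lemma pol_eq_sq_diff: "pol_eq m k f g \<Longrightarrow> pol_eq m k (sq_diff f) (sq_diff g)"
  unfolding pol_eq_def using pol_sq_diff[of m k "\<lambda>x. f x - g x"]
  by (simp add: sq_diff_def[abs_def] algebra_simps)

text \<open>The displacement of \<open>h\<close> under the square of \<open>A\<close>; on the
  abelianization it is the matrix \<open>A^2 - 1\<close>.\<close>

definition defect :: "rword \<Rightarrow> rword" where
  "defect h = inverse h * A (A h)"

lemma even_defect [simp]: "even_word (defect h)"
  by (simp add: defect_def)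

text \<open>A twisted Leibniz rule: the square of \<open>A\<close> turns the shift by
  \<open>h\<close> into the shift by \<open>h * defect h\<close>, and shifts add up modulo lower
  degree.\<close>

lemma shift_diff_sq_diff:
  assumes "pol m (Suc (Suc k)) f" "even_word h"
  shows "pol_eq m k (shift_diff h (sq_diff f))
    (\<lambda>x. sq_diff (shift_diff h f) x + shift_diff (defect h) f (A (A x)))"
proof -
  have "pol_eq m k (shift_diff (h * defect h) f) (\<lambda>x. shift_diff h f x + shift_diff (defect h) f x)"
    using assms by (intro shift_diff_mult) simp_all
  then have "pol m k (\<lambda>x. shift_diff (A (A h)) f (A (A x))
      - (shift_diff h f (A (A x)) + shift_diff (defect h) f (A (A x))))"
    unfolding pol_eq_def
    using pol_A[OF pol_A, of m k "\<lambda>x. shift_diff (A (A h)) f x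
      - (shift_diff h f x + shift_diff (defect h) f x)"]
    by (simp add: defect_def)
  then show ?thesis
    by (simp add: pol_eq_def shift_diff_def sq_diff_def algebra_simps)
qed

lemma shift_diff_sq_diff_commute:
  assumes "pol m (Suc (Suc k)) f" "even_word h" "pol m k (shift_diff (defect h) f)"
  shows "pol_eq m k (shift_diff h (sq_diff f)) (sq_diff (shift_diff h f))"
proof -
  have "pol m k (\<lambda>x. shift_diff (defect h) f (A (A x)))" using assms(3) by (intro pol_A pol_A)
  then have "pol_eq m k (\<lambda>x. sq_diff (shift_diff h f) x + shift_diff (defect h) f (A (A x)))
      (sq_diff (shift_diff h f))"
    by (simp add: pol_eq_def)
  with shift_diff_sq_diff[OF assms(1,2)] show ?thesis by (rule pol_eq_trans)
qed

text \<open>Cayley-Hamilton for determinant one: \<open>A^2 - 1 = t A - 2\<close> with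
  \<open>t = a + d\<close>.\<close>

lemma vec_defect:
  assumes "even_word h"
  shows "word_vec (defect h) =
    ((a + d) * (a * fst (word_vec h) + b * snd (word_vec h)) - 2 * fst (word_vec h),
     (a + d) * (c * fst (word_vec h) + d * snd (word_vec h)) - 2 * snd (word_vec h))"
proof -
  have "word_vec (defect h) = word_vec (A (A h)) - word_vec h"
    using assms by (simp add: defect_def word_vec_mult word_vec_inverse)
  moreover have "b * c = a * d - 1" "c * b = a * d - 1" using det by (auto simp: algebra_simps)
  then have "b * (c * z) = (a * d - 1) * z" "c * (b * z) = (a * d - 1) * z" for z
    by (metis mult.assoc)+
  ultimately show ?thesis
    using assms by (cases "word_vec h") (simp add: vec algebra_simps)
qed

text \<open>If \<open>m\<close> divides \<open>tr\<^sup>2 - 4\<close>, then the square of the matrix of \<open>A\<close> is unipotent modulo \<open>m\<close>.\<close>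

lemma vec_defect_defect:
  assumes "even_word h" "m dvd (a + d)^2 - 4"
  shows "m dvd fst (word_vec (defect (defect h)))" "m dvd snd (word_vec (defect (defect h)))"
proof -
  obtain x y where xy: "word_vec h = (x, y)" by force
  have bc: "b * c = a * d - 1" using det by simp
  \<comment> \<open>Cayley-Hamilton once more: \<open>(A^2 - 1)^2 = (t^2 - 4) (t A - 1)\<close>. The
    second summand vanishes by \<open>bc\<close>; with it the equation is a polynomial identity in
    the entries.\<close>
  have "fst (word_vec (defect (defect h))) = ((a + d)^2 - 4) * ((a + d) * (a * x + b * y) - x)
      + (a + d)^2 * (b * c - (a * d - 1)) * x"
    using assms(1) by (simp add: vec_defect xy) (simp add: algebra_simps power2_eq_square)
  moreover have "snd (word_vec (defect (defect h))) = ((a + d)^2 - 4) * ((a + d) * (c * x + d * y) - y)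
      + (a + d)^2 * (b * c - (a * d - 1)) * y"
    using assms(1) by (simp add: vec_defect xy) (simp add: algebra_simps power2_eq_square)
  ultimately show "m dvd fst (word_vec (defect (defect h)))" "m dvd snd (word_vec (defect (defect h)))"
    using assms(2) bc by auto
qed

text \<open>Differences along \<open>defect (defect h)\<close> lose an extra degree, because the
  vector of this word is divisible by \<open>m\<close>. Hence \<open>sq_diff\<close> commutes,
  modulo lower degree, with differences along \<open>defect h\<close>, and \<open>N\<close>
  applications kill these by induction. From then on it commutes with differences along every
  \<open>h\<close>, and \<open>N\<close> further applications kill those too.\<close>

lemma sq_diff_nilpotent:
  assumes m: "m dvd (a + d)^2 - 4"
  shows "\<exists>N. \<forall>f. pol m (Suc k) f \<longrightarrow> pol m k ((sq_diff ^^ N) f)"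
proof (induction k)
  case 0
  have "pol m 0 (sq_diff f)" if "pol m (Suc 0) f" for f
  proof -
    have f: "m dvd f h - f 1" if "even_word h" for h
    proof -
      have "\<forall>x. even_word x \<longrightarrow> m dvd f (x * h) - f x"
        using \<open>pol m (Suc 0) f\<close> that by simp
      from this[rule_format, of 1] show ?thesis by simp
    qed
    have "m dvd (f (A (A x)) - f 1) - (f x - f 1)" if "even_word x" for x
      using dvd_diff[OF f[of "A (A x)"] f[of x]] that by simp
    then show ?thesis by (simp add: sq_diff_def)
  qed
  then show ?case by (intro exI[of _ 1]) simp
next
  case (Suc k)
  then obtain N where N: "\<And>f. pol m (Suc k) f \<Longrightarrow> pol m k ((sq_diff ^^ N) f)" by blast
  have "pol m (Suc k) ((sq_diff ^^ (N + N)) f)" if f: "pol m (Suc (Suc k)) f" for f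
  proof -
    have N': "pol m k ((sq_diff ^^ n) g)" if "pol m (Suc k) g" "n \<ge> N" for g n
    proof -
      have "(sq_diff ^^ n) g = (sq_diff ^^ (n - N + N)) g" using \<open>n \<ge> N\<close> by simp
      also have "\<dots> = (sq_diff ^^ (n - N)) ((sq_diff ^^ N) g)"
        by (simp only: funpow_add comp_apply)
      finally have "(sq_diff ^^ n) g = (sq_diff ^^ (n - N)) ((sq_diff ^^ N) g)" .
      then show ?thesis using N[OF that(1)] pol_sq_diff_funpow by simp
    qed
    have ker: "pol m k (shift_diff (defect (defect h)) g)"
      if "even_word h" "pol m (Suc (Suc k)) g" for g h
    proof -
      let ?h = "defect (defect h)"
      have "pol m k (\<lambda>x. fst (word_vec ?h) * shift_diff (gen V * gen U) g x
        + snd (word_vec ?h) * shift_diff (gen W * gen U) g x)"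
        using vec_defect_defect[OF that(1) m] by (intro pol_add pol_multiple)
      with shift_diff_word_vec[OF that(2), of ?h] show ?thesis by (auto intro: pol_eq_pol)
    qed
    have 1: "pol_eq m k (shift_diff (defect h) ((sq_diff ^^ n) f)) ((sq_diff ^^ n) (shift_diff (defect h) f))"
      if "even_word h" for h n
    proof (induction n)
      case (Suc n)
      have "pol_eq m k (shift_diff (defect h) (sq_diff ((sq_diff ^^ n) f)))
          (sq_diff (shift_diff (defect h) ((sq_diff ^^ n) f)))"
        using that f by (intro shift_diff_sq_diff_commute ker pol_sq_diff_funpow) simp_all
      also have "pol_eq m k \<dots> (sq_diff ((sq_diff ^^ n) (shift_diff (defect h) f)))"
        using Suc.IH by (rule pol_eq_sq_diff)
      finally show ?case by simp
    qed simp
    have 2: "pol m k (shift_diff (defect h) ((sq_diff ^^ n) f))" if "even_word h" "n \<ge> N" for h n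
      using f that by (intro pol_eq_pol[OF 1] N' pol_shift_diff) simp_all
    have 3: "pol_eq m k (shift_diff h ((sq_diff ^^ n) ((sq_diff ^^ N) f)))
        ((sq_diff ^^ n) (shift_diff h ((sq_diff ^^ N) f)))" if "even_word h" for h n
    proof (induction n)
      case (Suc n)
      have "pol m k (shift_diff (defect h) ((sq_diff ^^ n) ((sq_diff ^^ N) f)))"
        using 2[OF that, of "n + N"] by (simp add: funpow_add)
      then have "pol_eq m k (shift_diff h (sq_diff ((sq_diff ^^ n) ((sq_diff ^^ N) f))))
          (sq_diff (shift_diff h ((sq_diff ^^ n) ((sq_diff ^^ N) f))))"
        using that f by (intro shift_diff_sq_diff_commute pol_sq_diff_funpow) simp_all
      also have "pol_eq m k \<dots> (sq_diff ((sq_diff ^^ n) (shift_diff h ((sq_diff ^^ N) f))))"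
        using Suc.IH by (rule pol_eq_sq_diff)
      finally show ?case by simp
    qed simp
    have "pol m k (shift_diff h ((sq_diff ^^ N) ((sq_diff ^^ N) f)))" if "even_word h" for h
      using f that by (intro pol_eq_pol[OF 3] N pol_shift_diff pol_sq_diff_funpow) simp_all
    then show ?thesis by (intro pol_SucI) (simp add: funpow_add)
  qed
  then show ?case by blast
qed

text \<open>Let \<open>X\<close> be composition with \<open>A\<close>. Since
  \<open>f (x * g) - f x\<close> has smaller degree, the relation for \<open>g\<close> makes the
  functional \<open>f g - f 1\<close> vanish on \<open>(X^2 - X + 1) f\<close> modulo
  \<open>m\<close>. As \<open>sq_diff\<close>, that is \<open>X^2 - 1\<close>, becomes nilpotent,
  one can descend through its powers as soon as \<open>3\<close> is invertible modulo
  \<open>m\<close>.\<close>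

lemma order_six_pol:
  assumes m: "m dvd (a + d)^2 - 4" "coprime m 3"
    and g: "even_word g" "A (A g) * g = A g"
  shows "pol m k f \<Longrightarrow> m dvd f g - f 1"
proof (induction k arbitrary: f)
  case 0
  then show ?case using g(1) by (auto intro!: dvd_diff)
next
  case (Suc k)
  let ?e = "\<lambda>f. f g - f 1"
  have rec: "m dvd ?e (\<lambda>x. f (A (A x))) - ?e (\<lambda>x. f (A x)) + ?e f" if "pol m (Suc k) f" for f
  proof -
    have "pol m k (shift_diff g f)" using that g by (intro pol_shift_diff)
    then have "m dvd ?e (\<lambda>x. shift_diff g f (A (A x)))" by (intro Suc.IH pol_A)
    then have "m dvd - (f (A g) - f (A (A g)) - (f g - f 1))"
      unfolding dvd_minus_iff by (simp add: shift_diff_def g(2))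
    then show ?thesis by (simp add: algebra_simps)
  qed
  have A: "(sq_diff ^^ n) (\<lambda>x. f (A x)) = (\<lambda>x. (sq_diff ^^ n) f (A x))" for n f
    by (induction n) (auto simp: sq_diff_def[abs_def])
  have descend: "\<forall>f. pol m (Suc k) f \<longrightarrow> m dvd ?e f"
    if "\<forall>f. pol m (Suc k) f \<longrightarrow> m dvd ?e ((sq_diff ^^ n) f)" for n
    using that
  proof (induction n)
    case (Suc n)
    have "m dvd ?e ((sq_diff ^^ n) f)" if f: "pol m (Suc k) f" for f
    proof -
      let ?F = "(sq_diff ^^ n) f"
      have F: "pol m (Suc k) ?F" using f by (rule pol_sq_diff_funpow)
      have 1: "m dvd ?e (sq_diff ?F)" using Suc.prems f by simp
      have 2: "m dvd ?e (sq_diff (\<lambda>x. ?F (A x)))"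
        using Suc.prems[rule_format, OF pol_A[OF f]] A[of n f] by simp
      note 3 = rec[OF F] and 4 = rec[OF pol_A[OF F]]
      have "m dvd 3 * ?e ?F"
      proof -
        \<comment> \<open>This is the identity
          \<open>3 = (X + 2) (X^2 - X + 1) - (X + 1) (X^2 - 1)\<close>, read with \<open>X\<close>
          as composition with \<open>A\<close>.\<close>
        have "3 * ?e ?F = (?e (\<lambda>x. ?F (A (A x))) - ?e (\<lambda>x. ?F (A x)) + ?e ?F)
          + (?e (\<lambda>x. ?F (A (A x))) - ?e (\<lambda>x. ?F (A x)) + ?e ?F)
          + (?e (\<lambda>x. ?F (A (A (A x)))) - ?e (\<lambda>x. ?F (A (A x))) + ?e (\<lambda>x. ?F (A x)))
          - ?e (sq_diff ?F) - ?e (sq_diff (\<lambda>x. ?F (A x)))"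
          by (simp add: sq_diff_def)
        then show ?thesis using 1 2 3 4 by (metis dvd_add dvd_diff)
      qed
      then show ?thesis using m(2) by (metis coprime_dvd_mult_right_iff)
    qed
    then show ?case using Suc.IH by blast
  qed simp
  obtain N where "\<And>f. pol m (Suc k) f \<Longrightarrow> pol m k ((sq_diff ^^ N) f)"
    using sq_diff_nilpotent[OF m(1)] by blast
  with Suc.IH have "\<forall>f. pol m (Suc k) f \<longrightarrow> m dvd ?e ((sq_diff ^^ N) f)" by blast
  from descend[OF this] Suc.prems show ?case by blast
qed

text \<open>The Magnus coefficient at the word of \<open>g\<close> is polynomial, vanishes at
  \<open>1\<close> if \<open>g\<close> is nontrivial, and is a unit at \<open>g\<close>.\<close>

lemma order_six_trivial:
  assumes "m dvd (a + d)^2 - 4" "coprime m 3" "\<bar>m\<bar> \<noteq> 1"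
    and g: "even_word g" "A (A g) * g = A g"
  shows "g = 1"
proof (rule ccontr)
  assume "g \<noteq> 1"
  let ?w = "letters g"
  have "pol m (Suc (length ?w)) (\<lambda>x. magnus True x unit_series ?w)"
    by (rule pol_magnus[of 0]) (simp_all add: order_ge_def)
  with assms g have "m dvd magnus True g unit_series ?w - magnus True 1 unit_series ?w"
    using order_six_pol by blast
  moreover have "magnus True 1 unit_series ?w = 0"
    using \<open>g \<noteq> 1\<close> by (simp add: unit_series_def)
  moreover have "\<bar>magnus True g unit_series ?w\<bar> = 1"
    unfolding magnus_def by (rule magnus_leading) simp
  ultimately have "m dvd 1" by (metis diff_zero dvd_abs_iff)
  with assms(3) show False by simp
qed

theorem order_six_trace:
  assumes g: "even_word g" "A (A g) * g = A g" "g \<noteq> 1"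
  shows "a + d = 1 \<or> a + d = - 1"
proof (rule ccontr)
  assume t: "\<not> (a + d = 1 \<or> a + d = - 1)"
  have fac: "(a + d)^2 - 4 = (a + d - 2) * (a + d + 2)" by (simp add: power2_eq_square algebra_simps)
  have *: "\<not> (m dvd (a + d)^2 - 4 \<and> coprime m 3 \<and> \<bar>m\<bar> \<noteq> 1)" for m
    using order_six_trivial[of m g] g by blast
  have cop: "coprime x 3" if "\<not> 3 dvd x" for x :: int
    using prime_imp_coprime[of "3::int" x] that by (simp add: coprime_commute)
  show False
  proof (cases "even (a + d)")
    case True
    then have "2 dvd (a + d)^2 - 4" by simp
    moreover have "coprime 2 (3::int)" by (simp add: cop)
    ultimately show False using *[of 2] by simp
  next
    case False
    \<comment> \<open>The factors differ by \<open>4\<close>, so they are not both multiples of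
      \<open>3\<close>. If one of them is a unit, the trace is \<open>1\<close>, \<open>-1\<close>,
      \<open>3\<close> or \<open>-3\<close>; for the last two the other factor is \<open>5\<close>
      or \<open>-5\<close>, which is not allowed either.\<close>
    have "3 dvd a + d - 2 \<or> \<bar>a + d - 2\<bar> = 1" "3 dvd a + d + 2 \<or> \<bar>a + d + 2\<bar> = 1"
      using *[of "a + d - 2"] *[of "a + d + 2"] fac cop by auto
    with t False show False by presburger
  qed
qed

end

section \<open>Conjugacy and cyclic words\<close>

definition ext :: "(letter \<Rightarrow> 'a::mult_group) \<Rightarrow> rword \<Rightarrow> 'a" where
  "ext h x = prod_list (map h (letters x))"

lemma ext_one [simp]: "ext h 1 = 1" by (simp add: ext_def)
lemma ext_gen [simp]: "ext h (gen a) = h a" by (simp add: ext_def)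

lemma ext_gen_mult:
  assumes "\<And>a. h a * h a = 1"
  shows "ext h (gen a * x) = h a * ext h x"
proof -
  have "prod_list (map h (push a l)) = h a * prod_list (map h l)" for l
    using assms by (cases l) (auto simp flip: mult.assoc)
  then show ?thesis by (simp add: ext_def letters_gen_mult)
qed

lemma ext_morphism:
  assumes "\<And>a. h a * h a = 1"
  shows "group_morphism (ext h)"
proof
  fix x y
  show "ext h (x * y) = ext h x * ext h y"
    by (induction x rule: rword_induct) (simp_all add: ext_gen_mult assms mult.assoc)
qed

section \<open>Two automorphisms of the free product, of order three and of infinite order\<close>

fun nxt :: "letter \<Rightarrow> letter" where
  "nxt U = V" | "nxt V = W" | "nxt W = U"

lemma nxt_simps [simp]: "nxt (nxt (nxt a)) = a" "nxt a \<noteq> a" "nxt (nxt a) \<noteq> a" "a \<noteq> nxt a"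
    "a \<noteq> nxt (nxt a)" "nxt a = nxt b \<longleftrightarrow> a = b"
  by (cases a; cases b; simp)+

lemma nxt_cases: "b = a \<or> b = nxt a \<or> b = nxt (nxt a)"
  by (cases a; cases b) auto

text \<open>Conjugation by \<open>alpha_4\<close> on the three involutions, up to the centre; the
  rotation \<open>nxt\<close> is conjugation by \<open>sigma_1 alpha_4\<close>.\<close>

fun alpha_letter :: "letter \<Rightarrow> rword" where
  "alpha_letter U = gen U" | "alpha_letter V = gen W" | "alpha_letter W = gen U * gen V * gen U"

definition rot :: "rword \<Rightarrow> rword" where "rot = ext (\<lambda>a. gen (nxt a))"
definition flip :: "rword \<Rightarrow> rword" where "flip = ext alpha_letter"

interpretation rot: group_morphism rot
  unfolding rot_def by (rule ext_morphism) simp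

interpretation flip: group_morphism flip
  unfolding flip_def
proof (rule ext_morphism)
  show "alpha_letter a * alpha_letter a = 1" for a by (cases a) (simp_all add: mult.assoc)
qed

lemma rot_gen [simp]: "rot (gen a) = gen (nxt a)" by (simp add: rot_def)
lemma flip_gen [simp]: "flip (gen a) = alpha_letter a" by (simp add: flip_def)

lemma rot_wd: "rot (wd l) = wd (map nxt l)"
  by (induction l) simp_all

lemma distinct_adj_map_nxt [simp]: "distinct_adj (map nxt l) \<longleftrightarrow> distinct_adj l"
  by (rule distinct_adj_map_iff) (simp add: inj_on_def)

lemma letters_rot: "letters (rot x) = map nxt (letters x)"
proof -
  have "rot x = wd (map nxt (letters x))" by (metis rot_wd wd_letters)
  then show ?thesis by (simp add: letters_wd_reduced)
qed

lemma rot_rot_rot [simp]: "rot (rot (rot x)) = x"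
  by (induction x rule: rword_induct) simp_all

text \<open>A cocycle of the group of order three generated by \<open>rot\<close> is a coboundary.
  Unless the last letter of \<open>x\<close> is the rotated first one, the triple product is reduced
  as written and nontrivial; otherwise one letter moves into \<open>m\<close> and \<open>x\<close>
  gets shorter.\<close>

lemma order_three_word:
  assumes "x * rot x * rot (rot x) = 1"
  shows "\<exists>m. x = m * inverse (rot m)"
  using assms
proof (induction "length (letters x)" arbitrary: x rule: less_induct)
  case less
  let ?x = "letters x"
  show ?case
  proof (cases "x = 1")
    case True
    then show ?thesis by (intro exI[of _ 1]) simp
  next
    case False
    then have ne: "?x \<noteq> []" by simp
    have eq: "last ?x = nxt (hd ?x)"
    proof (rule ccontr)
      assume no: "last ?x \<noteq> nxt (hd ?x)"
      have "distinct_adj (?x @ map nxt ?x @ map nxt (map nxt ?x))"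
        using ne no by (auto simp: distinct_adj_append_iff hd_map last_map simp del: map_map)
      moreover have "wd (?x @ map nxt ?x @ map nxt (map nxt ?x)) = 1"
        using less.prems by (simp add: mult.assoc del: map_map flip: letters_rot)
      ultimately have "?x @ map nxt ?x @ map nxt (map nxt ?x) = []"
        by (metis letters_one letters_wd_reduced)
      then show False using ne by simp
    qed
    define a where "a = hd ?x"
    obtain t where t: "?x = a # t" using ne a_def by (metis list.exhaust_sel)
    have "t \<noteq> []" using eq t by auto
    then obtain s where s: "?x = a # s @ [nxt a]"
      using eq t by (metis append_butlast_last_id last_ConsR list.sel(1))
    let ?y = "gen a * x * gen (nxt a)"
    have "x = wd (a # s @ [nxt a])" by (metis s wd_letters)
    then have y: "?y = wd s" by (simp add: mult.assoc)
    have "distinct_adj s"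
      using distinct_adj_letters[of x] unfolding s
      by (auto simp: distinct_adj_Cons distinct_adj_append_iff)
    then have "length (letters ?y) < length ?x" using y s by (simp add: letters_wd_reduced)
    moreover have "?y * rot ?y * rot (rot ?y) = gen a * (x * rot x * rot (rot x)) * gen a"
      by (simp add: mult.assoc)
    then have "?y * rot ?y * rot (rot ?y) = 1" using less.prems by simp
    ultimately obtain m where m: "?y = m * inverse (rot m)" using less.hyps by blast
    have "x = gen a * ?y * gen (nxt a)" by (simp add: mult.assoc)
    also have "\<dots> = gen a * m * inverse (rot (gen a * m))" unfolding m by (simp add: mult.assoc)
    finally have "x = gen a * m * inverse (rot (gen a * m))" .
    then show ?thesis by blast
  qed
qed

lemma odd_palindrome:
  "rev l = l \<Longrightarrow> odd (length l) \<Longrightarrow> \<exists>m a. l = m @ [a] @ rev m"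
proof (induction l rule: length_induct)
  case (1 l)
  show ?case
  proof (cases "length l = 1")
    case True
    then obtain a where "l = [a]" by (auto simp: length_Suc_conv)
    then show ?thesis by (intro exI[of _ "[]"]) simp
  next
    case False
    obtain a t where l: "l = a # t" using 1(3) by (cases l) auto
    with False have "t \<noteq> []" by auto
    then obtain s b where t: "t = s @ [b]" by (metis append_butlast_last_id)
    have "rev (a # s @ [b]) = a # s @ [b]" using 1(2) unfolding l t .
    moreover have "rev (a # s @ [b]) = b # (rev s @ [a])" by simp
    ultimately have "b # (rev s @ [a]) = a # (s @ [b])" by (rule trans[OF sym, rotated])
    then have "a = b" "rev s = s" by (metis list.inject append1_eq_conv)+
    moreover have "odd (length s)" using 1(3) unfolding l t by simp
    moreover have "length s < length l" using l t by simp
    ultimately obtain m c where "s = m @ [c] @ rev m" using 1(1) by blast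
    then show ?thesis using l t \<open>a = b\<close> by (intro exI[of _ "a # m"]) simp
  qed
qed

text \<open>An involution is its own inverse, so its reduced word is a palindrome, and odd length
  gives it a middle letter.\<close>

lemma odd_involution:
  assumes "x * x = 1" "\<not> even_word x"
  shows "\<exists>m a. letters x = m @ [a] @ rev m"
proof (rule odd_palindrome)
  show "rev (letters x) = letters x" using inv_unique[OF assms(1)] by (metis letters_inverse)
  show "odd (length (letters x))" using assms(2) by (simp add: even_word_def)
qed

section \<open>Conjugacy classes as cyclic words\<close>

definition conj_words :: "rword \<Rightarrow> rword \<Rightarrow> bool" where
  "conj_words x y \<longleftrightarrow> (\<exists>m. y = m * x * inverse m)"

lemma conj_words_refl [simp]: "conj_words x x"
  unfolding conj_words_def by (rule exI[of _ 1]) simp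

lemma conj_words_sym: "conj_words x y \<Longrightarrow> conj_words y x"
  unfolding conj_words_def
proof (elim exE)
  fix m assume "y = m * x * inverse m"
  then have "x = inverse m * y * inverse (inverse m)" by (simp add: mult.assoc)
  then show "\<exists>m. x = m * y * inverse m" by blast
qed

lemma conj_words_trans [trans]: "conj_words x y \<Longrightarrow> conj_words y z \<Longrightarrow> conj_words x z"
  unfolding conj_words_def
proof (elim exE)
  fix m n assume "y = m * x * inverse m" "z = n * y * inverse n"
  then have "z = (n * m) * x * inverse (n * m)" by (simp add: mult.assoc)
  then show "\<exists>m. z = m * x * inverse m" by blast
qed

lemma conj_words_morphism: "group_morphism f \<Longrightarrow> conj_words x y \<Longrightarrow> conj_words (f x) (f y)"
  unfolding conj_words_def by (metis group_morphism.inv group_morphism.mult)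

lemma conj_words_power: "conj_words x y \<Longrightarrow> conj_words (x ^ n) (y ^ n)"
  unfolding conj_words_def using conj_power by metis

lemma conj_words_rotate1: "conj_words (wd l) (wd (rotate1 l))"
proof (cases l)
  case (Cons a t)
  then have "wd (rotate1 l) = gen a * wd l * inverse (gen a)" by (simp add: mult.assoc)
  then show ?thesis unfolding conj_words_def by blast
qed simp

lemma conj_words_rotate: "conj_words (wd l) (wd (rotate n l))"
  by (induction n) (auto intro: conj_words_trans conj_words_rotate1)

lemma cyc_reduced_rotate1:
  assumes "cyc_reduced l"
  shows "cyc_reduced (rotate1 l)"
proof (cases l)
  case (Cons a t)
  then have "t \<noteq> []" using assms by (auto simp: cyc_reduced_def)
  then show ?thesis using assms Cons
    by (cases t) (auto simp: cyc_reduced_def distinct_adj_Cons distinct_adj_append_iff hd_append)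
qed (use assms in \<open>simp add: cyc_reduced_def\<close>)

lemma cyc_reduced_rotate: "cyc_reduced l \<Longrightarrow> cyc_reduced (rotate n l)"
  by (induction n) (auto intro: cyc_reduced_rotate1)

text \<open>The conjugator is consumed from its inner end: a letter that cancels against an end of
  \<open>l\<close> merely rotates \<open>l\<close>. If it does not cancel, the conjugate is reduced
  as written and has equal ends, so it is not cyclically reduced.\<close>

lemma cyc_reduced_conj:
  assumes "cyc_reduced l" "cyc_reduced k" "conj_words (wd l) (wd k)"
  shows "\<exists>n. k = rotate n l"
proof -
  have "\<exists>n. k = rotate n l"
    if "distinct_adj m" "cyc_reduced l" "wd k = wd m * wd l * inverse (wd m)" for m l
    using that
  proof (induction m arbitrary: l rule: rev_induct)
    case Nil
    then show ?case using assms(2)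
      by (intro exI[of _ 0]) (simp, metis cyc_reduced_def letters_wd_reduced)
  next
    case (snoc a m)
    have m: "distinct_adj m" using snoc.prems by (simp add: distinct_adj_append_iff)
    have l: "distinct_adj l" "l \<noteq> []" "hd l \<noteq> last l" using snoc.prems by (auto simp: cyc_reduced_def)
    have k: "wd k = wd m * (gen a * wd l * gen a) * inverse (wd m)"
      using snoc.prems by (simp add: mult.assoc)
    consider "hd l = a" | "last l = a" | "hd l \<noteq> a" "last l \<noteq> a" by blast
    then show ?case
    proof cases
      case 1
      then obtain t where t: "l = a # t" using l by (cases l) auto
      then have "wd k = wd m * wd (rotate1 l) * inverse (wd m)"
        using k by (simp add: mult.assoc)
      with snoc.IH[OF m cyc_reduced_rotate1] snoc.prems obtain n where "k = rotate n (rotate1 l)"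
        by blast
      then show ?thesis by (metis rotate1_rotate_swap rotate_Suc)
    next
      case 2
      then obtain t where t: "l = t @ [a]" using l by (metis append_butlast_last_id)
      have r: "rotate (length t) l = a # t" unfolding t by (simp add: rotate_append)
      have "wd k = wd m * wd (rotate (length t) l) * inverse (wd m)"
        unfolding r using k t by (simp add: mult.assoc)
      with snoc.IH[OF m cyc_reduced_rotate] snoc.prems obtain n where
        "k = rotate n (rotate (length t) l)" by blast
      then show ?thesis by (metis rotate_rotate)
    next
      case 3
      let ?m = "m @ [a]"
      have "distinct_adj (?m @ l @ rev ?m)"
        using 3 l snoc.prems(1)
        by (auto simp: distinct_adj_append_iff distinct_adj_Cons hd_append hd_rev)
      moreover have "wd (?m @ l @ rev ?m) = wd k"
        using k by (simp add: wd_rev mult.assoc)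
      ultimately have "k = ?m @ l @ rev ?m"
        using assms(2) by (metis cyc_reduced_def letters_wd_reduced)
      then have "hd k = last k" by (cases m) (simp_all add: last_rev)
      then show ?thesis using assms(2) by (simp add: cyc_reduced_def)
    qed
  qed
  moreover obtain m where "wd k = m * wd l * inverse m"
    using assms(3) unfolding conj_words_def by blast
  ultimately show ?thesis using assms(1) by (metis distinct_adj_letters wd_letters)
qed

section \<open>Two counts on cyclic words and their behaviour under the flip\<close>

text \<open>The automorphism \<open>flip\<close> exchanges the counts \<open>direct\<close> and \<open>through\<close> at \<open>U\<close> and changes the
  length of a cyclic word by their difference.\<close>

definition cyc_pairs :: "'a list \<Rightarrow> ('a \<times> 'a) list" where
  "cyc_pairs l = zip l (rotate1 l)"

definition cyc_triples :: "'a list \<Rightarrow> ('a \<times> 'a \<times> 'a) list" where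
  "cyc_triples l = zip l (cyc_pairs (rotate1 l))"

definition direct :: "letter list \<Rightarrow> letter \<Rightarrow> nat" where
  "direct l y = length (filter (\<lambda>(a, b). a \<noteq> y \<and> b \<noteq> y \<and> a \<noteq> b) (cyc_pairs l))"

definition through :: "letter list \<Rightarrow> letter \<Rightarrow> nat" where
  "through l y = length (filter (\<lambda>(a, b, c). b = y \<and> a \<noteq> y \<and> c \<noteq> y \<and> a \<noteq> c) (cyc_triples l))"

lemma zip_rotate1:
  "length xs = length ys \<Longrightarrow> zip (rotate1 xs) (rotate1 ys) = rotate1 (zip xs ys)"
  by (cases xs; cases ys) auto

lemma length_filter_rotate1: "length (filter P (rotate1 l)) = length (filter P l)"
  by (cases l) auto

lemma direct_rotate [simp]: "direct (rotate n l) = direct l"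
proof -
  have "direct (rotate1 l) = direct l" for l
    by (rule ext) (simp add: direct_def cyc_pairs_def zip_rotate1 length_filter_rotate1)
  then show ?thesis by (induction n) auto
qed

lemma through_rotate [simp]: "through (rotate n l) = through l"
proof -
  have "through (rotate1 l) = through l" for l
    by (rule ext) (simp add: through_def cyc_triples_def cyc_pairs_def zip_rotate1
        length_filter_rotate1)
  then show ?thesis by (induction n) auto
qed

lemma cyc_pairs_map: "cyc_pairs (map f l) = map (map_prod f f) (cyc_pairs l)"
  unfolding cyc_pairs_def rotate1_map by (rule nth_equalityI) simp_all

lemma cyc_triples_map: "cyc_triples (map f l) = map (map_prod f (map_prod f f)) (cyc_triples l)"
  unfolding cyc_triples_def rotate1_map cyc_pairs_map
  by (rule nth_equalityI) (simp_all add: cyc_pairs_def)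

lemma direct_map_nxt: "direct (map nxt l) (nxt y) = direct l y"
  unfolding direct_def cyc_pairs_map filter_map length_map
  by (rule arg_cong[where f = "\<lambda>P. length (filter P _)"]) (auto simp: fun_eq_iff)

lemma through_map_nxt: "through (map nxt l) (nxt y) = through l y"
  unfolding through_def cyc_triples_map filter_map length_map
  by (rule arg_cong[where f = "\<lambda>P. length (filter P _)"]) (auto simp: fun_eq_iff)

lemma length_filter_mono: "(\<And>x. x \<in> set l \<Longrightarrow> P x \<Longrightarrow> Q x) \<Longrightarrow> length (filter P l) \<le> length (filter Q l)"
  by (induction l) (auto simp: le_SucI)

lemma length_filter_split:
  "length (filter P l) = length (filter (\<lambda>x. P x \<and> Q x) l) + length (filter (\<lambda>x. P x \<and> \<not> Q x) l)"
  by (induction l) auto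

lemma map_zip_triples:
  assumes "length k = length l" "length l = length m"
  shows "map (\<lambda>(a, b, c). (a, b)) (zip k (zip l m)) = zip k l"
    "map (\<lambda>(a, b, c). (b, c)) (zip k (zip l m)) = zip l m"
proof -
  show "map (\<lambda>(a, b, c). (a, b)) (zip k (zip l m)) = zip k l"
    using assms by (intro nth_equalityI) (simp_all add: case_prod_unfold)
  show "map (\<lambda>(a, b, c). (b, c)) (zip k (zip l m)) = zip l m"
    using assms by (intro nth_equalityI) (simp_all add: case_prod_unfold)
qed

text \<open>A passage \<open>a y c\<close> with \<open>a \<noteq> c\<close> uses all three letters,
  so \<open>z\<close> is \<open>a\<close> or \<open>c\<close>, and the passage is charged to the
  adjacent pair that avoids \<open>z\<close>. No pair is charged twice: \<open>y\<close> is its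
  second letter in the first kind of charge and its first letter in the other.\<close>

lemma through_le_direct:
  assumes "y \<noteq> z"
  shows "through l y \<le> direct l z"
proof -
  let ?T = "cyc_triples l" and ?P = "cyc_pairs l"
  have first: "?P = map (\<lambda>(a, b, c). (a, b)) ?T"
    by (simp add: cyc_pairs_def cyc_triples_def map_zip_triples)
  have last: "rotate1 ?P = map (\<lambda>(a, b, c). (b, c)) ?T"
    unfolding cyc_pairs_def cyc_triples_def
    by (subst map_zip_triples(2)) (simp_all add: zip_rotate1)
  have 1: "length (filter (\<lambda>(a, b, c). (b = y \<and> a \<noteq> y \<and> c \<noteq> y \<and> a \<noteq> c) \<and> a \<noteq> z) ?T)
      \<le> length (filter (\<lambda>(a, b). (a \<noteq> z \<and> b \<noteq> z \<and> a \<noteq> b) \<and> b = y) ?P)"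
    unfolding first filter_map length_map using assms by (intro length_filter_mono) auto
  have "length (filter (\<lambda>(a, b, c). (b = y \<and> a \<noteq> y \<and> c \<noteq> y \<and> a \<noteq> c) \<and> \<not> a \<noteq> z) ?T)
      \<le> length (filter (\<lambda>(a, b). (a \<noteq> z \<and> b \<noteq> z \<and> a \<noteq> b) \<and> \<not> b = y) (rotate1 ?P))"
    unfolding last filter_map length_map using assms by (intro length_filter_mono) auto
  then have 2: "length (filter (\<lambda>(a, b, c). (b = y \<and> a \<noteq> y \<and> c \<noteq> y \<and> a \<noteq> c) \<and> \<not> a \<noteq> z) ?T)
      \<le> length (filter (\<lambda>(a, b). (a \<noteq> z \<and> b \<noteq> z \<and> a \<noteq> b) \<and> \<not> b = y) ?P)"
    by (simp only: length_filter_rotate1)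
  show ?thesis
    unfolding through_def direct_def
    using 1 2 length_filter_split[of "\<lambda>(a, b, c). b = y \<and> a \<noteq> y \<and> c \<noteq> y \<and> a \<noteq> c" ?T "\<lambda>(a, b, c). a \<noteq> z"]
      length_filter_split[of "\<lambda>(a, b). a \<noteq> z \<and> b \<noteq> z \<and> a \<noteq> b" ?P "\<lambda>(a, b). b = y"]
    by (simp add: case_prod_unfold)
qed

text \<open>A cyclic word that does not start with \<open>U\<close> is cut into blocks: a letter other than \<open>U\<close>,
  and a flag telling whether a letter \<open>U\<close> follows.\<close>

type_synonym block = "letter \<times> bool"

fun flat :: "block list \<Rightarrow> letter list" where
  "flat [] = []"
| "flat ((x, e) # ps) = (if e then [x, U] else [x]) @ flat ps"

definition proper :: "block list \<Rightarrow> bool" where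
  "proper ps \<longleftrightarrow> (\<forall>p\<in>set ps. fst p \<noteq> U)"

lemma proper_Cons [simp]: "proper (p # ps) \<longleftrightarrow> fst p \<noteq> U \<and> proper ps"
  by (auto simp: proper_def)

lemma proper_Nil [simp]: "proper []" by (simp add: proper_def)

lemma ex_blocks:
  "distinct_adj l \<Longrightarrow> l = [] \<or> hd l \<noteq> U \<Longrightarrow> \<exists>ps. l = flat ps \<and> proper ps"
proof (induction l rule: length_induct)
  case (1 l)
  show ?case
  proof (cases l)
    case Nil
    then show ?thesis by (intro exI[of _ "[]"]) simp
  next
    case (Cons x t)
    show ?thesis
    proof (cases "t \<noteq> [] \<and> hd t = U")
      case True
      then obtain s where t: "t = U # s" by (cases t) auto
      have s: "distinct_adj s" "s = [] \<or> hd s \<noteq> U" "length s < length l"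
        using 1(2) unfolding Cons t by (auto simp: distinct_adj_Cons)
      then obtain ps where "s = flat ps" "proper ps" using 1(1) by blast
      then show ?thesis using Cons t 1(3) by (intro exI[of _ "(x, True) # ps"]) simp
    next
      case False
      have t: "distinct_adj t" "t = [] \<or> hd t \<noteq> U" "length t < length l"
        using 1(2) False unfolding Cons by (auto simp: distinct_adj_Cons)
      then obtain ps where "t = flat ps" "proper ps" using 1(1) by blast
      then show ?thesis using Cons 1(3) by (intro exI[of _ "(x, False) # ps"]) simp
    qed
  qed
qed

text \<open>The adjacent pairs of a list closed up by \<open>q\<close>. With the closing element
  kept apart, cyclic pairs become accessible to structural induction.\<close>

fun chain :: "'a list \<Rightarrow> 'a \<Rightarrow> ('a \<times> 'a) list" where
  "chain [] q = []"
| "chain (p # ps) q = (p, hd (ps @ [q])) # chain ps q"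

lemma chain_conv_zip: "chain ps q = zip ps (tl (ps @ [q]))"
proof (induction ps)
  case (Cons p ps)
  then show ?case by (cases ps) simp_all
qed simp

lemma cyc_pairs_chain: "ps \<noteq> [] \<Longrightarrow> cyc_pairs ps = chain ps (hd ps)"
  by (cases ps) (simp_all add: cyc_pairs_def chain_conv_zip)

lemma hd_flat: "ps \<noteq> [] \<Longrightarrow> hd (flat ps) = fst (hd ps)"
  by (cases ps) auto

lemma flat_eq_Nil [simp]: "flat ps = [] \<longleftrightarrow> ps = []"
  by (cases ps) (auto split: if_splits)

lemma hd_flat_append: "hd (flat ps @ [fst q]) = fst (hd (ps @ [q]))"
  by (cases ps) auto

lemma chain_flat_Cons:
  "chain (flat ((x, e) # ps)) (fst q) =
    (if e then [(x, U), (U, fst (hd (ps @ [q])))] else [(x, fst (hd (ps @ [q])))]) @ chain (flat ps) (fst q)"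
  by (simp add: hd_flat_append)

lemma direct_chain_flat:
  assumes "proper ps" "fst q \<noteq> U"
  shows "length (filter (\<lambda>(a, b). a \<noteq> U \<and> b \<noteq> U \<and> a \<noteq> b) (chain (flat ps) (fst q)))
    = length (filter (\<lambda>(p, p'). \<not> snd p \<and> fst p \<noteq> fst p') (chain ps q))"
  using assms(1)
proof (induction ps)
  case (Cons p ps)
  obtain x e where p: "p = (x, e)" by (cases p)
  have "fst (hd (ps @ [q])) \<noteq> U" using Cons.prems assms(2) by (cases ps) auto
  then show ?case using Cons unfolding p chain_flat_Cons by auto
qed simp

fun chain3 :: "'a list \<Rightarrow> 'a \<Rightarrow> 'a \<Rightarrow> ('a \<times> 'a \<times> 'a) list" where
  "chain3 [] y z = []"
| "chain3 (p # ps) y z = (p, hd (ps @ [y]), hd (tl (ps @ [y, z]))) # chain3 ps y z"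

lemma chain3_conv: "chain3 l y z = zip l (chain (tl (l @ [y])) z)"
proof (induction l)
  case (Cons a l)
  show ?case
  proof (cases l)
    case Nil
    then show ?thesis by simp
  next
    case (Cons b l')
    then show ?thesis using Cons.IH by (cases l') auto
  qed
qed simp

lemma cyc_triples_chain3:
  assumes "length l \<ge> 2"
  shows "cyc_triples l = chain3 l (hd l) (hd (tl l))"
proof -
  obtain a b t where l: "l = a # b # t"
    using assms by (metis Suc_le_length_iff numeral_2_eq_2)
  have "cyc_pairs (rotate1 l) = chain (rotate1 l) (hd (rotate1 l))"
    by (rule cyc_pairs_chain) (simp add: l)
  then show ?thesis by (simp add: cyc_triples_def chain3_conv l)
qed

lemma through_chain3_flat:
  assumes "proper ps" "fst q \<noteq> U"
  shows "length (filter (\<lambda>(a, b, c). b = U \<and> a \<noteq> U \<and> c \<noteq> U \<and> a \<noteq> c) (chain3 (flat ps) (fst q) z))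
    = length (filter (\<lambda>(p, p'). snd p \<and> fst p \<noteq> fst p') (chain ps q))"
  using assms(1)
proof (induction ps)
  case (Cons p ps)
  obtain x e where p: "p = (x, e)" by (cases p)
  have ne: "fst (hd (ps @ [q])) \<noteq> U" using Cons.prems assms(2) by (cases ps) auto
  have h: "hd (flat ps @ [fst q, z]) = fst (hd (ps @ [q]))" by (cases ps) auto
  have "chain3 (flat ((x, e) # ps)) (fst q) z =
    (if e then [(x, U, fst (hd (ps @ [q]))), (U, fst (hd (ps @ [q])), hd (tl (flat ps @ [fst q, z])))]
     else [(x, fst (hd (ps @ [q])), hd (tl (flat ps @ [fst q, z])))]) @ chain3 (flat ps) (fst q) z"
    using h by (simp add: hd_flat_append)
  then show ?case using Cons ne unfolding p by auto
qed simp

lemma cyc_reduced_flat: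
  assumes "proper ps" "ps \<noteq> []"
  shows "cyc_reduced (flat ps) \<longleftrightarrow> (\<forall>(p, p')\<in>set (cyc_pairs ps). snd p \<or> fst p \<noteq> fst p')"
proof -
  have *: "distinct_adj (flat ps @ [fst q]) \<longleftrightarrow> (\<forall>(p, p')\<in>set (chain ps q). snd p \<or> fst p \<noteq> fst p')"
    if "proper ps" "fst q \<noteq> U" for ps q
    using that
  proof (induction ps)
    case (Cons p ps)
    obtain x e where p: "p = (x, e)" by (cases p)
    have "fst (hd (ps @ [q])) \<noteq> U" using Cons.prems by (cases ps) auto
    then show ?case using Cons unfolding p
      by (auto simp: distinct_adj_Cons hd_flat_append)
  qed simp
  have "fst (hd ps) \<noteq> U" using assms by (cases ps) auto
  moreover have "cyc_reduced (flat ps) \<longleftrightarrow> distinct_adj (flat ps @ [fst (hd ps)])"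
    using assms(2) by (auto simp: cyc_reduced_def distinct_adj_append_iff hd_flat)
  ultimately show ?thesis
    using *[of ps "hd ps"] assms by (simp add: cyc_pairs_chain)
qed

lemma cyc_pairs_nth: "i < length l \<Longrightarrow> cyc_pairs l ! i = (l ! i, l ! (Suc i mod length l))"
  by (simp add: cyc_pairs_def nth_rotate1)

lemma length_cyc_pairs [simp]: "length (cyc_pairs l) = length l"
  by (simp add: cyc_pairs_def)

definition bend :: "block list \<Rightarrow> nat \<Rightarrow> bool" where
  "bend ps i \<longleftrightarrow> fst (ps ! i) \<noteq> fst (ps ! (Suc i mod length ps))"

lemma length_flat: "length (flat ps) = length ps + card {i. i < length ps \<and> snd (ps ! i)}"
proof -
  have "length (flat ps) = length ps + length (filter snd ps)"
    by (induction ps) auto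
  then show ?thesis by (simp add: length_filter_conv_card)
qed

lemma direct_flat:
  assumes "proper ps" "ps \<noteq> []"
  shows "direct (flat ps) U = card {i. i < length ps \<and> \<not> snd (ps ! i) \<and> bend ps i}"
proof -
  have "fst (hd ps) \<noteq> U" using assms by (cases ps) auto
  then have "direct (flat ps) U = length (filter (\<lambda>(p, p'). \<not> snd p \<and> fst p \<noteq> fst p') (cyc_pairs ps))"
    using direct_chain_flat[of ps "hd ps"] assms by (simp add: direct_def cyc_pairs_chain hd_flat)
  also have "\<dots> = card {i. i < length ps \<and> \<not> snd (ps ! i) \<and> bend ps i}"
    by (auto simp: length_filter_conv_card cyc_pairs_nth bend_def intro!: arg_cong[of _ _ card])
  finally show ?thesis .
qed

lemma through_flat:
  assumes "proper ps" "ps \<noteq> []" "length (flat ps) \<ge> 2"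
  shows "through (flat ps) U = card {i. i < length ps \<and> snd (ps ! i) \<and> bend ps i}"
proof -
  have "fst (hd ps) \<noteq> U" using assms by (cases ps) auto
  then have "through (flat ps) U = length (filter (\<lambda>(p, p'). snd p \<and> fst p \<noteq> fst p') (cyc_pairs ps))"
    using through_chain3_flat[of ps "hd ps"] assms
    by (simp add: through_def cyc_triples_chain3 cyc_pairs_chain hd_flat)
  also have "\<dots> = card {i. i < length ps \<and> snd (ps ! i) \<and> bend ps i}"
    by (auto simp: length_filter_conv_card cyc_pairs_nth bend_def intro!: arg_cong[of _ _ card])
  finally show ?thesis .
qed

fun swap :: "letter \<Rightarrow> letter" where
  "swap U = U" | "swap V = W" | "swap W = V"

lemma swap_simps [simp]: "swap x = swap y \<longleftrightarrow> x = y" "swap x = U \<longleftrightarrow> x = U"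
  by (cases x; cases y; simp)+

text \<open>\<open>flip\<close> exchanges \<open>V\<close> and \<open>W\<close> and adds a letter
  \<open>U\<close> on both sides of the image of \<open>W\<close>. Between two blocks this adds a
  single \<open>U\<close> if their letters differ and an even number otherwise, so the flag is
  toggled exactly where the letters differ.\<close>

fun flip_block :: "block \<times> block \<Rightarrow> block" where
  "flip_block (p, p') = (swap (fst p), snd p \<noteq> (fst p \<noteq> fst p'))"

definition flip_blocks :: "block list \<Rightarrow> block list" where
  "flip_blocks ps = map flip_block (cyc_pairs ps)"

lemma length_flip_blocks [simp]: "length (flip_blocks ps) = length ps"
  by (simp add: flip_blocks_def)

lemma flip_blocks_nth:
  "i < length ps \<Longrightarrow> flip_blocks ps ! i = (swap (fst (ps ! i)), snd (ps ! i) \<noteq> bend ps i)"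
  by (simp add: flip_blocks_def cyc_pairs_nth bend_def)

lemma bend_flip_blocks: "i < length ps \<Longrightarrow> bend (flip_blocks ps) i = bend ps i"
  by (subst bend_def, subst (1 2) flip_blocks_nth) (auto simp: bend_def intro: mod_less_divisor)

lemma proper_flip_blocks: "proper ps \<Longrightarrow> proper (flip_blocks ps)"
  by (simp add: proper_def all_set_conv_all_nth flip_blocks_nth)

text \<open>The share of one block in the letters \<open>U\<close> that are added on either side;
  inside a cyclic word these shares combine in pairs.\<close>

definition pre :: "letter \<Rightarrow> rword" where
  "pre x = (if x = W then gen U else 1)"

lemma flip_flat:
  assumes "proper ps" "fst q \<noteq> U"
  shows "flip (wd (flat ps)) =
    pre (fst (hd (ps @ [q]))) * wd (flat (map flip_block (chain ps q))) * pre (fst q)"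
  using assms(1)
proof (induction ps)
  case Nil
  then show ?case by (simp add: pre_def)
next
  case (Cons p ps)
  obtain x e where p: "p = (x, e)" by (cases p)
  obtain y where y: "fst (hd (ps @ [q])) = y" by blast
  have ne: "x \<noteq> U" "y \<noteq> U" using Cons.prems assms(2) p y by (cases ps; auto)+
  have IH: "flip (wd (flat ps)) = pre y * wd (flat (map flip_block (chain ps q))) * pre (fst q)"
    using Cons y by simp
  show ?case
    unfolding p using ne
    by (cases x; cases y; cases e) (simp_all add: IH y pre_def mult.assoc)
qed

lemma conj_words_flip_flat:
  assumes "proper ps" "ps \<noteq> []"
  shows "conj_words (flip (wd (flat ps))) (wd (flat (flip_blocks ps)))"
proof -
  have "fst (hd ps) \<noteq> U" using assms by (cases ps) auto
  then have "flip (wd (flat ps)) = pre (fst (hd ps)) * wd (flat (flip_blocks ps)) * pre (fst (hd ps))"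
    using flip_flat[of ps "hd ps"] assms by (simp add: flip_blocks_def cyc_pairs_chain)
  moreover have "inverse (pre x) = pre x" for x by (simp add: pre_def)
  ultimately show ?thesis
    by (metis conj_words_def conj_words_sym)
qed

lemma cyc_reduced_length: "cyc_reduced l \<Longrightarrow> length l \<ge> 2"
  by (cases l; cases "tl l") (auto simp: cyc_reduced_def)

text \<open>At a bend the flag is toggled, elsewhere it is kept. Bends without a flag are the direct
  pairs and bends with a flag are the through passages, so the two change places, and the length
  changes by the number of flags gained minus those lost.\<close>

lemma flip_cyc_reduced:
  assumes l: "cyc_reduced l"
  obtains k where "cyc_reduced k" "conj_words (flip (wd l)) (wd k)"
    "length k + through l U = length l + direct l U"
    "direct k U = through l U" "through k U = direct l U"
proof -
  have "\<exists>n. hd (rotate n l) \<noteq> U"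
  proof (cases "hd l = U")
    case True
    then have "hd (rotate 1 l) \<noteq> U"
      using l by (cases l; cases "tl l") (auto simp: cyc_reduced_def)
    then show ?thesis by blast
  qed (metis rotate0 id_apply)
  then obtain n where n: "hd (rotate n l) \<noteq> U" by blast
  let ?l = "rotate n l"
  have cl: "cyc_reduced ?l" using l by (rule cyc_reduced_rotate)
  then obtain ps where ps: "?l = flat ps" "proper ps"
    using ex_blocks[of ?l] n by (auto simp: cyc_reduced_def)
  have ne: "ps \<noteq> []" using cl ps by (auto simp: cyc_reduced_def)
  let ?E = "{i. i < length ps \<and> snd (ps ! i)}"
  let ?D = "{i. i < length ps \<and> \<not> snd (ps ! i) \<and> bend ps i}"
  let ?T = "{i. i < length ps \<and> snd (ps ! i) \<and> bend ps i}"
  let ?qs = "flip_blocks ps"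
  let ?E' = "{i. i < length ps \<and> snd (?qs ! i)}"
  have len: "length (flat ps) \<ge> 2" using cl ps cyc_reduced_length by metis
  have dt: "direct l U = card ?D" "through l U = card ?T"
    using direct_flat[OF ps(2) ne] through_flat[OF ps(2) ne len] ps(1)
    by (metis direct_rotate, metis through_rotate)
  have red: "cyc_reduced (flat ?qs)"
  proof -
    have "snd (ps ! i) \<or> bend ps i" if "i < length ps" for i
    proof -
      have "cyc_pairs ps ! i \<in> set (cyc_pairs ps)" using that by (intro nth_mem) simp
      then show ?thesis using cl[unfolded ps(1) cyc_reduced_flat[OF ps(2) ne]] that
        by (auto simp: cyc_pairs_nth bend_def)
    qed
    then have "snd (?qs ! i) \<or> bend ?qs i" if "i < length ps" for i
      using that by (auto simp: bend_flip_blocks flip_blocks_nth)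
    then have "\<forall>(p, p')\<in>set (cyc_pairs ?qs). snd p \<or> fst p \<noteq> fst p'"
      by (simp add: all_set_conv_all_nth cyc_pairs_nth bend_def)
    moreover have "?qs \<noteq> []" using ne by (metis length_0_conv length_flip_blocks)
    ultimately show ?thesis using cyc_reduced_flat[of ?qs] proper_flip_blocks[OF ps(2)] by blast
  qed
  have ne': "?qs \<noteq> []" using ne by (metis length_0_conv length_flip_blocks)
  have "conj_words (flip (wd l)) (flip (wd ?l))"
    by (rule conj_words_morphism[OF flip.group_morphism_axioms conj_words_rotate])
  also have "conj_words (flip (wd ?l)) (wd (flat ?qs))"
    unfolding ps(1) using ps(2) ne by (rule conj_words_flip_flat)
  finally have conj: "conj_words (flip (wd l)) (wd (flat ?qs))" .
  have "card ?E' + card ?T = card ?E + card ?D"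
  proof -
    have "?E' \<union> ?T = ?E \<union> ?D" "?E' \<inter> ?T = {}" "?E \<inter> ?D = {}"
      by (auto simp: flip_blocks_nth)
    moreover have "card (?E' \<union> ?T) = card ?E' + card ?T" "card (?E \<union> ?D) = card ?E + card ?D"
      using calculation(2,3) by (auto intro!: card_Un_disjoint)
    ultimately show ?thesis by metis
  qed
  moreover have "length l = length (flat ps)" using ps(1) by (metis length_rotate)
  ultimately have length: "length (flat ?qs) + through l U = length l + direct l U"
    by (simp add: length_flat dt)
  have "direct (flat ?qs) U = card {i. i < length ps \<and> \<not> snd (?qs ! i) \<and> bend ?qs i}"
    using direct_flat[OF proper_flip_blocks[OF ps(2)] ne'] by simp
  also have "{i. i < length ps \<and> \<not> snd (?qs ! i) \<and> bend ?qs i} = ?T"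
    by (auto simp: flip_blocks_nth bend_flip_blocks)
  finally have d: "direct (flat ?qs) U = through l U" by (simp add: dt)
  have "through (flat ?qs) U = card {i. i < length ps \<and> snd (?qs ! i) \<and> bend ?qs i}"
    using through_flat[OF proper_flip_blocks[OF ps(2)] ne' cyc_reduced_length[OF red]] by simp
  also have "{i. i < length ps \<and> snd (?qs ! i) \<and> bend ?qs i} = ?D"
    by (auto simp: flip_blocks_nth bend_flip_blocks)
  finally have t: "through (flat ?qs) U = direct l U" by (simp add: dt)
  show thesis using that[OF red conj length d t] .
qed

section \<open>Convexity of the length\<close>

text \<open>Convexity of the length along a path in the trivalent tree of generating triples: once a
  move has lengthened a cyclic word, every move that does not undo it lengthens it further.\<close>

definition ascending :: "rword \<Rightarrow> nat \<Rightarrow> bool" where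
  "ascending x n \<longleftrightarrow> (\<exists>l. cyc_reduced l \<and> conj_words x (wd l) \<and> direct l U < through l U \<and> n < length l)"

lemma ascending_flip:
  assumes "cyc_reduced l" "conj_words x (wd l)" "through l U < direct l U" "n \<le> length l"
  shows "ascending (flip x) n"
proof -
  obtain k where k: "cyc_reduced k" "conj_words (flip (wd l)) (wd k)"
    "length k + through l U = length l + direct l U" "direct k U = through l U" "through k U = direct l U"
    using flip_cyc_reduced[OF assms(1)] by metis
  have "conj_words (flip x) (flip (wd l))"
    using conj_words_morphism[OF flip.group_morphism_axioms assms(2)] .
  with k assms show ?thesis unfolding ascending_def
    by (intro exI[of _ k]) (auto intro: conj_words_trans)
qed

definition turn :: "bool \<Rightarrow> rword \<Rightarrow> rword" where
  "turn b x = (if b then rot x else rot (rot x))"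

text \<open>For a letter \<open>z \<noteq> U\<close> the comparison of counts at different letters
  gives \<open>through z \<le> direct U < through U \<le> direct z\<close>. A turn by
  \<open>rot\<close> or its inverse brings such a \<open>z\<close> to the place of \<open>U\<close>,
  so the next flip lengthens the word.\<close>

lemma ascending_flip_turn:
  assumes "ascending x n"
  shows "ascending (flip (turn b x)) n"
proof -
  obtain l where l: "cyc_reduced l" "conj_words x (wd l)" "direct l U < through l U" "n < length l"
    using assms unfolding ascending_def by blast
  let ?f = "if b then nxt else nxt \<circ> nxt"
  let ?l = "map ?f l"
  have red: "cyc_reduced (map nxt l)" if "cyc_reduced l" for l
    using that by (auto simp: cyc_reduced_def hd_map last_map)
  then have "cyc_reduced ?l" using l(1) red[OF red[OF l(1)]] by simp
  moreover have "conj_words (turn b x) (wd ?l)"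
    using conj_words_morphism[OF rot.group_morphism_axioms] l(2)
    by (auto simp: turn_def simp flip: rot_wd map_map)
  moreover have "through ?l U < direct ?l U"
  proof -
    have "through l z < direct l z" if "z \<noteq> U" for z
      using through_le_direct[of U z l] through_le_direct[of z U l] that l(3) by simp
    then have "through l W < direct l W" "through l V < direct l V" by auto
    moreover have "direct ?l U = direct l (if b then W else V)"
      using direct_map_nxt[of l W] direct_map_nxt[of "map nxt l" W] direct_map_nxt[of l V] by simp
    moreover have "through ?l U = through l (if b then W else V)"
      using through_map_nxt[of l W] through_map_nxt[of "map nxt l" W] through_map_nxt[of l V] by simp
    ultimately show ?thesis by simp
  qed
  ultimately show ?thesis by (rule ascending_flip) (use l in simp)
qed

definition path :: "bool list \<Rightarrow> rword \<Rightarrow> rword" where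
  "path = foldr (\<lambda>b x. flip (turn b x))"

lemma path_simps [simp]: "path [] x = x" "path (b # bs) x = flip (turn b (path bs x))"
  by (simp_all add: path_def)

lemma ascending_path: "ascending x n \<Longrightarrow> ascending (path bs x) n"
  by (induction bs) (auto intro: ascending_flip_turn)

lemma ascending_not_conj:
  assumes "ascending x n" "conj_words x (wd l)" "cyc_reduced l" "length l \<le> n"
  shows False
proof -
  obtain k where k: "cyc_reduced k" "conj_words x (wd k)" "n < length k"
    using assms(1) unfolding ascending_def by blast
  then have "conj_words (wd l) (wd k)" using assms(2) conj_words_sym conj_words_trans by blast
  then obtain i where "k = rotate i l" using cyc_reduced_conj assms k by blast
  then show False using k assms by simp
qed

lemma direct_eq_if_rot_conj:
  assumes "cyc_reduced l" "conj_words (rot (wd l)) (wd l)"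
  shows "direct l y = direct l z" "through l y = through l z"
proof -
  have "cyc_reduced (map nxt l)" using assms(1) by (auto simp: cyc_reduced_def hd_map last_map)
  then obtain n where n: "map nxt l = rotate n l"
    using cyc_reduced_conj[OF assms(1)] assms(2) conj_words_sym by (metis rot_wd)
  have "direct l (nxt y) = direct l y" for y
    using direct_map_nxt[of l y] by (simp add: n)
  then show "direct l y = direct l z" by (cases y; cases z) (metis nxt.simps)+
  have "through l (nxt y) = through l y" for y
    using through_map_nxt[of l y] by (simp add: n)
  then show "through l y = through l z" by (cases y; cases z) (metis nxt.simps)+
qed

text \<open>The plane vector modulo two is a homomorphism to an abelian group. It is thus invariant
  under conjugation, and it separates the three letters.\<close>

lemma odd_rot_conj_not_gen:
  assumes "conj_words (rot x) x"
  shows "\<not> conj_words x (gen a)"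
proof
  assume a: "conj_words x (gen a)"
  have parity: "even (fst (word_vec (x * y))) \<longleftrightarrow> (even (fst (word_vec x)) \<longleftrightarrow> even (fst (word_vec y)))"
    "even (snd (word_vec (x * y))) \<longleftrightarrow> (even (snd (word_vec x)) \<longleftrightarrow> even (snd (word_vec y)))" for x y
    by (simp_all add: word_vec_mult)
  have conj: "(even (fst (word_vec x)) \<longleftrightarrow> even (fst (word_vec y))) \<and>
      (even (snd (word_vec x)) \<longleftrightarrow> even (snd (word_vec y)))" if xy: "conj_words x y" for x y
  proof -
    obtain m where y: "y = m * x * inverse m" using xy unfolding conj_words_def by blast
    then have "y * m = m * x" by (simp add: mult.assoc)
    then show ?thesis using parity[of y m] parity[of m x] by metis
  qed
  have "conj_words (gen (nxt a)) (gen a)"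
    using conj_words_morphism[OF rot.group_morphism_axioms a] assms a
    by (metis conj_words_sym conj_words_trans rot_gen)
  from conj[OF this] show False by (cases a) simp_all
qed

section \<open>Powers of omega among the cyclic words\<close>

definition omega :: rword where "omega = wd [W, V, U]"

lemma funpow_period_three:
  assumes "\<And>x. f (f (f x)) = (x :: 'a)"
  shows "map (\<lambda>i. (f ^^ i) x) [0..<3 * k] = concat (replicate k [x, f x, f (f x)])"
proof (induction k)
  case (Suc k)
  have p: "(f ^^ (3 * k)) x = x" for x by (induction k) (auto simp: assms funpow_add numeral_3_eq_3)
  have "[0..<3 * Suc k] = [0..<3 * k] @ [3 * k, 3 * k + 1, 3 * k + 2]"
    by (simp add: upt_rec[of "3 * k"] upt_add_eq_append[of 0 "3 * k" 3, simplified] numeral_3_eq_3)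
  then have "map (\<lambda>i. (f ^^ i) x) [0..<3 * Suc k] = concat (replicate k [x, f x, f (f x)]) @ [x, f x, f (f x)]"
    using Suc by (simp add: p)
  also have "\<dots> = concat (replicate (Suc k) [x, f x, f (f x)])"
    by (metis append_Nil2 concat.simps concat_append replicate_append_same replicate_Suc)
  finally show ?case .
qed simp

lemma cyclic_steps:
  assumes f: "\<And>x. f (f (f x)) = (x :: letter)" "\<And>x. f x \<noteq> x"
    and step: "\<And>i. i < length l \<Longrightarrow> l ! (Suc i mod length l) = f (l ! i)" and "l \<noteq> []"
  shows "\<exists>k>0. l = concat (replicate k [hd l, f (hd l), f (f (hd l))])"
proof -
  let ?n = "length l" and ?x = "hd l"
  have nth: "l ! i = (f ^^ i) ?x" if "i < ?n" for i
    using that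
  proof (induction i)
    case 0
    then show ?case using assms(4) by (simp add: hd_conv_nth)
  next
    case (Suc i)
    then show ?case using step[of i] by simp
  qed
  then have l: "l = map (\<lambda>i. (f ^^ i) ?x) [0..<?n]" by (intro nth_equalityI) auto
  have p: "(f ^^ (3 * k)) x = x" for k x by (induction k) (auto simp: f funpow_add numeral_3_eq_3)
  have "l ! 0 = f (l ! (?n - 1))" using step[of "?n - 1"] assms(4) by simp
  then have "?x = (f ^^ ?n) ?x"
    using nth[of "?n - 1"] assms(4) by (cases ?n) (auto simp: hd_conv_nth)
  also have "\<dots> = (f ^^ (?n mod 3)) ((f ^^ (3 * (?n div 3))) ?x)"
    by (metis funpow_add comp_apply mod_mult_div_eq)
  also have "\<dots> = (f ^^ (?n mod 3)) ?x" by (simp add: p)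
  finally have fixed: "(f ^^ (?n mod 3)) ?x = ?x" by simp
  have "?n mod 3 = 0"
  proof -
    have "f (f y) \<noteq> y" for y using f by metis
    moreover have "?n mod 3 = 0 \<or> ?n mod 3 = 1 \<or> ?n mod 3 = 2" by auto
    ultimately show ?thesis using fixed f(2) by (auto simp: numeral_2_eq_2)
  qed
  then obtain k where k: "?n = 3 * k" by auto
  then have "l = concat (replicate k [?x, f ?x, f (f ?x)])"
    using l funpow_period_three[of f ?x k] f(1) by simp
  moreover have "k > 0" using k assms(4) by (cases k) auto
  ultimately show ?thesis by blast
qed

text \<open>Every adjacent pair is direct at exactly one letter, the missing one, so the direct
  counts add up to the length. The through counts add up to the number of places where letters two
  apart differ. Equality forces this everywhere, so the word runs through the three letters in a
  fixed cyclic order.\<close>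

lemma balanced_power_omega:
  assumes l: "cyc_reduced l" and bal: "\<And>y. direct l y = through l y"
  shows "\<exists>k>0. conj_words (wd l) (omega ^ k) \<or> conj_words (wd l) (inverse omega ^ k)"
proof -
  let ?n = "length l"
  have n: "?n > 0" using l by (auto simp: cyc_reduced_def)
  have adj: "l ! i \<noteq> l ! (Suc i mod ?n)" if "i < ?n" for i
  proof (cases "Suc i = ?n")
    case True
    then have "last l = l ! i" using n last_conv_nth[of l] by (metis diff_Suc_1 length_greater_0_conv)
    moreover have "l ! (Suc i mod ?n) = hd l" using True n by (simp add: hd_conv_nth)
    ultimately show ?thesis using l by (auto simp: cyc_reduced_def)
  next
    case False
    then show ?thesis using l that distinct_adj_conv_nth[of l] by (auto simp: cyc_reduced_def)
  qed
  have adj2: "l ! (Suc i mod ?n) \<noteq> l ! (Suc (Suc i) mod ?n)" for i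
    using adj[of "Suc i mod ?n"] n by (simp add: mod_Suc_eq)
  have four: "i = j" if "a \<noteq> b" "a \<noteq> i" "b \<noteq> i" "a \<noteq> j" "b \<noteq> j" for a b i j :: letter
    using that by (cases a; cases b; cases i; cases j) auto
  have d: "direct l y = card {i. i < ?n \<and> l ! i \<noteq> y \<and> l ! (Suc i mod ?n) \<noteq> y}" for y
  proof -
    have "direct l y = card {i. i < ?n \<and> l ! i \<noteq> y \<and> l ! (Suc i mod ?n) \<noteq> y \<and> l ! i \<noteq> l ! (Suc i mod ?n)}"
      by (auto simp: direct_def length_filter_conv_card cyc_pairs_nth intro!: arg_cong[of _ _ card])
    moreover have "{i. i < ?n \<and> l ! i \<noteq> y \<and> l ! (Suc i mod ?n) \<noteq> y \<and> l ! i \<noteq> l ! (Suc i mod ?n)}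
        = {i. i < ?n \<and> l ! i \<noteq> y \<and> l ! (Suc i mod ?n) \<noteq> y}"
      using adj by blast
    ultimately show ?thesis by simp
  qed
  have tnth: "cyc_triples l ! i = (l ! i, l ! (Suc i mod ?n), l ! (Suc (Suc i) mod ?n))" if "i < ?n" for i
    using that n by (simp add: cyc_triples_def cyc_pairs_nth nth_rotate1 mod_Suc_eq)
  have "length (cyc_triples l) = ?n" by (simp add: cyc_triples_def)
  then have "through l y = card {i. i < ?n \<and> (l ! (Suc i mod ?n) = y \<and> l ! i \<noteq> y \<and>
      l ! (Suc (Suc i) mod ?n) \<noteq> y \<and> l ! i \<noteq> l ! (Suc (Suc i) mod ?n))}" for y
    by (auto simp: through_def length_filter_conv_card tnth intro!: arg_cong[of _ _ card])
  moreover have "i < ?n \<and> (l ! (Suc i mod ?n) = y \<and> l ! i \<noteq> y \<and>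
      l ! (Suc (Suc i) mod ?n) \<noteq> y \<and> l ! i \<noteq> l ! (Suc (Suc i) mod ?n)) \<longleftrightarrow>
      i < ?n \<and> l ! (Suc i mod ?n) = y \<and> l ! i \<noteq> l ! (Suc (Suc i) mod ?n)" for i y
    using adj[of i] adj2[of i] by fastforce
  ultimately have t: "through l y = card {i. i < ?n \<and> l ! (Suc i mod ?n) = y \<and>
      l ! i \<noteq> l ! (Suc (Suc i) mod ?n)}" for y
    by simp
  have "(\<Sum>y\<in>{U, V, W}. direct l y) = ?n"
  proof -
    have "(\<Sum>y\<in>{U, V, W}. direct l y) = card (\<Union>y\<in>{U, V, W}. {i. i < ?n \<and> l ! i \<noteq> y \<and> l ! (Suc i mod ?n) \<noteq> y})"
      unfolding d
    proof (rule card_UN_disjoint[symmetric])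
      show "\<forall>i\<in>{U, V, W}. \<forall>j\<in>{U, V, W}. i \<noteq> j \<longrightarrow>
          {k. k < ?n \<and> l ! k \<noteq> i \<and> l ! (Suc k mod ?n) \<noteq> i} \<inter> {k. k < ?n \<and> l ! k \<noteq> j \<and> l ! (Suc k mod ?n) \<noteq> j} = {}"
        using adj four by blast
    qed simp_all
    also have "(\<Union>y\<in>{U, V, W}. {i. i < ?n \<and> l ! i \<noteq> y \<and> l ! (Suc i mod ?n) \<noteq> y}) = {i. i < ?n}"
    proof -
      have "\<exists>y\<in>{U, V, W}. a \<noteq> y \<and> b \<noteq> y" for a b by (cases a; cases b) auto
      then show ?thesis by blast
    qed
    finally show ?thesis by simp
  qed
  then have "(\<Sum>y\<in>{U, V, W}. through l y) = ?n" using bal by simp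
  moreover have "(\<Sum>y\<in>{U, V, W}. through l y) = card {i. i < ?n \<and> l ! i \<noteq> l ! (Suc (Suc i) mod ?n)}"
  proof -
    have "(\<Sum>y\<in>{U, V, W}. through l y) =
        card (\<Union>y\<in>{U, V, W}. {i. i < ?n \<and> l ! (Suc i mod ?n) = y \<and> l ! i \<noteq> l ! (Suc (Suc i) mod ?n)})"
      unfolding t by (rule card_UN_disjoint[symmetric]) (simp, simp, intro ballI impI, blast)
    also have "(\<Union>y\<in>{U, V, W}. {i. i < ?n \<and> l ! (Suc i mod ?n) = y \<and> l ! i \<noteq> l ! (Suc (Suc i) mod ?n)})
        = {i. i < ?n \<and> l ! i \<noteq> l ! (Suc (Suc i) mod ?n)}"
    proof -
      have "a \<in> {U, V, W}" for a by (cases a) auto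
      then show ?thesis by blast
    qed
    finally show ?thesis .
  qed
  ultimately have "card {i. i < ?n \<and> l ! i \<noteq> l ! (Suc (Suc i) mod ?n)} = card {i. i < ?n}" by simp
  then have "{i. i < ?n \<and> l ! i \<noteq> l ! (Suc (Suc i) mod ?n)} = {i. i < ?n}"
    by (intro card_subset_eq) auto
  then have far: "l ! i \<noteq> l ! (Suc (Suc i) mod ?n)" if "i < ?n" for i using that by blast
  have third: "f b = c" if "f = nxt \<or> f = nxt \<circ> nxt" "f a = b" "a \<noteq> c" "b \<noteq> c" for f and a b c :: letter
    using that by (cases a; cases b; cases c) auto
  have "l ! (Suc 0 mod ?n) = nxt (l ! 0) \<or> l ! (Suc 0 mod ?n) = nxt (nxt (l ! 0))"
    using nxt_cases[of "l ! (Suc 0 mod ?n)" "l ! 0"] not_sym[OF adj[OF n]] by blast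
  then have "\<exists>f. (f = nxt \<or> f = nxt \<circ> nxt) \<and> l ! (Suc 0 mod ?n) = f (l ! 0)"
  proof
    assume "l ! (Suc 0 mod ?n) = nxt (l ! 0)"
    then show ?thesis by (intro exI[of _ nxt]) simp
  next
    assume "l ! (Suc 0 mod ?n) = nxt (nxt (l ! 0))"
    then show ?thesis by (intro exI[of _ "nxt \<circ> nxt"]) simp
  qed
  then obtain f where f: "f = nxt \<or> f = nxt \<circ> nxt" "l ! (Suc 0 mod ?n) = f (l ! 0)" by blast
  have "l ! (Suc i mod ?n) = f (l ! i)" if "i < ?n" for i
    using that
  proof (induction i)
    case (Suc i)
    have "f (l ! (Suc i mod ?n)) = l ! (Suc (Suc i) mod ?n)"
    proof (rule third[OF f(1)])
      show "f (l ! i) = l ! (Suc i mod ?n)" using Suc by simp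
      show "l ! i \<noteq> l ! (Suc (Suc i) mod ?n)" using Suc.prems by (intro far) simp
      show "l ! (Suc i mod ?n) \<noteq> l ! (Suc (Suc i) mod ?n)" by (rule adj2)
    qed
    then show ?case using Suc.prems by simp
  qed (use f in simp)
  moreover have "f (f (f x)) = x" "f x \<noteq> x" for x using f(1) by auto
  ultimately obtain k where k: "k > 0" "l = concat (replicate k [hd l, f (hd l), f (f (hd l))])"
    using cyclic_steps[of f l] n by auto
  have wl: "wd l = wd [hd l, f (hd l), f (f (hd l))] ^ k"
    by (subst k(2)) (rule wd_concat_replicate)
  have "conj_words (wd [a, f a, f (f a)]) omega \<or> conj_words (wd [a, f a, f (f a)]) (inverse omega)" for a
  proof -
    have r: "conj_words (wd [U, W, V]) (wd [W, V, U])" "conj_words (wd [V, U, W]) (wd [W, V, U])"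
      "conj_words (wd [W, U, V]) (wd [U, V, W])" "conj_words (wd [V, W, U]) (wd [U, V, W])"
      using conj_words_rotate[of "[U, W, V]" 1] conj_words_rotate[of "[V, U, W]" 2]
        conj_words_rotate[of "[W, U, V]" 1] conj_words_rotate[of "[V, W, U]" 2]
      by (simp_all add: numeral_2_eq_2)
    have o: "omega = wd [W, V, U]" "inverse omega = wd [U, V, W]"
      by (simp_all add: omega_def mult.assoc)
    show ?thesis
      using f(1) r unfolding o(2) unfolding o(1) by (cases a) (auto simp del: wd_simps)
  qed
  then show ?thesis unfolding wl using k(1) conj_words_power by blast
qed

text \<open>By convexity no move along the path may lengthen the word, since otherwise the path could not
  return to its class; so all counts balance.\<close>

theorem rot_path_invariant:
  assumes odd: "\<not> even_word z" and r: "conj_words (rot z) z"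
    and p: "conj_words (path bs (if j then flip z else z)) ((rot ^^ i) z)" and "bs \<noteq> [] \<or> j"
  shows "\<exists>k>0. conj_words z (omega ^ k) \<or> conj_words z (inverse omega ^ k)"
proof -
  have "z \<noteq> 1" using odd by auto
  then obtain m c where mc: "letters z = m @ c @ rev m" "cyc_reduced c \<or> length c = 1"
    using cyclic_core[of "letters z"] by auto
  have "z = wd m * wd c * inverse (wd m)"
    by (metis mc(1) wd_letters wd_simps(3) wd_rev mult.assoc)
  then have zc: "conj_words z (wd c)" using conj_words_def conj_words_sym by blast
  have "length c \<noteq> 1"
  proof
    assume "length c = 1"
    then obtain a where "c = [a]" by (auto simp: length_Suc_conv)
    then show False using zc odd_rot_conj_not_gen[OF r] by simp
  qed
  with mc have c: "cyc_reduced c" by simp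
  have "conj_words (rot (wd c)) (rot z)"
    using conj_words_morphism[OF rot.group_morphism_axioms conj_words_sym[OF zc]] .
  then have rc: "conj_words (rot (wd c)) (wd c)" using r zc conj_words_trans by blast
  note eq = direct_eq_if_rot_conj[OF c rc]
  have ri: "conj_words ((rot ^^ n) z) z" for n
  proof (induction n)
    case (Suc n)
    then show ?case
      using conj_words_morphism[OF rot.group_morphism_axioms Suc] r conj_words_trans by fastforce
  qed simp
  \<comment> \<open>Rotation invariance makes the counts independent of the letter, so that the
    inequality for two different letters also holds for a single one.\<close>
  have le: "through c y \<le> direct c y" for y
    using through_le_direct[of y "nxt y" c] eq(1)[of "nxt y" y] by simp
  have "\<not> through c U < direct c U"
  proof
    assume less: "through c U < direct c U"
    have zf: "ascending (flip z) (length c)" using ascending_flip[OF c zc less] by simp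
    have "ascending (path bs (if j then flip z else z)) (length c)"
    proof (cases j)
      case True
      then show ?thesis using ascending_path[OF zf] by simp
    next
      case False
      with assms(4) have "bs \<noteq> []" by blast
      then obtain bs' b where bs: "bs = bs' @ [b]" by (metis append_butlast_last_id)
      have "conj_words (rot (rot z)) z" using ri[of 2] by (simp add: numeral_2_eq_2)
      then have "conj_words (turn b z) (wd c)"
        using r zc by (auto simp: turn_def intro: conj_words_trans)
      then have "ascending (flip (turn b z)) (length c)" using ascending_flip[OF c _ less] by simp
      moreover have "path bs z = path bs' (flip (turn b z))" by (simp add: bs path_def)
      ultimately show ?thesis using False ascending_path by simp
    qed
    moreover have "conj_words (path bs (if j then flip z else z)) (wd c)"
      using p ri zc conj_words_trans by blast
    ultimately show False using ascending_not_conj c by blast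
  qed
  then have "direct c y = through c y" for y
    using le[of y] eq(1)[of y U] eq(2)[of y U] by simp
  from balanced_power_omega[OF c this] show ?thesis using zc conj_words_trans by blast
qed

lemma cyc_reduced_omega: "cyc_reduced [W, V, U]"
  by (simp add: cyc_reduced_def)

lemma omega_power_nth:
  "i < 3 * k \<Longrightarrow> concat (replicate k [W, V, U]) ! i = [W, V, U] ! (i mod 3)"
proof (induction k arbitrary: i)
  case (Suc k)
  show ?case
  proof (cases "i < 3")
    case True
    then have "i = 0 \<or> i = 1 \<or> i = 2" by auto
    then show ?thesis by auto
  next
    case False
    then have "concat (replicate (Suc k) [W, V, U]) ! i = concat (replicate k [W, V, U]) ! (i - 3)"
      by (simp add: nth_append nth_Cons' numeral_3_eq_3)
    also have "\<dots> = [W, V, U] ! ((i - 3) mod 3)" using Suc False by simp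
    also have "(i - 3) mod 3 = i mod 3" using False by (metis le_mod_geq linorder_not_less)
    finally show ?thesis .
  qed
qed simp

lemma length_concat_replicate: "length (concat (replicate k l)) = k * length l"
  by (induction k) auto

lemma commutes_omega_power_list:
  assumes "c = concat (replicate k [W, V, U])" "k > 0" "c @ n = n @ c"
  shows "\<exists>j. n = concat (replicate j [W, V, U])"
proof -
  have lc: "length c = 3 * k" using assms(1) by (simp add: length_concat_replicate)
  have c: "c ! i = [W, V, U] ! (i mod 3)" if "i < length c" for i
    using omega_power_nth that lc assms(1) by simp
  have n: "n ! i = [W, V, U] ! (i mod 3)" if "i < length n" for i
    using that
  proof (induction i rule: less_induct)
    case (less i)
    have *: "n ! i = (c @ n) ! i" using assms(3) less.prems by (simp add: nth_append)
    show ?case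
    proof (cases "i < length c")
      case True
      then show ?thesis using * c by (simp add: nth_append)
    next
      case False
      then have "n ! i = n ! (i - length c)" using * by (simp add: nth_append)
      also have "\<dots> = [W, V, U] ! ((i - 3 * k) mod 3)"
        using less False lc assms(2) by simp
      also have "(i - 3 * k) mod 3 = i mod 3"
        using False lc by (metis le_add_diff_inverse2 linorder_not_less mod_mult_self2)
      finally show ?thesis .
    qed
  qed
  have "length n mod 3 = 0"
  proof -
    have "(c @ n) ! length n = [W, V, U] ! (length n mod 3)"
    proof (cases "length n < length c")
      case True
      then show ?thesis using c by (simp add: nth_append)
    next
      case False
      then have "(c @ n) ! length n = n ! (length n - length c)" by (simp add: nth_append)
      also have "\<dots> = [W, V, U] ! ((length n - 3 * k) mod 3)"
        using n[of "length n - length c"] lc assms(2) False by simp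
      also have "(length n - 3 * k) mod 3 = length n mod 3"
        using False lc by (metis le_add_diff_inverse2 linorder_not_less mod_mult_self2)
      finally show ?thesis .
    qed
    moreover have "(n @ c) ! length n = W" using c[of 0] lc assms(2) by (simp add: nth_append)
    moreover have "length n mod 3 = 0 \<or> length n mod 3 = 1 \<or> length n mod 3 = 2" by auto
    ultimately show ?thesis using assms(3) by auto
  qed
  then obtain j where j: "length n = 3 * j" by auto
  then have "n = concat (replicate j [W, V, U])"
    using n omega_power_nth by (intro nth_equalityI) (simp_all add: length_concat_replicate)
  then show ?thesis by blast
qed

text \<open>The word of \<open>omega ^ k\<close> has different ends, hence its product with
  \<open>x\<close> or with the inverse of \<open>x\<close> is reduced as written. The two lists then
  commute, which forces period three letter by letter.\<close>

lemma centralizer_omega_power: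
  assumes "x * omega ^ k = omega ^ k * x" "k > 0"
  shows "\<exists>j. x = omega ^ j \<or> x = inverse omega ^ j"
proof (cases "x = 1")
  case True
  then show ?thesis by (intro exI[of _ 0]) simp
next
  case False
  let ?c = "concat (replicate k [W, V, U])"
  have c: "cyc_reduced ?c" using cyc_reduced_concat_replicate[OF cyc_reduced_omega assms(2)] .
  have wc: "wd ?c = omega ^ k" by (simp add: omega_def wd_concat_replicate del: wd_simps)
  have ne: "letters x \<noteq> []" "?c \<noteq> []" using False c by (auto simp: cyc_reduced_def)
  have d: "distinct_adj ?c" "hd ?c \<noteq> last ?c" using c by (auto simp: cyc_reduced_def)
  have pow: "wd (concat (replicate j [W, V, U])) = omega ^ j" for j
    by (simp add: omega_def wd_concat_replicate del: wd_simps)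
  have comm: "wd ?c * wd (letters x) = wd (letters x) * wd ?c" using assms(1) wc by simp
  have comm': "wd ?c * wd (rev (letters x)) = wd (rev (letters x)) * wd ?c"
    using commute_inv[OF assms(1)] wc by (simp add: wd_rev)
  note 1 = commuting_cancel[OF d(1) ne(2) distinct_adj_letters ne(1) comm]
  note 2 = commuting_cancel[OF d(1) ne(2) _ _ comm']
  consider "last ?c \<noteq> hd (letters x)" | "last ?c \<noteq> last (letters x)"
    using 1(1) d(2) by metis
  then show ?thesis
  proof cases
    case 1
    then have "?c @ letters x = letters x @ ?c"
      using commuting_cancel(2)[OF d(1) ne(2) distinct_adj_letters ne(1) comm] by blast
    then obtain j where "letters x = concat (replicate j [W, V, U])"
      using commutes_omega_power_list[OF refl assms(2)] by blast
    then show ?thesis by (metis pow wd_letters)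
  next
    case 2
    then have "?c @ rev (letters x) = rev (letters x) @ ?c"
      using commuting_cancel(2)[OF d(1) ne(2) _ _ comm'] ne by (simp add: hd_rev)
    then obtain j where "rev (letters x) = concat (replicate j [W, V, U])"
      using commutes_omega_power_list[OF refl assms(2)] by blast
    then have "inverse x = omega ^ j" by (metis pow wd_letters wd_rev)
    then show ?thesis by (metis inv_inv inv_power)
  qed
qed

text \<open>A product of three rotated copies of an odd involution has palindromic passages unless the
  involution is a letter; a cyclic power of \<open>omega\<close> has none.\<close>

lemma involution_product_conj_omega:
  assumes x: "letters x = m @ [b] @ rev m"
    and c: "conj_words (rot (rot x) * rot x * x) (omega ^ k) \<or>
      conj_words (rot (rot x) * rot x * x) (inverse omega ^ k)" and "k > 0"
  shows "m = []"
proof (rule ccontr)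
  assume "m \<noteq> []"
  then obtain m' a where m: "m = m' @ [a]" by (metis append_butlast_last_id)
  let ?x = "letters x"
  let ?l = "map nxt (map nxt ?x) @ map nxt ?x @ ?x"
  have ne: "?x \<noteq> []" using x by simp
  have h: "last ?x = hd ?x" using x by (cases m) (simp_all add: last_rev)
  \<comment> \<open>A palindrome has equal ends, and its three rotated copies have three different
    end letters, so nothing cancels, not even cyclically.\<close>
  have red: "cyc_reduced ?l"
    using ne by (auto simp: cyc_reduced_def distinct_adj_append_iff hd_append hd_map last_map h
        simp del: map_map)
  have "wd ?l = rot (rot x) * rot x * x" by (simp add: mult.assoc del: map_map flip: rot_wd)
  then have c': "conj_words (wd ?l) (omega ^ k) \<or> conj_words (wd ?l) (inverse omega ^ k)" using c by simp
  have "\<exists>n r. (r = [W, V, U] \<or> r = [U, V, W]) \<and> ?l = rotate n (concat (replicate k r))"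
  proof -
    have o: "omega ^ k = wd (concat (replicate k [W, V, U]))"
      "inverse omega ^ k = wd (concat (replicate k [U, V, W]))"
      by (simp_all add: omega_def wd_concat_replicate mult.assoc)
    have "cyc_reduced (concat (replicate k [W, V, U]))" "cyc_reduced (concat (replicate k [U, V, W]))"
      using cyc_reduced_concat_replicate[OF _ \<open>k > 0\<close>, of "[W, V, U]"]
        cyc_reduced_concat_replicate[OF _ \<open>k > 0\<close>, of "[U, V, W]"]
      by (simp_all add: cyc_reduced_def del: concat_replicate_trivial)
    then show ?thesis using c' unfolding o using red conj_words_sym cyc_reduced_conj by metis
  qed
  then obtain n r where r: "r = [W, V, U] \<or> r = [U, V, W]" "?l = rotate n (concat (replicate k r))"
    by blast
  let ?p = "concat (replicate k r)"
  have len: "length ?p = 3 * k" using r(1) by (auto simp: length_concat_replicate)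
  have pn: "?l ! i = r ! ((n + i) mod 3)" if "i < 3 * k" for i
  proof -
    have power_nth: "concat (replicate k r) ! i = r ! (i mod length r)" if "i < k * length r"
      for k i and r :: "letter list"
      using that
    proof (induction k arbitrary: i)
      case (Suc k)
      then show ?case by (cases "i < length r") (simp_all add: nth_append le_mod_geq)
    qed simp
    have "length r = 3" using r(1) by auto
    have "?l ! i = ?p ! ((n + i) mod (3 * k))" unfolding r(2) using that len by (simp add: nth_rotate)
    also have "\<dots> = r ! ((n + i) mod (3 * k) mod 3)"
    proof -
      have "(n + i) mod (3 * k) < k * length r"
        using \<open>length r = 3\<close> \<open>k > 0\<close> by (simp add: mult.commute)
      from power_nth[OF this] show ?thesis using \<open>length r = 3\<close> by simp
    qed
    also have "(n + i) mod (3 * k) mod 3 = (n + i) mod 3" by (simp add: mod_mod_cancel)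
    finally show ?thesis .
  qed
  define q where "q = length (map nxt (map nxt ?x) @ map nxt ?x) + length m'"
  have split: "?l = (map nxt (map nxt ?x) @ map nxt ?x) @ m' @ [a, b, a] @ rev m'"
    by (subst (3) x) (simp add: m)
  have "?l ! q = a" "?l ! (q + 2) = a" unfolding split q_def by (simp_all add: nth_append)
  moreover have "length ?l = 3 * k" unfolding r(2) using len by simp
  moreover have "q + 2 < length ?l" unfolding split q_def by simp
  ultimately have "r ! ((n + q) mod 3) = r ! ((n + q + 2) mod 3)"
    using pn[of q] pn[of "q + 2"] by (simp add: add.assoc)
  moreover have "(n + q) mod 3 = 0 \<or> (n + q) mod 3 = 1 \<or> (n + q) mod 3 = 2" by auto
  moreover have "(n + q + 2) mod 3 = ((n + q) mod 3 + 2) mod 3" by presburger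
  ultimately show False using r(1) by auto
qed

section \<open>Integer matrices of determinant one\<close>

datatype mat2 = Mat int int int int

instantiation mat2 :: monoid_mult
begin
definition one_mat2 :: mat2 where "one_mat2 = Mat 1 0 0 1"
fun times_mat2 :: "mat2 \<Rightarrow> mat2 \<Rightarrow> mat2" where
  "times_mat2 (Mat a b c d) (Mat a' b' c' d') =
    Mat (a * a' + b * c') (a * b' + b * d') (c * a' + d * c') (c * b' + d * d')"
instance
proof
  fix x y z :: mat2
  show "x * y * z = x * (y * z)" by (cases x; cases y; cases z) (simp add: algebra_simps)
  show "1 * x = x" "x * 1 = x" by (cases x; simp add: one_mat2_def)+
qed
end

fun det :: "mat2 \<Rightarrow> int" where "det (Mat a b c d) = a * d - b * c"
fun trc :: "mat2 \<Rightarrow> int" where "trc (Mat a b c d) = a + d"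
fun adj :: "mat2 \<Rightarrow> mat2" where "adj (Mat a b c d) = Mat d (- b) (- c) a"
fun neg :: "mat2 \<Rightarrow> mat2" where "neg (Mat a b c d) = Mat (- a) (- b) (- c) (- d)"

lemma det_mult [simp]: "det (x * y) = det x * det y"
  by (cases x; cases y) (simp add: algebra_simps)

lemma det_one [simp]: "det 1 = 1" by (simp add: one_mat2_def)

lemma adj_mult: "det x = 1 \<Longrightarrow> adj x * x = 1" "det x = 1 \<Longrightarrow> x * adj x = 1"
  by (cases x; simp add: one_mat2_def algebra_simps)+

lemma mat2_left_cancel: "det x = 1 \<Longrightarrow> x * y = x * z \<longleftrightarrow> y = z"
  by (metis adj_mult(1) mult.assoc mult_1_left)

lemma mat2_right_cancel: "det x = 1 \<Longrightarrow> y * x = z * x \<longleftrightarrow> y = z"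
  by (metis adj_mult(2) mult.assoc mult_1_right)

lemma det_adj [simp]: "det (adj x) = det x" by (cases x) simp

lemma neg_mult [simp]: "neg x * y = neg (x * y)" "x * neg y = neg (x * y)" "neg (neg x) = x"
  "neg x = neg y \<longleftrightarrow> x = y"
  by (cases x; cases y; simp)+

lemma trc_one_cube: "det x = 1 \<Longrightarrow> trc x = 1 \<Longrightarrow> x * x * x = neg 1"
proof (cases x)
  case (Mat a b c d)
  assume "det x = 1" "trc x = 1"
  then have "a * d - b * c = 1" and d: "d = 1 - a" using Mat by auto
  then have bc: "b * c = a * (1 - a) - 1" by simp
  have "a * a + b * c = a - 1" "c * b + d * d = d - 1" "a * b + b * d = b" "c * a + d * c = c"
    using bc unfolding d by (simp_all add: algebra_simps)
  then have sq: "x * x = Mat (a - 1) b c (d - 1)" by (simp add: Mat)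
  have "(a - 1) * a + b * c = - 1" "c * b + (d - 1) * d = - 1"
    "(a - 1) * b + b * d = 0" "c * a + (d - 1) * c = 0"
    using bc unfolding d by (simp_all add: algebra_simps)
  then show ?thesis unfolding sq by (simp add: Mat one_mat2_def)
qed

lemma trc_zero_square: "det x = 1 \<Longrightarrow> trc x = 0 \<Longrightarrow> x * x = neg 1"
proof (cases x)
  case (Mat a b c d)
  assume "det x = 1" "trc x = 0"
  then have "a * d - b * c = 1" and d: "d = - a" using Mat by auto
  then have bc: "b * c = - (a * a) - 1" by simp
  then have "c * b = - (a * a) - 1" by (simp add: mult.commute)
  with bc d show ?thesis by (simp add: Mat one_mat2_def algebra_simps)
qed

lemma trc_neg_one_cube: "det x = 1 \<Longrightarrow> trc x = - 1 \<Longrightarrow> x * x * x = 1"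
proof -
  assume x: "det x = 1" "trc x = - 1"
  have "det (neg x) = 1" "trc (neg x) = 1" using x by (cases x; simp)+
  from trc_one_cube[OF this] have "neg (x * x * x) = neg 1" by simp
  then show ?thesis by (simp only: neg_mult(4))
qed

lemma braid_commute_eq:
  assumes "x * y * x = y * x * y" "x * y = y * x" "det x = 1" "det y = 1"
  shows "x = y"
proof -
  have "(x * y) * x = (x * y) * y" using assms(1,2) by simp
  moreover have "det (x * y) = 1" using assms by simp
  ultimately show ?thesis by (metis mat2_left_cancel)
qed

text \<open>For matrices of determinant one, \<open>x y x = tr (x y) x - y\<^sup>-\<^sup>1\<close>.  The braid relation then makes
  \<open>(tr (x y) - 1) (x - y)\<close> scalar.\<close>

lemma braid_trace:
  assumes "x * y * x = y * x * y" "x * y \<noteq> y * x" "det x = 1" "det y = 1"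
  shows "trc (x * y) = 1" "trc x = trc y" "trc (x * y * x) = 0"
proof -
  obtain a b c d where x: "x = Mat a b c d" by (cases x)
  obtain e f g h where y: "y = Mat e f g h" by (cases y)
  define s where "s = a * e + b * g + c * f + d * h"
  have dx: "a * d - b * c = 1" and dy: "e * h - f * g = 1" using assms x y by auto
  have L: "x * y * x = Mat (s * a - h) (s * b + f) (s * c + g) (s * d - e)"
  proof -
    have "a * (a * e + b * g) + c * (a * f + b * h) = s * a - (a * d - b * c) * h"
      "b * (a * e + b * g) + d * (a * f + b * h) = s * b + (a * d - b * c) * f"
      "a * (c * e + d * g) + c * (c * f + d * h) = s * c + (a * d - b * c) * g"
      "b * (c * e + d * g) + d * (c * f + d * h) = s * d - (a * d - b * c) * e"
      unfolding s_def by algebra+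
    then show ?thesis unfolding dx by (simp add: x y algebra_simps)
  qed
  have R: "y * x * y = Mat (s * e - d) (s * f + b) (s * g + c) (s * h - a)"
  proof -
    have "e * (e * a + f * c) + g * (e * b + f * d) = s * e - (e * h - f * g) * d"
      "f * (e * a + f * c) + h * (e * b + f * d) = s * f + (e * h - f * g) * b"
      "e * (g * a + h * c) + g * (g * b + h * d) = s * g + (e * h - f * g) * c"
      "f * (g * a + h * c) + h * (g * b + h * d) = s * h - (e * h - f * g) * a"
      unfolding s_def by algebra+
    then show ?thesis unfolding dy by (simp add: x y algebra_simps)
  qed
  have eq: "s * a - h = s * e - d" "s * b + f = s * f + b" "s * c + g = s * g + c" "s * d - e = s * h - a"
    using assms(1) L R by auto
  have "s = 1"
  proof (rule ccontr)
    assume "s \<noteq> 1"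
    have "(s - 1) * (b - f) = 0" "(s - 1) * (c - g) = 0" "(s - 1) * ((a - d) - (e - h)) = 0"
      using eq by (auto simp: algebra_simps)
    then have "b = f" "c = g" "a - d = e - h" using \<open>s \<noteq> 1\<close> by auto
    then have bf: "b = f" "c = g" "a = e - h + d" by auto
    have "x * y = y * x" unfolding x y bf by (simp add: algebra_simps)
    then show False using assms(2) by blast
  qed
  then show "trc (x * y) = 1" by (simp add: x y s_def algebra_simps)
  show t: "trc x = trc y" using eq(1) \<open>s = 1\<close> by (simp add: x y)
  show "trc (x * y * x) = 0" unfolding L using \<open>s = 1\<close> t by (simp add: x y)
qed

lemma square_ne_two: "(t :: int) * t \<noteq> 2"
proof
  assume t: "t * t = 2"
  have "\<bar>t\<bar> * \<bar>t\<bar> = 2" using t by (metis abs_mult_self_eq)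
  moreover have "\<bar>t\<bar> \<le> 1 \<Longrightarrow> \<bar>t\<bar> * \<bar>t\<bar> \<le> 1 * 1" by (rule mult_mono) auto
  moreover have "\<bar>t\<bar> \<ge> 2 \<Longrightarrow> \<bar>t\<bar> * \<bar>t\<bar> \<ge> 2 * 2" by (rule mult_mono) auto
  ultimately show False by linarith
qed

text \<open>As \<open>x\<close> is not scalar, \<open>k z = l x + m\<close> with
  \<open>k \<noteq> 0\<close>. All three matrices have the same trace \<open>t\<close>, and both
  products with \<open>y\<close> have trace one. Taking traces, also after multiplication by
  \<open>y\<close>, gives \<open>(k - l) t = 2 m\<close> and \<open>k - l = m t\<close>; so
  \<open>m (2 - t^2) = 0\<close>, and \<open>2\<close> is not a square.\<close>

lemma commuting_braid_partner_unique:
  assumes xy: "x * y * x = y * x * y" "x * y \<noteq> y * x" and zy: "z * y * z = y * z * y"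
    and xz: "x * z = z * x" and det: "det x = 1" "det y = 1" "det z = 1"
  shows "z = x"
proof -
  have "z * y \<noteq> y * z"
  proof
    assume "z * y = y * z"
    then have "z = y" by (rule braid_commute_eq[OF zy _ det(3,2)])
    with xz xy(2) show False by metis
  qed
  note tx = braid_trace[OF xy det(1,2)] and tz = braid_trace[OF zy this det(3,2)]
  obtain a b c d where x: "x = Mat a b c d" by (cases x)
  obtain e f g h where y: "y = Mat e f g h" by (cases y)
  obtain p q r u where z: "z = Mat p q r u" by (cases z)
  have comm: "b * r = q * c" "a * q + b * u = p * b + q * d" "c * p + d * r = r * a + u * c"
  proof -
    have "a * p + b * r = p * a + q * c" "a * q + b * u = p * b + q * d" "c * p + d * r = r * a + u * c"
      using xz unfolding x z times_mat2.simps mat2.inject by blast+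
    then show "b * r = q * c" "a * q + b * u = p * b + q * d" "c * p + d * r = r * a + u * c"
      by (simp_all only: mult.commute[of p a] add_left_cancel)
  qed
  have sx: "a * e + b * g + c * f + d * h = 1" and sz: "p * e + q * g + r * f + u * h = 1"
    using tx(1) tz(1) by (simp_all add: x y z)
  have t: "a + d = e + h" "p + u = e + h" using tx(2) tz(2) by (simp_all add: x y z)
  have key: "z = x" if "k \<noteq> 0" "k * p = l * a + m" "k * q = l * b" "k * r = l * c" "k * u = l * d + m" for k l m
  proof -
    have 1: "k * (e + h) = l * (e + h) + 2 * m"
    proof -
      have "k * (p + u) = l * (a + d) + 2 * m" using that by (simp add: distrib_left)
      then show ?thesis unfolding t .
    qed
    have "k * (p * e + q * g + r * f + u * h) = l * (a * e + b * g + c * f + d * h) + m * (e + h)"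
    proof -
      have "k * (p * e + q * g + r * f + u * h) = (k * p) * e + (k * q) * g + (k * r) * f + (k * u) * h"
        by (simp add: algebra_simps)
      then show ?thesis unfolding that by (simp add: algebra_simps)
    qed
    then have 2: "k = l + m * (e + h)" using sx sz by simp
    have "m * (2 - (e + h) * (e + h)) = 0" using 1 unfolding 2 by (simp add: algebra_simps)
    then have "m = 0" using square_ne_two[of "e + h"] by auto
    then have "l = k" using 2 by simp
    then show ?thesis using that \<open>m = 0\<close> by (simp add: x z)
  qed
  show ?thesis
  proof (cases "b = 0 \<and> c = 0 \<and> a = d")
    case True
    then have "x * y = y * x" by (simp add: x y mult.commute)
    then show ?thesis using xy by blast
  next
    case False
    then consider "b \<noteq> 0" | "c \<noteq> 0" | "a - d \<noteq> 0" by fastforce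
    then show ?thesis
    proof cases
      case 1
      show ?thesis by (rule key[OF 1, of q "b * p - q * a"]) (use comm in \<open>simp_all add: algebra_simps\<close>)
    next
      case 2
      show ?thesis by (rule key[OF 2, of r "c * p - r * a"]) (use comm in \<open>simp_all add: algebra_simps\<close>)
    next
      case 3
      show ?thesis by (rule key[OF 3, of "p - u" "(a - d) * p - (p - u) * a"])
          (use comm in \<open>simp_all add: algebra_simps\<close>)
    qed
  qed
qed

text \<open>Reduction theory of binary quadratic forms of discriminant \<open>-3\<close>, definite
  of either sign. Conjugation by an elementary matrix moves \<open>a\<close> by an off-diagonal
  entry, and \<open>\<bar>b c\<bar> = a^2 - a + 1\<close> makes one of these entries small enough to
  decrease \<open>\<bar>2 a - 1\<bar>\<close>.\<close>

lemma elliptic_induct [consumes 2, case_names pos neg conj]: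
  assumes "det x = 1" "trc x = 1"
    and "P (Mat 0 (- 1) 1 1)" "P (Mat 0 1 (- 1) 1)"
    and conj: "\<And>x g. g \<in> {Mat 1 (- 1) 0 1, Mat 1 1 0 1, Mat 1 0 1 1, Mat 1 0 (- 1) 1} \<Longrightarrow>
      P (g * x * adj g) \<Longrightarrow> P x"
  shows "P x"
proof -
  have "P (Mat a b c (1 - a))" if "b * c = a * (1 - a) - 1" for a b c
    using that
  proof (induction "nat \<bar>2 * a - 1\<bar>" arbitrary: a b c rule: less_induct)
    case less
    let ?x = "Mat a b c (1 - a)"
    have bc: "b * c = a - a * a - 1" using less.prems by (simp add: algebra_simps)
    have step: "P ?x" if g: "g \<in> {Mat 1 (- 1) 0 1, Mat 1 1 0 1, Mat 1 0 1 1, Mat 1 0 (- 1) 1}"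
      and eq: "g * ?x * adj g = Mat a' b' c' (1 - a')" and "\<bar>2 * a' - 1\<bar> < \<bar>2 * a - 1\<bar>" for g a' b' c'
    proof -
      have "det g = 1" using g by auto
      then have "det (Mat a' b' c' (1 - a')) = det ?x" by (simp flip: eq del: det.simps)
      then have "b' * c' = a' * (1 - a') - 1" using less.prems by simp
      then have "P (Mat a' b' c' (1 - a'))" using less.hyps that by simp
      then show ?thesis using conj[OF g] eq by metis
    qed
    have cT: "Mat 1 (- 1) 0 1 * ?x * adj (Mat 1 (- 1) 0 1) = Mat (a - c) (b + 2 * a - 1 - c) c (1 - (a - c))"
      "Mat 1 1 0 1 * ?x * adj (Mat 1 1 0 1) = Mat (a + c) (b - 2 * a + 1 - c) c (1 - (a + c))"
      "Mat 1 0 1 1 * ?x * adj (Mat 1 0 1 1) = Mat (a - b) b (c + 2 * a - 1 - b) (1 - (a - b))"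
      "Mat 1 0 (- 1) 1 * ?x * adj (Mat 1 0 (- 1) 1) = Mat (a + b) b (c - 2 * a + 1 - b) (1 - (a + b))"
      by (simp_all add: algebra_simps)
    note move = step[OF _ cT(1), simplified] step[OF _ cT(2), simplified]
      step[OF _ cT(3), simplified] step[OF _ cT(4), simplified]
    have ne: "b \<noteq> 0" "c \<noteq> 0"
    proof -
      have "a * a - a \<ge> 0"
      proof (cases "a \<ge> 1")
        case True
        then have "a * (a - 1) \<ge> 0" by (intro mult_nonneg_nonneg) auto
        then show ?thesis by (simp add: algebra_simps)
      next
        case False
        then have "(- a) * (1 - a) \<ge> 0" by (intro mult_nonneg_nonneg) auto
        then show ?thesis by (simp add: algebra_simps)
      qed
      then show "b \<noteq> 0" "c \<noteq> 0" using bc by auto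
    qed
    consider "a = 0" | "a = 1" | "a \<ge> 2" | "a \<le> - 1" by linarith
    then show ?case
    proof cases
      case 1
      then have "b * c = - 1" using bc by simp
      then have "b = 1 \<and> c = - 1 \<or> b = - 1 \<and> c = 1"
        by (metis minus_equation_iff mult_minus_right pos_zmult_eq_1_iff_lemma zmult_eq_1_iff)
      then show ?thesis using assms(3,4) 1 by auto
    next
      \<comment> \<open>The measure at \<open>a = 1\<close> equals that at \<open>a = 0\<close>, so
        the descent stops here too; one explicit conjugation leads to \<open>a = 0\<close>.\<close>
      case 2
      then have "b * c = - 1" using bc by simp
      then have bcases: "b = 1 \<and> c = - 1 \<or> b = - 1 \<and> c = 1"
        by (metis minus_equation_iff mult_minus_right pos_zmult_eq_1_iff_lemma zmult_eq_1_iff)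
      show ?thesis
      proof (cases "c = 1")
        case True
        then have "b = - 1" using bcases by auto
        then have "P (Mat 1 (- 1) 0 1 * ?x * adj (Mat 1 (- 1) 0 1))" using assms(3) 2 True by simp
        then show ?thesis using conj[of "Mat 1 (- 1) 0 1"] by blast
      next
        case False
        then have "b = 1" "c = - 1" using bcases by auto
        then have "P (Mat 1 1 0 1 * ?x * adj (Mat 1 1 0 1))" using assms(4) 2 by simp
        then show ?thesis using conj[of "Mat 1 1 0 1"] by blast
      qed
    next
      case 3
      have "\<bar>b\<bar> \<le> a - 1 \<or> \<bar>c\<bar> \<le> a - 1"
      proof (rule ccontr)
        assume "\<not> ?thesis"
        then have "a * a \<le> \<bar>b\<bar> * \<bar>c\<bar>" using 3 by (intro mult_mono) auto
        also have "\<bar>b\<bar> * \<bar>c\<bar> = \<bar>a - a * a - 1\<bar>" by (simp flip: abs_mult add: bc)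
        finally have 4: "a * a \<le> \<bar>a - a * a - 1\<bar>" .
        moreover have "a * 2 \<le> a * a" using 3 by (intro mult_left_mono) auto
        ultimately show False using 3 by linarith
      qed
      then consider "b > 0" "b \<le> a - 1" | "b < 0" "- b \<le> a - 1" | "c > 0" "c \<le> a - 1" | "c < 0" "- c \<le> a - 1"
        using ne by linarith
      then show ?thesis
      proof cases
        case 1
        then show ?thesis using \<open>a \<ge> 2\<close> by (intro move(3)) linarith
      next
        case 2
        then show ?thesis using \<open>a \<ge> 2\<close> by (intro move(4)) linarith
      next
        case 3
        then show ?thesis using \<open>a \<ge> 2\<close> by (intro move(1)) linarith
      next
        case 4
        then show ?thesis using \<open>a \<ge> 2\<close> by (intro move(2)) linarith
      qed
    next
      case 4
      have "\<bar>b\<bar> \<le> - a \<or> \<bar>c\<bar> \<le> - a"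
      proof (rule ccontr)
        assume "\<not> ?thesis"
        then have "(1 - a) * (1 - a) \<le> \<bar>b\<bar> * \<bar>c\<bar>" using 4 by (intro mult_mono) auto
        also have "\<bar>b\<bar> * \<bar>c\<bar> = \<bar>a - a * a - 1\<bar>" by (simp flip: abs_mult add: bc)
        finally have "1 - 2 * a + a * a \<le> \<bar>a - a * a - 1\<bar>" by (simp add: algebra_simps)
        moreover have "0 \<le> a * a" by simp
        ultimately show False using 4 by linarith
      qed
      then consider "b > 0" "b \<le> - a" | "b < 0" "- b \<le> - a" | "c > 0" "c \<le> - a" | "c < 0" "- c \<le> - a"
        using ne by linarith
      then show ?thesis
      proof cases
        case 1
        then show ?thesis using \<open>a \<le> - 1\<close> by (intro move(4)) linarith
      next
        case 2
        then show ?thesis using \<open>a \<le> - 1\<close> by (intro move(3)) linarith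
      next
        case 3
        then show ?thesis using \<open>a \<le> - 1\<close> by (intro move(2)) linarith
      next
        case 4
        then show ?thesis using \<open>a \<le> - 1\<close> by (intro move(1)) linarith
      qed
    qed
  qed
  moreover obtain a b c d where x: "x = Mat a b c d" by (cases x)
  moreover have "d = 1 - a" using assms(2) x by simp
  moreover have "b * c = a * (1 - a) - 1" using assms(1) x calculation by simp
  ultimately show ?thesis by simp
qed

section \<open>The braid group and its actions\<close>

text \<open>The carrier of \<open>braid_group 4\<close> as a type of its own, so that the simplifier
  computes in it through the class \<open>mult_group\<close>.\<close>

typedef b4 = "carrier (braid_group 4)" morphisms Rep_b4 Abs_b4
proof -
  interpret group "braid_group 4" by (rule group_braid_group)
  show ?thesis using one_closed by blast
qed

lemma Rep_b4_carrier [simp]: "Rep_b4 x \<in> carrier (braid_group 4)"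
  by (rule Rep_b4)

instantiation b4 :: mult_group
begin
definition one_b4 :: b4 where "one_b4 = Abs_b4 \<one>\<^bsub>braid_group 4\<^esub>"
definition times_b4 :: "b4 \<Rightarrow> b4 \<Rightarrow> b4" where
  "times_b4 x y = Abs_b4 (Rep_b4 x \<otimes>\<^bsub>braid_group 4\<^esub> Rep_b4 y)"
definition inverse_b4 :: "b4 \<Rightarrow> b4" where
  "inverse_b4 x = Abs_b4 (inv\<^bsub>braid_group 4\<^esub> Rep_b4 x)"
instance
proof
  interpret group "braid_group 4" by (rule group_braid_group)
  fix x y z :: b4
  show "x * y * z = x * (y * z)"
    by (simp add: times_b4_def Abs_b4_inverse m_assoc)
  show "1 * x = x" "x * 1 = x"
    by (simp_all add: times_b4_def one_b4_def Abs_b4_inverse Rep_b4_inverse)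
  show "inverse x * x = 1"
    by (simp add: times_b4_def one_b4_def inverse_b4_def Abs_b4_inverse)
qed
end

lemma Rep_b4_one: "Rep_b4 1 = \<one>\<^bsub>braid_group 4\<^esub>"
proof -
  interpret group "braid_group 4" by (rule group_braid_group)
  show ?thesis by (simp add: one_b4_def Abs_b4_inverse)
qed

lemma Rep_b4_mult: "Rep_b4 (x * y) = Rep_b4 x \<otimes>\<^bsub>braid_group 4\<^esub> Rep_b4 y"
proof -
  interpret group "braid_group 4" by (rule group_braid_group)
  show ?thesis by (simp add: times_b4_def Abs_b4_inverse)
qed

lemma Rep_b4_inverse_elt: "Rep_b4 (inverse x) = inv\<^bsub>braid_group 4\<^esub> Rep_b4 x"
proof -
  interpret group "braid_group 4" by (rule group_braid_group)
  show ?thesis by (simp add: inverse_b4_def Abs_b4_inverse)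
qed

definition s1 :: b4 where "s1 = Abs_b4 (braid_sigma 4 1)"
definition s2 :: b4 where "s2 = Abs_b4 (braid_sigma 4 2)"
definition s3 :: b4 where "s3 = Abs_b4 (braid_sigma 4 3)"

lemma Rep_b4_s: "Rep_b4 s1 = braid_sigma 4 1" "Rep_b4 s2 = braid_sigma 4 2" "Rep_b4 s3 = braid_sigma 4 3"
  by (simp_all add: s1_def s2_def s3_def Abs_b4_inverse braid_sigma_carrier)

lemma s_relations:
  "s1 * s2 * s1 = s2 * s1 * s2" "s2 * s3 * s2 = s3 * s2 * s3" "s1 * s3 = s3 * s1"
proof -
  interpret group "braid_group 4" by (rule group_braid_group)
  show "s1 * s2 * s1 = s2 * s1 * s2"
    unfolding Rep_b4_inject[symmetric] Rep_b4_mult Rep_b4_s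
    using braid_sigma_braid[of 1 4] by (simp add: m_assoc braid_sigma_carrier numeral_2_eq_2)
  show "s2 * s3 * s2 = s3 * s2 * s3"
    unfolding Rep_b4_inject[symmetric] Rep_b4_mult Rep_b4_s
    using braid_sigma_braid[of 2 4] by (simp add: m_assoc braid_sigma_carrier)
  show "s1 * s3 = s3 * s1"
    unfolding Rep_b4_inject[symmetric] Rep_b4_mult Rep_b4_s
    using braid_sigma_commute[of 1 3 4] by simp
qed

lemma s_relations_left:
  "s1 * (s2 * (s1 * x)) = s2 * (s1 * (s2 * x))" "s2 * (s3 * (s2 * x)) = s3 * (s2 * (s3 * x))"
  "s1 * (s3 * x) = s3 * (s1 * x)"
  using s_relations by (simp_all flip: mult.assoc)

lemma b4_induct [case_names one mult]:
  assumes "P 1" "\<And>s x. s \<in> {s1, s2, s3, inverse s1, inverse s2, inverse s3} \<Longrightarrow> P x \<Longrightarrow> P (s * x)"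
  shows "P x"
proof -
  interpret B: group "braid_group 4" by (rule group_braid_group)
  interpret presentation "{1..<4}" "braid_relations 4" by (rule braid_presentation)
  have "P (Abs_b4 (cls w))" if "w \<in> gwords {1..<4}" for w
    using that
  proof (induction w)
    case Nil
    then show ?case using assms(1) by (simp add: one_b4_def braid_group_def one_cls del: One_nat_def)
  next
    case (Cons p w)
    obtain i b where p: "p = (i, b)" by (cases p)
    with Cons.prems have i: "i \<in> {1..<4}" and w: "w \<in> gwords {1..<4}" by auto
    have cw: "cls w \<in> carrier (braid_group 4)" using w by (simp add: braid_group_def del: One_nat_def)
    have sg: "cls [(i, True)] = braid_sigma 4 i" by (simp add: braid_sigma_def presented_gen_def del: One_nat_def)
    have "cls [(i, False)] \<otimes>\<^bsub>braid_group 4\<^esub> cls [(i, True)] = \<one>\<^bsub>braid_group 4\<^esub>"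
      using i gword_cancel[of "[]" "{1..<4}" "[]" i "braid_relations 4" False]
      by (simp add: braid_group_def mult_cls one_cls cls_eq del: One_nat_def)
    moreover have car: "cls [(i, True)] \<in> carrier (braid_group 4)" "cls [(i, False)] \<in> carrier (braid_group 4)"
      using i by (simp_all add: braid_group_def del: One_nat_def)
    ultimately have inv: "cls [(i, False)] = inv\<^bsub>braid_group 4\<^esub> braid_sigma 4 i"
      using B.inv_equality[of "cls [(i, False)]" "cls [(i, True)]"] sg by simp
    have "i = 1 \<or> i = 2 \<or> i = 3" using i by auto
    then obtain s where s: "s \<in> {s1, s2, s3}" "Rep_b4 s = braid_sigma 4 i" using Rep_b4_s by blast
    then have "Rep_b4 (if b then s else inverse s) = cls [(i, b)]"
      using sg inv by (simp add: Rep_b4_inverse_elt)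
    moreover have "cls (p # w) = cls [(i, b)] \<otimes>\<^bsub>braid_group 4\<^esub> cls w"
      using w i by (simp add: braid_group_def mult_cls p del: One_nat_def)
    ultimately have "Abs_b4 (cls (p # w)) = (if b then s else inverse s) * Abs_b4 (cls w)"
      using cw by (simp only: times_b4_def Abs_b4_inverse)
    then show ?case using assms(2)[of "if b then s else inverse s"] Cons.IH[OF w] s(1) by auto
  qed
  moreover obtain w where "w \<in> gwords {1..<4}" "Rep_b4 x = cls w"
    using Rep_b4_carrier[of x] unfolding braid_group_def by (rule carrier_cases)
  ultimately show ?thesis by (metis Rep_b4_inverse)
qed

section \<open>Homomorphisms out of the braid group: matrices and exponent sums\<close>

definition b4_map :: "('b, 'c) monoid_scheme \<Rightarrow> 'b \<Rightarrow> 'b \<Rightarrow> 'b \<Rightarrow> b4 \<Rightarrow> 'b" where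
  "b4_map H a b c x = presented_lift H (\<lambda>i. if i = 1 then a else if i = 2 then b else c) (Rep_b4 x)"

lemma b4_map:
  assumes H: "group H" and car: "a \<in> carrier H" "b \<in> carrier H" "c \<in> carrier H"
    and rel: "a \<otimes>\<^bsub>H\<^esub> (b \<otimes>\<^bsub>H\<^esub> a) = b \<otimes>\<^bsub>H\<^esub> (a \<otimes>\<^bsub>H\<^esub> b)"
      "b \<otimes>\<^bsub>H\<^esub> (c \<otimes>\<^bsub>H\<^esub> b) = c \<otimes>\<^bsub>H\<^esub> (b \<otimes>\<^bsub>H\<^esub> c)" "a \<otimes>\<^bsub>H\<^esub> c = c \<otimes>\<^bsub>H\<^esub> a"
  shows "b4_map H a b c x \<in> carrier H"
    and "b4_map H a b c (x * y) = b4_map H a b c x \<otimes>\<^bsub>H\<^esub> b4_map H a b c y"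
    and "b4_map H a b c s1 = a" "b4_map H a b c s2 = b" "b4_map H a b c s3 = c"
proof -
  interpret H: group H by fact
  let ?f = "\<lambda>i::nat. if i = 1 then a else if i = 2 then b else c"
  have fc: "?f i \<in> carrier H" for i using car by simp
  have r: "gword_eval H ?f r = gword_eval H ?f s" if "(r, s) \<in> braid_relations 4" for r s
  proof -
    from that consider i j where "r = [(i, True), (j, True)]" "s = [(j, True), (i, True)]"
        "1 \<le> i" "i + 2 \<le> j" "j < 4"
      | i where "r = [(i, True), (i + 1, True), (i, True)]"
        "s = [(i + 1, True), (i, True), (i + 1, True)]" "1 \<le> i" "i + 1 < 4"
      unfolding braid_relations_def by blast
    then show ?thesis
    proof cases
      case 1
      then have "i = 1" "j = 3" by auto
      with 1 show ?thesis using rel car by simp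
    next
      case 2
      then have "i = 1 \<or> i = 2" by auto
      with 2 show ?thesis using rel car by auto
    qed
  qed
  have hom: "presented_lift H ?f \<in> hom (braid_group 4) H"
    unfolding braid_group_def
    by (rule presentation.presented_lift_hom[OF braid_presentation H]) (use fc r in auto)
  show "b4_map H a b c x \<in> carrier H" using hom by (simp add: b4_map_def hom_def Pi_iff)
  show "b4_map H a b c (x * y) = b4_map H a b c x \<otimes>\<^bsub>H\<^esub> b4_map H a b c y"
    using hom by (simp add: b4_map_def Rep_b4_mult hom_mult)
  have "presented_lift H ?f (braid_sigma 4 i) = ?f i" if "i \<in> {1..<4}" for i
    unfolding braid_sigma_def
    by (rule presentation.presented_lift_gen[OF braid_presentation H]) (use fc r that in auto)
  from this[of 1] this[of 2] this[of 3]
  show "b4_map H a b c s1 = a" "b4_map H a b c s2 = b" "b4_map H a b c s3 = c"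
    by (simp_all add: b4_map_def Rep_b4_s)
qed

definition sl2z :: "mat2 monoid" where
  "sl2z = \<lparr>carrier = {x. det x = 1}, monoid.mult = (*), one = 1\<rparr>"

lemma group_sl2z: "group sl2z"
proof (rule groupI)
  fix x assume "x \<in> carrier sl2z"
  then show "\<exists>y\<in>carrier sl2z. y \<otimes>\<^bsub>sl2z\<^esub> x = \<one>\<^bsub>sl2z\<^esub>"
    by (intro bexI[of _ "adj x"]) (simp_all add: sl2z_def adj_mult)
qed (auto simp: sl2z_def mult.assoc)

text \<open>The map \<open>R_*\<close> followed by the usual surjection of the braid group on three
  strands onto the integer matrices of determinant one.\<close>

definition mat :: "b4 \<Rightarrow> mat2" where
  "mat = b4_map sl2z (Mat 1 (- 1) 0 1) (Mat 1 0 1 1) (Mat 1 (- 1) 0 1)"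

lemma mat:
  "det (mat x) = 1" "mat (x * y) = mat x * mat y"
  "mat s1 = Mat 1 (- 1) 0 1" "mat s2 = Mat 1 0 1 1" "mat s3 = Mat 1 (- 1) 0 1"
proof -
  note m = b4_map[OF group_sl2z, of "Mat 1 (- 1) 0 1" "Mat 1 0 1 1" "Mat 1 (- 1) 0 1", folded mat_def]
  show "det (mat x) = 1" "mat (x * y) = mat x * mat y"
    "mat s1 = Mat 1 (- 1) 0 1" "mat s2 = Mat 1 0 1 1" "mat s3 = Mat 1 (- 1) 0 1"
    using m by (simp_all add: sl2z_def)
qed

lemma mat_one [simp]: "mat 1 = 1"
  using mat(2)[of 1 1] mat(1)[of 1] mat2_left_cancel[of "mat 1" "mat 1" 1] by simp

lemma mat_inverse: "mat (inverse x) = adj (mat x)"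
proof -
  have "mat (inverse x) * mat x = adj (mat x) * mat x"
    using mat(2)[of "inverse x" x] adj_mult(1)[OF mat(1)] by simp
  then show ?thesis using mat2_right_cancel[OF mat(1)] by blast
qed

definition int_add :: "int monoid" where
  "int_add = \<lparr>carrier = UNIV, monoid.mult = (+), one = 0\<rparr>"

lemma group_int_add: "group int_add"
  by (rule groupI) (auto simp: int_add_def intro: exI[of _ "- _"])

text \<open>The exponent sum, that is, the abelianization of the braid group.\<close>

definition expo :: "b4 \<Rightarrow> int" where "expo = b4_map int_add 1 1 1"

lemma expo: "expo (x * y) = expo x + expo y" "expo s1 = 1" "expo s2 = 1" "expo s3 = 1"
  using b4_map[OF group_int_add, of 1 1 1, folded expo_def] by (simp_all add: int_add_def)

lemma expo_one [simp]: "expo 1 = 0" using expo(1)[of 1 1] by simp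
lemma expo_inverse [simp]: "expo (inverse x) = - expo x"
  using expo(1)[of "inverse x" x] by simp
lemma expo_power: "expo (x ^ n) = int n * expo x"
  by (induction n) (simp_all add: expo algebra_simps)

definition bij_maps :: "('a \<Rightarrow> 'a) monoid" where
  "bij_maps = \<lparr>carrier = {f. bij f}, monoid.mult = (\<circ>), one = id\<rparr>"

lemma group_bij_maps: "group bij_maps"
proof (rule groupI)
  fix f :: "'a \<Rightarrow> 'a" assume "f \<in> carrier bij_maps"
  then show "\<exists>g\<in>carrier bij_maps. g \<otimes>\<^bsub>bij_maps\<^esub> f = \<one>\<^bsub>bij_maps\<^esub>"
    by (intro bexI[of _ "inv_into UNIV f"]) (simp_all add: bij_maps_def bij_is_inj bij_imp_bij_inv)
qed (auto simp: bij_maps_def bij_comp comp_assoc)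

lemma rword_morphism_eqI:
  assumes "group_morphism f" "group_morphism (g :: rword \<Rightarrow> 'a::mult_group)" "\<And>a. f (gen a) = g (gen a)"
  shows "f = g"
proof
  interpret f: group_morphism f by fact
  interpret g: group_morphism g by fact
  show "f x = g x" for x by (induction x rule: rword_induct) (simp_all add: assms(3))
qed

lemma group_morphism_comp: "group_morphism f \<Longrightarrow> group_morphism g \<Longrightarrow> group_morphism (f \<circ> g)"
  by (simp add: group_morphism_def)

section \<open>The action on the free product\<close>

text \<open>Conjugation by the braid generators on the three involutions, modulo the centre; the
  primed tables give the inverse automorphisms.\<close>

fun act_letter1 :: "letter \<Rightarrow> rword" where
  "act_letter1 U = gen V" | "act_letter1 V = gen V * gen U * gen V" | "act_letter1 W = gen W"
fun act_letter2 :: "letter \<Rightarrow> rword" where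
  "act_letter2 U = gen W" | "act_letter2 V = gen W * gen U * gen V * gen U * gen W"
| "act_letter2 W = gen W * gen U * gen W"
fun act_letter3 :: "letter \<Rightarrow> rword" where
  "act_letter3 U = gen U * gen V * gen U" | "act_letter3 V = gen U"
| "act_letter3 W = gen U * gen V * gen W * gen V * gen U"

fun act_letter1' :: "letter \<Rightarrow> rword" where
  "act_letter1' U = gen U * gen V * gen U" | "act_letter1' V = gen U" | "act_letter1' W = gen W"
fun act_letter2' :: "letter \<Rightarrow> rword" where
  "act_letter2' U = gen U * gen W * gen U" | "act_letter2' V = gen U * gen W * gen V * gen W * gen U"
| "act_letter2' W = gen U"
fun act_letter3' :: "letter \<Rightarrow> rword" where
  "act_letter3' U = gen V" | "act_letter3' V = gen V * gen U * gen V"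
| "act_letter3' W = gen V * gen U * gen W * gen U * gen V"

lemma act_letter_involution:
  "act_letter1 a * act_letter1 a = 1" "act_letter2 a * act_letter2 a = 1" "act_letter3 a * act_letter3 a = 1"
  "act_letter1' a * act_letter1' a = 1" "act_letter2' a * act_letter2' a = 1" "act_letter3' a * act_letter3' a = 1"
  by (cases a; simp add: mult.assoc)+

interpretation act1: group_morphism "ext act_letter1" by (rule ext_morphism) (rule act_letter_involution)
interpretation act2: group_morphism "ext act_letter2" by (rule ext_morphism) (rule act_letter_involution)
interpretation act3: group_morphism "ext act_letter3" by (rule ext_morphism) (rule act_letter_involution)
interpretation act1': group_morphism "ext act_letter1'" by (rule ext_morphism) (rule act_letter_involution)
interpretation act2': group_morphism "ext act_letter2'" by (rule ext_morphism) (rule act_letter_involution)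
interpretation act3': group_morphism "ext act_letter3'" by (rule ext_morphism) (rule act_letter_involution)

lemma group_morphism_id: "group_morphism id" by unfold_locales simp

lemma bij_act: "bij (ext act_letter1)" "bij (ext act_letter2)" "bij (ext act_letter3)"
proof -
  have 1: "ext act_letter1 \<circ> ext act_letter1' = id" "ext act_letter1' \<circ> ext act_letter1 = id"
    "ext act_letter2 \<circ> ext act_letter2' = id" "ext act_letter2' \<circ> ext act_letter2 = id"
    "ext act_letter3 \<circ> ext act_letter3' = id" "ext act_letter3' \<circ> ext act_letter3 = id"
    by (rule rword_morphism_eqI, (intro group_morphism_comp group_morphism_id; unfold_locales; simp),
        rule group_morphism_id, case_tac a; simp add: mult.assoc)+
  show "bij (ext act_letter1)" "bij (ext act_letter2)" "bij (ext act_letter3)"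
    using 1 by (metis o_bij)+
qed

lemma act_relations:
  "ext act_letter1 \<circ> (ext act_letter2 \<circ> ext act_letter1) = ext act_letter2 \<circ> (ext act_letter1 \<circ> ext act_letter2)"
  "ext act_letter2 \<circ> (ext act_letter3 \<circ> ext act_letter2) = ext act_letter3 \<circ> (ext act_letter2 \<circ> ext act_letter3)"
  "ext act_letter1 \<circ> ext act_letter3 = ext act_letter3 \<circ> ext act_letter1"
  by (rule rword_morphism_eqI, (unfold_locales; simp), (unfold_locales; simp), case_tac a; simp add: mult.assoc)+

definition act :: "b4 \<Rightarrow> rword \<Rightarrow> rword" where
  "act = b4_map bij_maps (ext act_letter1) (ext act_letter2) (ext act_letter3)"

lemma act:
  "bij (act x)" "act (x * y) = act x \<circ> act y"
  "act s1 = ext act_letter1" "act s2 = ext act_letter2" "act s3 = ext act_letter3"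
  using b4_map[OF group_bij_maps, of "ext act_letter1" "ext act_letter2" "ext act_letter3", folded act_def]
    bij_act act_relations by (simp_all add: bij_maps_def)

lemma act_mult [simp]: "act (x * y) z = act x (act y z)" by (simp add: act)

lemma act_one [simp]: "act 1 z = z"
proof -
  have "act 1 (act 1 z) = act 1 z" using act_mult[of 1 1 z] by simp
  then show ?thesis using act(1)[of 1] by (metis bij_is_inj injD)
qed

lemma act_inverse [simp]: "act (inverse x) (act x z) = z" "act x (act (inverse x) z) = z"
  by (simp_all flip: act_mult)

lemma act_morphism: "group_morphism (act x)"
proof (induction x rule: b4_induct)
  case one
  show ?case by unfold_locales simp
next
  case (mult s x)
  have gen: "group_morphism (act s1)" "group_morphism (act s2)" "group_morphism (act s3)"
    unfolding act by (rule act1.group_morphism_axioms act2.group_morphism_axioms act3.group_morphism_axioms)+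
  have inv: "group_morphism (act (inverse x))" if "group_morphism (act x)" for x
  proof
    fix y z
    interpret group_morphism "act x" by fact
    have "act x (act (inverse x) (y * z)) = act x (act (inverse x) y * act (inverse x) z)" by simp
    then show "act (inverse x) (y * z) = act (inverse x) y * act (inverse x) z"
      using act(1)[of x] by (metis bij_is_inj injD)
  qed
  have "group_morphism (act s)" using mult(1) gen inv by auto
  then show ?case unfolding act(2) using mult(2) by (rule group_morphism_comp)
qed

interpretation act: group_morphism "act x" by (rule act_morphism)

fun mat_vec :: "mat2 \<Rightarrow> int \<times> int \<Rightarrow> int \<times> int" where
  "mat_vec (Mat a b c d) (x, y) = (a * x + b * y, c * x + d * y)"

lemma mat_vec_mult: "mat_vec (x * y) v = mat_vec x (mat_vec y v)"
  by (cases x; cases y; cases v) (simp add: algebra_simps)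

lemma mat_vec_one [simp]: "mat_vec 1 v = v" by (cases v) (simp add: one_mat2_def)

lemma mat_vec_add: "mat_vec x (v + w) = mat_vec x v + mat_vec x w"
  by (cases x; cases v; cases w) (simp add: algebra_simps)

lemma mat_vec_diff: "mat_vec x (v - w) = mat_vec x v - mat_vec x w"
  by (cases x; cases v; cases w) (simp add: algebra_simps)

lemma mat_vec_zero [simp]: "mat_vec x 0 = 0"
  using mat_vec_diff[of x 0 0] by simp

lemma mat_vec_minus: "mat_vec x (- v) = - mat_vec x v"
  using mat_vec_diff[of x 0 v] by simp

text \<open>Letters are point reflections of the plane, and a braid acts on them through an affine
  map. Even words are translations and see only its linear part, which is the matrix of the braid;
  odd words also see the translation part \<open>v\<close>.\<close>

lemma act_even_vec:
  "(even_word (act x z) \<longleftrightarrow> even_word z) \<and> (\<exists>v. \<forall>z. word_vec (act x z) =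
    mat_vec (mat x) (word_vec z) + (if even_word z then 0 else v))"
proof -
  define P where "P x \<longleftrightarrow> (\<forall>z. even_word (act x z) \<longleftrightarrow> even_word z) \<and> (\<exists>v. \<forall>z. word_vec (act x z) =
    mat_vec (mat x) (word_vec z) + (if even_word z then 0 else v))" for x
  have P_mult: "P (x * y)" if xy: "P x" "P y" for x y
  proof -
    obtain v where v: "\<And>z. word_vec (act x z) = mat_vec (mat x) (word_vec z) + (if even_word z then 0 else v)"
      using xy unfolding P_def by blast
    obtain w where w: "\<And>z. word_vec (act y z) = mat_vec (mat y) (word_vec z) + (if even_word z then 0 else w)"
      using xy unfolding P_def by blast
    have "word_vec (act (x * y) z) = mat_vec (mat (x * y)) (word_vec z) +
        (if even_word z then 0 else mat_vec (mat x) w + v)" for z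
      using xy by (simp add: v w mat mat_vec_mult mat_vec_add P_def add.assoc)
    then show ?thesis using xy unfolding P_def by auto
  qed
  have P_inv: "P (inverse x)" if Px: "P x" for x
  proof -
    obtain v where v: "\<And>z. word_vec (act x z) = mat_vec (mat x) (word_vec z) + (if even_word z then 0 else v)"
      using Px unfolding P_def by blast
    have ev: "even_word (act (inverse x) z) \<longleftrightarrow> even_word z" for z
      using Px unfolding P_def by (metis act_inverse(2))
    have "word_vec (act (inverse x) z) = mat_vec (mat (inverse x)) (word_vec z) +
        (if even_word z then 0 else mat_vec (mat (inverse x)) (- v))" for z
    proof -
      have "mat_vec (mat (inverse x)) (word_vec z) =
          mat_vec (mat (inverse x)) (mat_vec (mat x) (word_vec (act (inverse x) z))
            + (if even_word z then 0 else v))"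
        using v[of "act (inverse x) z"] ev by simp
      also have "\<dots> = word_vec (act (inverse x) z) + mat_vec (mat (inverse x)) (if even_word z then 0 else v)"
        unfolding mat_vec_add mat_vec_mult[symmetric] mat(2)[symmetric] by simp
      finally have eq: "word_vec (act (inverse x) z) =
        mat_vec (mat (inverse x)) (word_vec z) - mat_vec (mat (inverse x)) (if even_word z then 0 else v)"
        by simp
      show ?thesis unfolding eq by (simp add: mat_vec_minus)
    qed
    then show ?thesis using ev unfolding P_def by blast
  qed
  have P_gen: "P s" if h: "\<And>a. act s (gen a) = h a" "\<And>a. \<not> even_word (h a)"
      "\<And>a. word_vec (h a) = mat_vec (mat s) (letter_vec a) + v" for s h v
  proof -
    have "(even_word (act s z) \<longleftrightarrow> even_word z) \<and> word_vec (act s z) =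
        mat_vec (mat s) (word_vec z) + (if even_word z then 0 else v)" for z
    proof (induction z rule: rword_induct)
      case one
      show ?case by simp
    next
      case (gen a z)
      then show ?case by (simp add: h word_vec_mult mat_vec_diff)
    qed
    then show ?thesis unfolding P_def by blast
  qed
  \<comment> \<open>Since \<open>U\<close> has vector zero, the translation part is the vector of
    the image of \<open>U\<close>.\<close>
  have "P s1"
    by (rule P_gen[of _ act_letter1 "(1, 0)"]; (case_tac a)?; simp add: act mat word_vec_mult mult.assoc)
  moreover have "P s2"
    by (rule P_gen[of _ act_letter2 "(0, 1)"]; (case_tac a)?; simp add: act mat word_vec_mult mult.assoc)
  moreover have "P s3"
    by (rule P_gen[of _ act_letter3 "(- 1, 0)"]; (case_tac a)?; simp add: act mat word_vec_mult mult.assoc)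
  moreover have "P 1" unfolding P_def by (intro conjI exI[of _ 0]) simp_all
  ultimately have "P x" by (induction x rule: b4_induct) (auto intro: P_mult P_inv)
  then show ?thesis unfolding P_def by blast
qed

lemma even_act [simp]: "even_word (act x z) \<longleftrightarrow> even_word z"
  using act_even_vec by blast

lemma word_vec_act: "even_word z \<Longrightarrow> word_vec (act x z) = mat_vec (mat x) (word_vec z)"
  using act_even_vec[of x z] by auto

section \<open>Braids modulo the centre\<close>

definition al :: b4 where "al = s1 * s2 * s3"
text \<open>A conjugate of \<open>beta_4\<close>, namely \<open>s1 * (al * s1) * inverse s1\<close>,
  chosen because it permutes the three involutions cyclically.\<close>

definition be :: b4 where "be = s1 * al"
definition Om :: b4 where "Om = al ^ 4"

lemma Om_alt: "Om = al * al * (al * al)"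
  by (simp add: Om_def power4_eq_xxxx mult.assoc)

lemma al_s: "al * s1 = s2 * al" "al * s2 = s3 * al" "al * al * s1 = s3 * (al * al)"
  "al * al * s3 = s1 * (al * al)"
proof -
  show 1: "al * s1 = s2 * al"
    unfolding al_def by (simp add: mult.assoc s_relations(3)[symmetric] s_relations_left(1))
  show 2: "al * s2 = s3 * al"
  proof -
    have "al * s2 = s1 * (s2 * s3 * s2)" by (simp add: al_def mult.assoc)
    also have "\<dots> = s3 * al"
      unfolding s_relations(2) by (simp add: al_def mult.assoc s_relations_left(3))
    finally show ?thesis .
  qed
  show "al * al * s1 = s3 * (al * al)"
    using 1 2 by (metis mult.assoc)
  show "al * al * s3 = s1 * (al * al)"
  proof -
    have "s2 * s3 * s1 * s2 * s3 * s3 = s2 * s1 * (s3 * s2 * s3) * s3"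
      by (simp add: mult.assoc s_relations_left(3))
    also have "\<dots> = s2 * s1 * s2 * (s3 * s2 * s3)"
      by (simp only: mult.assoc s_relations_left(2)[symmetric])
    also have "\<dots> = s1 * s2 * s1 * (s3 * s2 * s3)" unfolding s_relations(1) ..
    also have "\<dots> = al * al" by (simp add: al_def mult.assoc s_relations_left(3))
    finally have "s2 * s3 * s1 * s2 * s3 * s3 = al * al" .
    then show ?thesis by (metis al_def mult.assoc)
  qed
qed

lemma al_al_s2: "al * al * s2 = al * s3 * inverse al * (al * al)"
proof -
  have "al * al * s2 = al * (s3 * al)" using al_s(2) by (metis mult.assoc)
  then show ?thesis by (simp add: mult.assoc)
qed

lemma Om_central: "Om * x = x * Om"
proof -
  have 1: "Om * s1 = s1 * Om" "Om * s3 = s3 * Om"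
    unfolding Om_alt using al_s(3,4) by (metis mult.assoc)+
  have "al * Om = Om * al" by (simp add: Om_alt mult.assoc)
  then have 2: "Om * s2 = s2 * Om"
  proof -
    assume a: "al * Om = Om * al"
    have "Om * s2 * al = Om * al * s1" using al_s(1) by (simp add: mult.assoc)
    also have "\<dots> = al * s1 * Om" using a 1 by (metis mult.assoc)
    also have "\<dots> = s2 * Om * al" using al_s(1) a by (metis mult.assoc)
    finally show ?thesis by simp
  qed
  have inv: "Om * inverse y = inverse y * Om" if "Om * y = y * Om" for y
    using commute_inv[of y Om] that by simp
  show ?thesis
  proof (induction x rule: b4_induct)
    case (mult s x)
    have "Om * s = s * Om" using mult(1) 1 2 inv by auto
    then show ?case using mult(2) by (metis mult.assoc)
  qed simp
qed

text \<open>Pulled to the left through the copies of \<open>al\<close>, the three letters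
  \<open>s1\<close> become \<open>s1\<close>, \<open>s2\<close> and \<open>s3\<close>, which make up
  a fourth \<open>al\<close>.\<close>

lemma be_cube: "be * be * be = Om"
proof -
  have "be * be * be = s1 * (al * s1) * (al * s1) * al" by (simp add: be_def mult.assoc)
  also have "\<dots> = s1 * s2 * (al * s2) * al * al" unfolding al_s(1) by (simp add: mult.assoc)
  also have "\<dots> = s1 * s2 * s3 * al * al * al" unfolding al_s(2) by (simp add: mult.assoc)
  also have "\<dots> = Om" by (simp add: Om_alt al_def mult.assoc)
  finally show ?thesis .
qed

lemma s_al_be: "s1 = be * inverse al" "s2 = al * s1 * inverse al" "s3 = al * s2 * inverse al"
  using al_s by (simp_all add: be_def eq_mult_inv_iff mult.assoc)

text \<open>The subgroup generated by \<open>Om\<close>, written without integer exponents.\<close>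

definition Om_powers :: "b4 set" where
  "Om_powers = {c. \<exists>m n. c * Om ^ m = Om ^ n}"

lemma Om_power_central: "Om ^ n * x = x * Om ^ n"
  by (induction n) (simp_all add: mult.assoc Om_central, simp flip: mult.assoc add: Om_central)

lemma Om_powers_alt: "c \<in> Om_powers \<longleftrightarrow> (\<exists>n. c = Om ^ n \<or> c = inverse Om ^ n)"
proof
  assume "c \<in> Om_powers"
  then obtain m n where c: "c * Om ^ m = Om ^ n" by (auto simp: Om_powers_def)
  show "\<exists>n. c = Om ^ n \<or> c = inverse Om ^ n"
  proof (cases "m \<le> n")
    case True
    then have "c * Om ^ m = Om ^ (n - m) * Om ^ m" using c by (simp flip: power_add)
    then show ?thesis by auto
  next
    case False
    then have "Om ^ m = Om ^ (m - n) * Om ^ n" by (simp flip: power_add)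
    with c have "c * Om ^ (m - n) * Om ^ n = 1 * Om ^ n" by (simp add: mult.assoc)
    then have "c * Om ^ (m - n) = 1" by (simp only: mult_right_cancel')
    then have "inverse (Om ^ (m - n)) = c" by (metis inv_inv inv_unique)
    then show ?thesis by (metis inv_power)
  qed
next
  assume "\<exists>n. c = Om ^ n \<or> c = inverse Om ^ n"
  then obtain n where "c = Om ^ n \<or> c = inverse (Om ^ n)" by (auto simp: inv_power)
  then have "c * Om ^ 0 = Om ^ n \<or> c * Om ^ n = Om ^ 0" by auto
  then show "c \<in> Om_powers" unfolding Om_powers_def by blast
qed

lemma Om_powers_central: "c \<in> Om_powers \<Longrightarrow> c * x = x * c"
proof -
  assume "c \<in> Om_powers"
  then obtain n where "c = Om ^ n \<or> c = inverse (Om ^ n)" by (auto simp: Om_powers_alt inv_power)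
  then show ?thesis using Om_power_central commute_inv[of "Om ^ n" x] by metis
qed

lemma Om_powers_one [simp]: "1 \<in> Om_powers" and Om_powers_Om [simp]: "Om \<in> Om_powers"
  unfolding Om_powers_alt by (auto intro: exI[of _ 0] exI[of _ 1])

lemma Om_powers_mult [simp]:
  assumes "c \<in> Om_powers" "d \<in> Om_powers"
  shows "c * d \<in> Om_powers"
proof -
  obtain m n k l where "c * Om ^ m = Om ^ n" "d * Om ^ k = Om ^ l"
    using assms unfolding Om_powers_def by blast
  then have "c * d * Om ^ (m + k) = Om ^ (n + l)"
    by (metis Om_power_central mult.assoc power_add)
  then show ?thesis unfolding Om_powers_def by blast
qed

lemma Om_powers_inverse [simp]: "c \<in> Om_powers \<Longrightarrow> inverse c \<in> Om_powers"
  unfolding Om_powers_alt by (metis inv_inv inv_power)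

definition eqz :: "b4 \<Rightarrow> b4 \<Rightarrow> bool" (infix "\<approx>" 50) where
  "x \<approx> y \<longleftrightarrow> (\<exists>c\<in>Om_powers. x = y * c)"

lemma eqz_refl [simp]: "x \<approx> x" unfolding eqz_def by (intro bexI[of _ 1]) simp_all

lemma eqz_sym: "x \<approx> y \<Longrightarrow> y \<approx> x"
  unfolding eqz_def by (metis Om_powers_inverse eq_mult_inv_iff)

lemma eqz_trans [trans]: "x \<approx> y \<Longrightarrow> y \<approx> z \<Longrightarrow> x \<approx> z"
  unfolding eqz_def by (metis Om_powers_mult mult.assoc)

lemma eqz_trans_eq [trans]: "x \<approx> y \<Longrightarrow> y = z \<Longrightarrow> x \<approx> z" "x = y \<Longrightarrow> y \<approx> z \<Longrightarrow> x \<approx> z"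
  by simp_all

lemma eqz_mult:
  assumes "x \<approx> x'" "y \<approx> y'"
  shows "x * y \<approx> x' * y'"
proof -
  obtain c d where c: "c \<in> Om_powers" "x = x' * c" "d \<in> Om_powers" "y = y' * d"
    using assms unfolding eqz_def by blast
  then have "x * y = x' * y' * (c * d)" using Om_powers_central[of c] by (metis mult.assoc)
  then show ?thesis unfolding eqz_def using c by (intro bexI[of _ "c * d"]) simp_all
qed

lemma eqz_inverse: "x \<approx> y \<Longrightarrow> inverse x \<approx> inverse y"
  unfolding eqz_def by (metis Om_powers_central Om_powers_inverse inv_mult)

lemma eqz_one_iff: "x \<approx> 1 \<longleftrightarrow> x \<in> Om_powers"
  unfolding eqz_def by auto

lemma eqz_cancel: "x * y \<approx> x * z \<longleftrightarrow> y \<approx> z" "y * x \<approx> z * x \<longleftrightarrow> y \<approx> z"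
proof -
  show "x * y \<approx> x * z \<longleftrightarrow> y \<approx> z"
    using eqz_mult[OF eqz_refl[of "inverse x"], of "x * y" "x * z"] eqz_mult[OF eqz_refl[of x], of y z]
    by auto
  show "y * x \<approx> z * x \<longleftrightarrow> y \<approx> z"
    using eqz_mult[OF _ eqz_refl[of "inverse x"], of "y * x" "z * x"] eqz_mult[OF _ eqz_refl[of x], of y z]
    by (auto simp: mult.assoc)
qed

lemma expo_al [simp]: "expo al = 3" "expo be = 4" "expo Om = 12"
  by (simp_all add: al_def be_def Om_alt expo)

lemma Om_powers_expo: "c \<in> Om_powers \<Longrightarrow> expo c = 0 \<Longrightarrow> c = 1"
proof -
  assume "c \<in> Om_powers" "expo c = 0"
  then obtain m n where c: "c * Om ^ m = Om ^ n" unfolding Om_powers_def by blast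
  have "expo (c * Om ^ m) = expo (Om ^ n)" by (simp only: c)
  then have "m = n" using \<open>expo c = 0\<close> by (simp add: expo expo_power)
  with c have "c * Om ^ m = 1 * Om ^ m" by simp
  then show "c = 1" by (simp only: mult_right_cancel')
qed

text \<open>\<open>Om\<close> has exponent sum \<open>12\<close>, so a power of \<open>Om\<close>
  with exponent sum zero is trivial. This is the way back from congruences to equations.\<close>

lemma eqz_expo: "x \<approx> y \<Longrightarrow> expo x = expo y \<Longrightarrow> x = y"
  unfolding eqz_def by (metis Om_powers_expo add_cancel_left_right expo(1) mult_1_right)

lemma act_al: "act al = flip" and act_be: "act be = rot"
proof -
  show al: "act al = flip"
    by (rule rword_morphism_eqI[OF act_morphism flip.group_morphism_axioms], case_tac a)
      (simp_all add: al_def act mult.assoc)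
  show "act be = rot"
    by (rule rword_morphism_eqI[OF act_morphism rot.group_morphism_axioms], case_tac a)
      (simp_all add: be_def act al mult.assoc del: act_mult)
qed

lemma mat_al: "mat al = Mat 0 (- 1) 1 0" and mat_be: "mat be = Mat (- 1) (- 1) 1 0"
  by (simp_all add: al_def be_def mat)

section \<open>Words as braids modulo the centre\<close>

fun inv_gen :: "letter \<Rightarrow> b4" where
  "inv_gen U = al * al"
| "inv_gen V = be * (al * al) * inverse be"
| "inv_gen W = be * (be * (al * al) * inverse be) * inverse be"

lemma be_inv_gen: "be * inv_gen a * inverse be = inv_gen (nxt a)"
proof (cases a)
  case W
  have "be * inv_gen W * inverse be = (be * be * be) * (al * al) * inverse (be * be * be)"
    by (simp add: mult.assoc)
  also have "\<dots> = al * al" unfolding be_cube Om_central by (simp add: mult.assoc)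
  finally show ?thesis using W by simp
qed simp_all

lemma inv_gen_square: "inv_gen a * inv_gen a = Om"
proof (cases a)
  case U
  then show ?thesis by (simp add: Om_alt mult.assoc)
next
  case V
  then have "inv_gen a * inv_gen a = be * (al * al * (al * al)) * inverse be" by (simp add: mult.assoc)
  also have "\<dots> = Om" unfolding Om_alt[symmetric] Om_central[symmetric] by (simp add: mult.assoc)
  finally show ?thesis .
next
  case W
  then have "inv_gen a * inv_gen a = be * be * (al * al * (al * al)) * inverse (be * be)"
    by (simp add: mult.assoc)
  also have "\<dots> = Om" unfolding Om_alt[symmetric] Om_central[symmetric] by (simp add: mult.assoc)
  finally show ?thesis .
qed

text \<open>A section rather than a homomorphism: each \<open>inv_gen a\<close> squares to
  \<open>Om\<close> instead of \<open>1\<close>, so products are respected only up to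
  \<open>\<approx>\<close>.\<close>

definition word_elt :: "rword \<Rightarrow> b4" where
  "word_elt x = prod_list (map inv_gen (letters x))"

lemma word_elt_one [simp]: "word_elt 1 = 1" by (simp add: word_elt_def)
lemma word_elt_gen [simp]: "word_elt (gen a) = inv_gen a" by (simp add: word_elt_def)

lemma inv_gen_square_eqz: "inv_gen a * (inv_gen a * x) \<approx> x"
proof -
  have "inv_gen a * (inv_gen a * x) = x * Om"
    using inv_gen_square[of a] Om_central[of x] by (simp flip: mult.assoc)
  then show ?thesis unfolding eqz_def by auto
qed

lemma word_elt_gen_mult: "word_elt (gen a * x) \<approx> inv_gen a * word_elt x"
proof -
  have "prod_list (map inv_gen (push a l)) \<approx> inv_gen a * prod_list (map inv_gen l)" for l
    using eqz_sym[OF inv_gen_square_eqz] by (cases l) auto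
  then show ?thesis by (simp add: word_elt_def letters_gen_mult)
qed

lemma word_elt_mult: "word_elt (x * y) \<approx> word_elt x * word_elt y"
proof (induction x rule: rword_induct)
  case (gen a x)
  have "word_elt (gen a * x * y) \<approx> inv_gen a * word_elt (x * y)"
    using word_elt_gen_mult[of a "x * y"] by (simp add: mult.assoc)
  also have "\<dots> \<approx> inv_gen a * (word_elt x * word_elt y)" using gen by (simp add: eqz_cancel)
  also have "\<dots> = inv_gen a * word_elt x * word_elt y" by (simp add: mult.assoc)
  also have "\<dots> \<approx> word_elt (gen a * x) * word_elt y"
    using eqz_sym[OF word_elt_gen_mult] by (intro eqz_mult) simp_all
  finally show ?case .
qed simp

lemma word_elt_inverse: "word_elt (inverse x) \<approx> inverse (word_elt x)"
proof -
  have "word_elt (inverse x) * word_elt x \<approx> inverse (word_elt x) * word_elt x"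
    using eqz_sym[OF word_elt_mult[of "inverse x" x]] by simp
  then show ?thesis by (simp only: eqz_cancel)
qed

text \<open>The content is that \<open>al\<close> carries the second involution to the third. Both
  are conjugates of \<open>al * al\<close>, by \<open>s2\<close> and by \<open>s1 * s2\<close>, and
  these conjugators differ by \<open>s1 * s2 * inverse s1\<close>, which commutes with
  \<open>al * al\<close>. The image of \<open>W\<close> follows by conjugating twice.\<close>

lemma al_inv_gen: "al * inv_gen a * inverse al \<approx> word_elt (alpha_letter a)"
proof -
  let ?u = "al * al"
  have uu: "?u * s1 = s3 * ?u" "?u * s3 = s1 * ?u" using al_s by simp_all
  have v: "inv_gen V = s1 * ?u * inverse s1" by (simp add: be_def mult.assoc)
  have v': "al * inv_gen V * inverse al = s2 * ?u * inverse s2"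
  proof -
    have "al * inv_gen V * inverse al = (al * s1 * inverse al) * ?u * inverse (al * s1 * inverse al)"
      unfolding v by (simp add: mult.assoc)
    then show ?thesis unfolding s_al_be(2)[symmetric] .
  qed
  have w: "inv_gen W = s1 * s2 * ?u * inverse (s1 * s2)"
  proof -
    have "inv_gen W = s1 * (al * inv_gen V * inverse al) * inverse s1" by (simp add: be_def mult.assoc)
    then show ?thesis unfolding v' by (simp add: mult.assoc)
  qed
  \<comment> \<open>Conjugation by \<open>al * al\<close> exchanges \<open>s1\<close> and \<open>s3\<close>, and so fixes \<open>s1 s2 s1\<^sup>-\<^sup>1\<close>.\<close>
  have c: "?u * (s1 * s2 * inverse s1) = s1 * s2 * inverse s1 * ?u"
  proof -
    have t: "al * s3 * inverse al = inverse s3 * (s1 * s2 * inverse s1) * s3"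
    proof -
      have "s3 * (al * s3) = s1 * (s3 * s2 * s3) * s3"
        by (simp add: al_def mult.assoc s_relations_left(3))
      also have "\<dots> = s1 * s2 * (s3 * s2 * s3)" by (simp only: mult.assoc s_relations_left(2)[symmetric])
      finally have "s3 * (al * s3) * inverse al = s1 * s2 * (s3 * s2 * s3) * inverse al" by simp
      moreover have "s1 * s2 * inverse s1 * s3 * al = s1 * s2 * (s3 * s2 * s3)"
        using s_relations(3) by (simp add: al_def mult.assoc commute_inv flip: s_relations_left(3))
      ultimately have "s3 * (al * s3 * inverse al) = s1 * s2 * inverse s1 * s3"
        by (metis eq_mult_inv_iff mult.assoc)
      then show ?thesis by (simp add: eq_inv_mult_iff mult.assoc)
    qed
    have "?u * (s1 * s2 * inverse s1) = s3 * (?u * s2) * inverse s1"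
      using uu by (metis mult.assoc)
    also have "\<dots> = s3 * (al * s3 * inverse al) * (?u * inverse s1)"
      unfolding al_al_s2 by (simp add: mult.assoc)
    also have "?u * inverse s1 = inverse s3 * ?u"
      using uu(1) by (metis eq_inv_mult_iff eq_mult_inv_iff mult.assoc)
    finally show ?thesis unfolding t by (simp add: mult.assoc)
  qed
  have vw: "al * inv_gen V * inverse al = inv_gen W"
  proof -
    let ?g = "s1 * s2 * inverse s1"
    have g: "s1 * s2 = s2 * ?g"
    proof -
      have "(s1 * s2) * s1 = (s2 * ?g) * s1" using s_relations(1) by (simp add: mult.assoc)
      then show ?thesis by (simp only: mult_right_cancel')
    qed
    have "inv_gen W = (s2 * ?g) * ?u * inverse (s2 * ?g)" by (simp only: w g[symmetric])
    also have "\<dots> = s2 * (?g * ?u) * inverse (s2 * ?g)" by (simp only: mult.assoc)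
    also have "\<dots> = s2 * (?u * ?g) * inverse (s2 * ?g)" by (simp only: c)
    also have "\<dots> = s2 * ?u * inverse s2" by (simp add: mult.assoc)
    finally show ?thesis using v' by simp
  qed
  show ?thesis
  proof (cases a)
    case U
    then show ?thesis by (simp add: mult.assoc)
  next
    case V
    then show ?thesis using vw by simp
  next
    case W
    have "al * inv_gen W * inverse al = inv_gen U * inv_gen V * inverse (inv_gen U)"
      unfolding vw[symmetric] by (simp add: mult.assoc)
    also have "\<dots> \<approx> inv_gen U * inv_gen V * inv_gen U"
    proof -
      have "inv_gen U * inv_gen U \<approx> 1" using inv_gen_square_eqz[of U 1] by simp
      then have "inverse (inv_gen U) * (inv_gen U * inv_gen U) \<approx> inverse (inv_gen U) * 1"
        by (simp only: eqz_cancel)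
      then have "inv_gen U \<approx> inverse (inv_gen U)" by (simp del: inv_gen.simps)
      then show ?thesis by (rule eqz_mult[OF eqz_refl eqz_sym])
    qed
    also have "\<dots> \<approx> word_elt (gen U * gen V * gen U)"
    proof -
      have "word_elt (gen U * gen V * gen U) \<approx> word_elt (gen U * gen V) * word_elt (gen U)"
        by (rule word_elt_mult)
      also have "\<dots> \<approx> word_elt (gen U) * word_elt (gen V) * word_elt (gen U)"
        by (rule eqz_mult[OF word_elt_mult eqz_refl])
      finally show ?thesis unfolding word_elt_gen by (rule eqz_sym)
    qed
    finally show ?thesis using W by simp
  qed
qed

lemma conj_word_elt:
  assumes "\<And>a. y * inv_gen a * inverse y \<approx> word_elt (f (gen a))" "group_morphism f"
  shows "y * word_elt x * inverse y \<approx> word_elt (f x)"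
proof (induction x rule: rword_induct)
  interpret group_morphism f by fact
  case one
  show ?case by simp
next
  interpret group_morphism f by fact
  case (gen a x)
  have "y * word_elt (gen a * x) * inverse y \<approx> y * (inv_gen a * word_elt x) * inverse y"
    using word_elt_gen_mult[of a x] by (simp add: eqz_cancel)
  also have "\<dots> = (y * inv_gen a * inverse y) * (y * word_elt x * inverse y)" by (simp add: mult.assoc)
  also have "\<dots> \<approx> word_elt (f (gen a)) * word_elt (f x)" by (intro eqz_mult assms(1) gen)
  also have "\<dots> \<approx> word_elt (f (gen a * x))" using eqz_sym[OF word_elt_mult] by simp
  finally show ?case .
qed

lemma al_word_elt: "al * word_elt x \<approx> word_elt (flip x) * al"
proof -
  have "al * word_elt x * inverse al \<approx> word_elt (flip x)"
    by (rule conj_word_elt[OF _ flip.group_morphism_axioms]) (simp add: al_inv_gen)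
  from eqz_mult[OF this eqz_refl[of al]] show ?thesis by (simp add: mult.assoc)
qed

lemma be_word_elt: "be * word_elt x \<approx> word_elt (rot x) * be"
proof -
  have "be * word_elt x * inverse be \<approx> word_elt (rot x)"
    by (rule conj_word_elt[OF _ rot.group_morphism_axioms]) (simp add: be_inv_gen)
  from eqz_mult[OF this eqz_refl[of be]] show ?thesis by (simp add: mult.assoc)
qed

lemma mat_Om_powers: "c \<in> Om_powers \<Longrightarrow> mat c = 1"
proof -
  assume "c \<in> Om_powers"
  then obtain m n where c: "c * Om ^ m = Om ^ n" unfolding Om_powers_def by blast
  have "mat Om = 1" by (simp add: Om_alt mat mat_al one_mat2_def)
  then have "mat (Om ^ k) = 1" for k by (induction k) (simp_all add: mat)
  then show "mat c = 1" using arg_cong[OF c, of mat] by (simp add: mat)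
qed

lemma eqz_mat: "x \<approx> y \<Longrightarrow> mat x = mat y"
  unfolding eqz_def by (auto simp: mat mat_Om_powers)

lemma mat_inv_gen: "mat (inv_gen a) = neg 1"
proof -
  have "mat (al * al) = neg 1" by (simp add: mat mat_al one_mat2_def)
  moreover have "mat x * adj (mat x) = 1" for x using adj_mult(2)[OF mat(1)] .
  ultimately show ?thesis by (cases a) (simp_all add: mat mat_inverse)
qed

lemma mat_word_elt: "mat (word_elt x) = (if even_word x then 1 else neg 1)"
proof -
  have "mat (prod_list (map inv_gen l)) = (if even (length l) then 1 else neg 1)" for l
    by (induction l) (simp_all add: mat mat_inv_gen)
  then show ?thesis by (simp add: word_elt_def even_word_def)
qed

lemma flip_flip: "flip (flip x) = gen U * x * gen U"
proof (induction x rule: rword_induct)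
  case (gen a x)
  then show ?case by (cases a) (simp_all add: mult.assoc)
qed simp

lemma act_inv_gen: "act (inv_gen a) x = gen a * x * gen a"
proof -
  have be: "rot (act (inverse be) x) = x" for x using act_inverse(2)[of be x] by (simp add: act_be)
  have V: "rot (gen U * act (inverse be) x * gen U) = gen V * x * gen V" for x
    by (simp add: be)
  show ?thesis
    by (cases a) (simp_all add: act_al act_be flip_flip be mult.assoc)
qed

lemma act_Om_powers: "c \<in> Om_powers \<Longrightarrow> act c x = x"
proof -
  assume "c \<in> Om_powers"
  then obtain m n where c: "c * Om ^ m = Om ^ n" unfolding Om_powers_def by blast
  have "act Om x = x" for x by (simp add: Om_alt act_al flip_flip mult.assoc)
  then have pow: "act (Om ^ k) x = x" for k x by (induction k) simp_all
  have "act (c * Om ^ m) x = act (Om ^ n) x" by (simp only: c)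
  then show "act c x = x" by (simp add: pow)
qed

lemma eqz_act: "x \<approx> y \<Longrightarrow> act x = act y"
  unfolding eqz_def by (auto simp: fun_eq_iff act_Om_powers)

lemma act_word_elt: "act (word_elt n) x = n * x * inverse n"
proof -
  have "act (prod_list (map inv_gen l)) x = wd l * x * inverse (wd l)" for l
    by (induction l arbitrary: x) (simp_all add: act_inv_gen mult.assoc)
  from this[of "letters n"] show ?thesis by (simp add: word_elt_def)
qed

text \<open>With three letters available, some \<open>a\<close> differs from both ends of
  \<open>n\<close>. Then \<open>a n\<close> and \<open>n a\<close> are reduced as written but start
  with different letters.\<close>

lemma rword_centerless:
  assumes "\<And>a. n * gen a = gen a * n"
  shows "n = 1"
proof (rule ccontr)
  assume "n \<noteq> 1"
  then have ne: "letters n \<noteq> []" by simp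
  have "\<exists>a. a \<noteq> x \<and> a \<noteq> y" for x y :: letter by (cases x; cases y) auto
  then obtain a where a: "a \<noteq> hd (letters n)" "a \<noteq> last (letters n)" by blast
  have "distinct_adj (a # letters n)" "distinct_adj (letters n @ [a])"
    using a by (auto simp: distinct_adj_Cons distinct_adj_append_iff)
  moreover have "gen a * n = wd (a # letters n)" "n * gen a = wd (letters n @ [a])" by simp_all
  ultimately have "a # letters n = letters n @ [a]"
    using assms[of a] by (metis letters_wd_reduced)
  then show False using ne a by (metis hd_append list.sel(1))
qed

section \<open>Normal form, kernel and faithfulness\<close>

text \<open>Every braid is \<open>n h\<close> up to \<open>Om\<close>, with \<open>n\<close> a word in the three involutions and \<open>h\<close> a reduced
  word in \<open>al\<close>, \<open>be\<close> representing an element of the modular group.\<close>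

definition steps :: "bool list \<Rightarrow> b4" where
  "steps bs = prod_list (map (\<lambda>b. al * (if b then be else be * be)) bs)"

lemma steps_simps [simp]: "steps [] = 1" "steps (b # bs) = al * (if b then be else be * be) * steps bs"
  by (simp_all add: steps_def)

definition tail_elt :: "bool \<Rightarrow> b4" where "tail_elt j = (if j then al else 1)"

definition nf :: "b4 \<Rightarrow> bool" where
  "nf y \<longleftrightarrow> (\<exists>n i bs j. i < 3 \<and> y \<approx> word_elt n * (be ^ i * steps bs * tail_elt j))"

lemma nfI: "i < 3 \<Longrightarrow> y \<approx> word_elt n * (be ^ i * steps bs * tail_elt j) \<Longrightarrow> nf y"
  unfolding nf_def by blast

lemma nf_eqz: "x \<approx> y \<Longrightarrow> nf y \<Longrightarrow> nf x"
  unfolding nf_def using eqz_trans by blast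

lemma word_elt_mult_left: "word_elt n * (inv_gen a * x) \<approx> word_elt (n * gen a) * x"
  using eqz_mult[OF eqz_sym[OF word_elt_mult[of n "gen a"]] eqz_refl[of x]] by (simp add: mult.assoc)

lemma nf_be: "nf y \<Longrightarrow> nf (be * y)"
proof -
  assume "nf y"
  then obtain n i bs j where y: "i < 3" "y \<approx> word_elt n * (be ^ i * steps bs * tail_elt j)"
    unfolding nf_def by blast
  let ?r = "steps bs * tail_elt j"
  have "be * y \<approx> (be * word_elt n) * (be ^ i * ?r)"
    using y(2) eqz_cancel(1)[of be] by (simp add: mult.assoc)
  also have "\<dots> \<approx> word_elt (rot n) * be * (be ^ i * ?r)"
    by (rule eqz_mult[OF be_word_elt eqz_refl])
  finally have 1: "be * y \<approx> word_elt (rot n) * (be ^ Suc i * ?r)" by (simp add: mult.assoc)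
  show ?thesis
  proof (cases "i = 2")
    case True
    have "be ^ Suc i * ?r = ?r * Om"
      using be_cube Om_central[of ?r] True by (simp add: numeral_2_eq_2 flip: mult.assoc)
    then have "be ^ Suc i * ?r \<approx> be ^ 0 * ?r" unfolding eqz_def by (auto intro: bexI[of _ Om])
    then have "be * y \<approx> word_elt (rot n) * (be ^ 0 * ?r)"
      using 1 eqz_cancel(1) eqz_trans by blast
    then show ?thesis by (intro nfI[of 0 _ "rot n" bs j]) (simp_all add: mult.assoc)
  next
    case False
    then show ?thesis using 1 y(1) by (intro nfI[of "Suc i" _ "rot n" bs j]) (simp_all add: mult.assoc)
  qed
qed

lemma nf_al: "nf y \<Longrightarrow> nf (al * y)"
proof -
  assume "nf y"
  then obtain n i bs j where y: "i < 3" "y \<approx> word_elt n * (be ^ i * steps bs * tail_elt j)"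
    unfolding nf_def by blast
  let ?r = "be ^ i * steps bs * tail_elt j"
  have "al * y \<approx> (al * word_elt n) * ?r"
    using y(2) eqz_cancel(1)[of al] by (simp add: mult.assoc)
  also have "\<dots> \<approx> word_elt (flip n) * al * ?r"
    by (rule eqz_mult[OF al_word_elt eqz_refl])
  finally have al_y: "al * y \<approx> word_elt (flip n) * (al * ?r)" by (simp add: mult.assoc)
  have U: "nf (al * y)" if "al * ?r = inv_gen U * x" "nf' = be ^ k * steps cs * tail_elt j'" "x = nf'" "k < 3"
    for x nf' k cs j'
  proof -
    have "al * y \<approx> word_elt (flip n * gen U) * x"
      using al_y word_elt_mult_left eqz_trans unfolding that(1) by blast
    then show ?thesis using that by (intro nfI[of k]) auto
  qed
  consider "i = 1" | "i = 2" | "i = 0" "bs = []" "j" | "i = 0" "bs = []" "\<not> j"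
    | b cs where "i = 0" "bs = b # cs"
    using y(1) by (cases bs) fastforce+
  then show ?thesis
  proof cases
    case 1
    then show ?thesis using al_y
      by (intro nfI[of 0 _ "flip n" "True # bs" j]) (simp_all add: mult.assoc)
  next
    case 2
    then show ?thesis using al_y
      by (intro nfI[of 0 _ "flip n" "False # bs" j]) (simp_all add: mult.assoc numeral_2_eq_2)
  next
    case 3
    then show ?thesis using U[of 1 1 0 "[]" False] by (simp add: tail_elt_def mult.assoc)
  next
    case 4
    then show ?thesis using al_y
      by (intro nfI[of 0 _ "flip n" "[]" True]) (simp_all add: tail_elt_def mult.assoc)
  next
    case 5
    then show ?thesis
      using U[of "(if b then be else be * be) * steps cs * tail_elt j" _ "if b then 1 else 2" cs j]
      by (simp add: mult.assoc numeral_2_eq_2 split: if_splits)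
  qed
qed

lemma nf: "nf y"
proof (induction y rule: b4_induct)
  case one
  show ?case by (rule nfI[of 0 _ 1 "[]" False]) (simp_all add: tail_elt_def)
next
  case (mult s x)
  have ai: "inverse al \<approx> al * al * al"
  proof -
    have "al * al * al = inverse al * Om" by (simp add: Om_alt mult.assoc)
    then show ?thesis unfolding eqz_def using Om_powers_inverse[OF Om_powers_Om]
      by (intro bexI[of _ "inverse Om"]) (simp_all add: mult.assoc)
  qed
  have bi: "inverse be \<approx> be * be"
  proof -
    have "be * be = inverse be * Om" by (simp flip: be_cube add: mult.assoc)
    then show ?thesis unfolding eqz_def using Om_powers_inverse[OF Om_powers_Om]
      by (intro bexI[of _ "inverse Om"]) (simp_all add: mult.assoc)
  qed
  have ali: "nf (inverse al * x)" if "nf x" for x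
    by (rule nf_eqz[OF eqz_mult[OF ai eqz_refl]]) (simp add: mult.assoc nf_al that)
  have bei: "nf (inverse be * x)" if "nf x" for x
    by (rule nf_eqz[OF eqz_mult[OF bi eqz_refl]]) (simp add: mult.assoc nf_be that)
  note rules = nf_al nf_be ali bei
  have 1: "nf (s1 * x)" "nf (inverse s1 * x)" if "nf x" for x
    unfolding s_al_be(1) using that by (simp_all add: mult.assoc rules)
  have 2: "nf (s2 * x)" "nf (inverse s2 * x)" if "nf x" for x
    unfolding s_al_be(2) using that by (simp_all add: mult.assoc rules 1)
  have 3: "nf (s3 * x)" "nf (inverse s3 * x)" if "nf x" for x
    unfolding s_al_be(3) using that by (simp_all add: mult.assoc rules 2)
  show ?case using mult 1 2 3 by auto
qed

text \<open>Up to sign, \<open>al be\<close> and \<open>al be^2\<close> are the elementary matrices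
  with an entry \<open>1\<close> below or above the diagonal. Products of these have no negative
  entries, which shows the free product structure of the modular group.\<close>

lemma mat_steps:
  "\<exists>a b c d. a \<ge> 1 \<and> d \<ge> 1 \<and> b \<ge> 0 \<and> c \<ge> 0 \<and> (bs \<noteq> [] \<longrightarrow> b + c \<ge> 1) \<and>
    (mat (steps bs) = Mat a b c d \<or> mat (steps bs) = neg (Mat a b c d))"
proof (induction bs)
  case Nil
  show ?case by (intro exI[of _ 1] exI[of _ 0]) (simp add: one_mat2_def)
next
  case (Cons x bs)
  then obtain a b c d where abcd: "a \<ge> 1" "d \<ge> 1" "b \<ge> 0" "c \<ge> 0"
    "mat (steps bs) = Mat a b c d \<or> mat (steps bs) = neg (Mat a b c d)" by blast
  show ?case
  proof (cases x)
    case True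
    then show ?thesis using abcd
      by (intro exI[of _ a] exI[of _ b] exI[of _ "a + c"] exI[of _ "b + d"]) (auto simp: mat mat_al mat_be)
  next
    case False
    then show ?thesis using abcd
      by (intro exI[of _ "a + c"] exI[of _ "b + d"] exI[of _ c] exI[of _ d]) (auto simp: mat mat_al mat_be)
  qed
qed

lemma nf_trivial:
  assumes m: "mat (be ^ i * steps bs * tail_elt j) = 1 \<or> mat (be ^ i * steps bs * tail_elt j) = neg 1"
    and "i < 3"
  shows "i = 0 \<and> bs = [] \<and> \<not> j"
proof -
  obtain a b c d where abcd: "a \<ge> 1" "d \<ge> 1" "b \<ge> 0" "c \<ge> 0" "bs \<noteq> [] \<longrightarrow> b + c \<ge> 1"
    "mat (steps bs) = Mat a b c d \<or> mat (steps bs) = neg (Mat a b c d)" using mat_steps by blast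
  have "i = 0 \<or> i = 1 \<or> i = 2" using \<open>i < 3\<close> by auto
  then show ?thesis
  proof (elim disjE)
    assume "i = 0"
    then show ?thesis using m abcd
      by (cases j) (auto simp: mat mat_al tail_elt_def one_mat2_def)
  next
    assume "i = 1"
    then show ?thesis using m abcd
      by (cases j) (auto simp: mat mat_al mat_be tail_elt_def one_mat2_def)
  next
    assume "i = 2"
    then show ?thesis using m abcd
      by (cases j) (auto simp: mat mat_al mat_be tail_elt_def one_mat2_def numeral_2_eq_2)
  qed
qed

text \<open>The modular part of the normal form must be trivial, and the remaining word shows its
  parity in the sign of the matrix.\<close>

lemma kernel_word:
  assumes "mat y = 1 \<or> mat y = neg 1"
  shows "\<exists>n. y \<approx> word_elt n \<and> (even_word n \<longleftrightarrow> mat y = 1)"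
proof -
  obtain n i bs j where y: "i < 3" "y \<approx> word_elt n * (be ^ i * steps bs * tail_elt j)"
    using nf unfolding nf_def by blast
  have "mat (be ^ i * steps bs * tail_elt j) = 1 \<or> mat (be ^ i * steps bs * tail_elt j) = neg 1"
    using assms eqz_mat[OF y(2)] mat(2)[of "word_elt n" "be ^ i * steps bs * tail_elt j"]
    by (auto simp: mat_word_elt split: if_splits) (metis neg_mult(3))+
  then have "i = 0 \<and> bs = [] \<and> \<not> j" using nf_trivial y(1) by blast
  then have "y \<approx> word_elt n" using y(2) by (simp add: tail_elt_def)
  moreover from eqz_mat[OF this] have "even_word n \<longleftrightarrow> mat y = 1"
    by (simp add: mat_word_elt one_mat2_def)
  ultimately show ?thesis by blast
qed

text \<open>The word representing \<open>y\<close> acts by the same conjugation as \<open>m\<close>,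
  and the free product has trivial centre. Elements of the kernel can thus be identified by their
  action on three letters.\<close>

lemma kernel_word_conj:
  assumes "mat y = 1 \<or> mat y = neg 1" "\<And>a. act y (gen a) = m * gen a * inverse m"
  shows "y \<approx> word_elt m"
proof -
  obtain n where n: "y \<approx> word_elt n" using kernel_word[OF assms(1)] by blast
  then have "n * gen a * inverse n = m * gen a * inverse m" for a
    using assms(2) by (simp add: act_word_elt eqz_act)
  then have "inverse m * n * gen a = gen a * (inverse m * n)" for a
    by (metis eq_inv_mult_iff eq_mult_inv_iff mult.assoc)
  then have "inverse m * n = 1" by (rule rword_centerless)
  then have "n = m" using inv_unique by fastforce
  then show ?thesis using n by simp
qed

text \<open>A trivial action fixes the two basis vectors of the plane, so the matrix is
  \<open>1\<close>; the braid is then a word acting trivially by conjugation.\<close>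

lemma act_faithful:
  assumes "\<And>a. act y (gen a) = gen a"
  shows "y \<in> Om_powers"
proof -
  interpret group_morphism "act y" by (rule act_morphism)
  have "mat_vec (mat y) (1, 0) = (1, 0)" "mat_vec (mat y) (0, 1) = (0, 1)"
    using word_vec_act[of "gen V * gen U" y] word_vec_act[of "gen W * gen U" y] assms by simp_all
  then have "mat y = 1" by (cases "mat y") (simp add: one_mat2_def)
  then have "y \<approx> word_elt 1" using assms by (intro kernel_word_conj) simp_all
  then show ?thesis by (simp add: eqz_one_iff)
qed

lemma delta_word: "s1 * s2 * (s1 * s2) * (s1 * s2) \<approx> word_elt omega"
proof (rule kernel_word_conj)
  show "mat (s1 * s2 * (s1 * s2) * (s1 * s2)) = 1 \<or> mat (s1 * s2 * (s1 * s2) * (s1 * s2)) = neg 1"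
    by (simp add: mat one_mat2_def)
  show "act (s1 * s2 * (s1 * s2) * (s1 * s2)) (gen a) = omega * gen a * inverse omega" for a
    by (cases a) (simp_all add: act omega_def mult.assoc del: act_mult)
qed

section \<open>The stabilizer of a power of omega\<close>

inductive_set B3 :: "b4 set" where
  one: "1 \<in> B3"
| s1: "x \<in> B3 \<Longrightarrow> s1 * x \<in> B3"
| s1_inv: "x \<in> B3 \<Longrightarrow> inverse s1 * x \<in> B3"
| s2: "x \<in> B3 \<Longrightarrow> s2 * x \<in> B3"
| s2_inv: "x \<in> B3 \<Longrightarrow> inverse s2 * x \<in> B3"

lemma B3_mult: "x \<in> B3 \<Longrightarrow> y \<in> B3 \<Longrightarrow> x * y \<in> B3"
  by (induction rule: B3.induct) (auto simp: mult.assoc intro: B3.intros)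

lemma B3_gens: "s1 \<in> B3" "s2 \<in> B3" "inverse s1 \<in> B3" "inverse s2 \<in> B3"
  using B3.intros(2-5)[OF B3.one] by simp_all

lemma B3_inverse: "x \<in> B3 \<Longrightarrow> inverse x \<in> B3"
  by (induction rule: B3.induct) (auto intro: B3_mult B3_gens B3.one)

lemma B3_power: "x \<in> B3 \<Longrightarrow> x ^ n \<in> B3"
  by (induction n) (auto intro: B3_mult B3.one)

lemma mat_B3: "\<exists>h\<in>B3. mat h = mat y"
proof (induction y rule: b4_induct)
  case one
  show ?case by (rule bexI[OF _ B3.one]) simp
next
  case (mult s x)
  then obtain h where h: "h \<in> B3" "mat h = mat x" by blast
  have 3: "mat s3 = mat s1" "mat (inverse s3) = mat (inverse s1)" by (simp_all add: mat mat_inverse)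
  have "s \<in> B3 \<or> s = s3 \<or> s = inverse s3" using mult(1) B3_gens by blast
  then have "\<exists>g\<in>B3. mat g = mat s" using 3 B3_gens by metis
  then obtain g where "g \<in> B3" "mat g = mat s" by blast
  then show ?case using h by (intro bexI[of _ "g * h"]) (auto simp: mat intro: B3_mult)
qed

lemma act_B3_omega: "h \<in> B3 \<Longrightarrow> act h omega = omega"
proof (induction rule: B3.induct)
  have 1: "act s1 omega = omega" "act s2 omega = omega" by (simp_all add: omega_def act mult.assoc)
  have 2: "act (inverse s1) omega = omega" "act (inverse s2) omega = omega"
    using 1 act_inverse(1) by metis+
  show "act 1 omega = omega" by simp
  show "act (s1 * x) omega = omega" "act (s2 * x) omega = omega"
    "act (inverse s1 * x) omega = omega" "act (inverse s2 * x) omega = omega" if "act x omega = omega" for x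
    using that 1 2 by simp_all
qed

text \<open>Dividing by an element of \<open>B3\<close> with the same matrix leaves a word commuting
  with the power, hence a power of \<open>omega\<close>. Such a power is represented by a power of
  \<open>(s1 s2)^3\<close>, again in \<open>B3\<close>.\<close>

lemma stabilizer_omega_power:
  assumes "act y (omega ^ k) = omega ^ k" "k > 0"
  shows "\<exists>h\<in>B3. y \<approx> h"
proof -
  obtain h where h: "h \<in> B3" "mat h = mat y" using mat_B3 by blast
  have "mat (y * inverse h) = 1" using h(2) adj_mult(2)[OF mat(1)] by (simp add: mat mat_inverse)
  then obtain n where n: "y * inverse h \<approx> word_elt n" using kernel_word by blast
  have "act (inverse h) omega = omega" using act_B3_omega[OF B3_inverse[OF h(1)]] .
  then have "act (y * inverse h) (omega ^ k) = omega ^ k" using assms(1) by simp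
  then have "n * omega ^ k * inverse n = omega ^ k" using act_word_elt[of n "omega ^ k"] by (metis eqz_act[OF n])
  then have "n * omega ^ k = omega ^ k * n" by (metis eq_mult_inv_iff)
  then obtain j where j: "n = omega ^ j \<or> n = inverse omega ^ j"
    using centralizer_omega_power assms(2) by blast
  let ?d = "s1 * s2 * (s1 * s2) * (s1 * s2)"
  have pow: "word_elt (omega ^ j) \<approx> ?d ^ j" for j
  proof (induction j)
    case (Suc j)
    have "word_elt (omega ^ Suc j) \<approx> word_elt omega * word_elt (omega ^ j)" by (simp add: word_elt_mult)
    also have "\<dots> \<approx> ?d * ?d ^ j" by (rule eqz_mult[OF eqz_sym[OF delta_word] Suc])
    finally show ?case by simp
  qed simp
  have d: "?d ^ j \<in> B3" by (intro B3_power B3_mult B3_gens)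
  have "\<exists>g\<in>B3. word_elt n \<approx> g"
    using j
  proof
    assume "n = omega ^ j"
    then show ?thesis using pow d by blast
  next
    assume "n = inverse omega ^ j"
    then have "word_elt n \<approx> inverse (word_elt (omega ^ j))"
      using word_elt_inverse[of "omega ^ j"] by (simp add: inv_power)
    also have "\<dots> \<approx> inverse (?d ^ j)" by (rule eqz_inverse[OF pow])
    finally show ?thesis using B3_inverse[OF d] by blast
  qed
  then obtain g where g: "g \<in> B3" "word_elt n \<approx> g" by blast
  have "y * inverse h \<approx> g" using n g(2) by (rule eqz_trans)
  then have "y * inverse h * h \<approx> g * h" by (rule eqz_mult) simp
  then have "y \<approx> g * h" by (simp add: mult.assoc)
  then show ?thesis using B3_mult[OF g(1) h(1)] by blast
qed

section \<open>Words fixed by an elliptic braid\<close>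

abbreviation ell :: mat2 where "ell \<equiv> Mat 0 (- 1) 1 1"

lemma act_steps: "act (steps bs) = path bs"
proof
  show "act (steps bs) x = path bs x" for x
    by (induction bs arbitrary: x) (simp_all add: act_al act_be turn_def)
qed

lemma act_be_power: "act (be ^ i) x = (rot ^^ i) x"
  by (induction i) (simp_all add: act_be)

lemma over_rotation:
  assumes "mat a = mat be"
  obtains n where "even_word n" "a \<approx> word_elt n * be"
proof -
  have "mat (a * inverse be) = 1" using assms adj_mult(2)[OF mat(1)] by (simp add: mat mat_inverse)
  then obtain n where n: "even_word n" "a * inverse be \<approx> word_elt n" using kernel_word by blast
  have "a * inverse be * be \<approx> word_elt n * be" by (rule eqz_mult[OF n(2)]) simp
  then show thesis using n(1) that by (simp add: mult.assoc)
qed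

text \<open>The hypothesis on \<open>b\<close> says that it moves the vertex of the tree fixed by \<open>a\<close>.\<close>

lemma fixed_word_omega:
  assumes z: "\<not> even_word z" "act a z = z" "act b z = z"
    and a: "mat a = ell" and b: "mat b * ell \<noteq> ell * mat b"
  shows "\<exists>k>0. conj_words z (omega ^ k) \<or> conj_words z (inverse omega ^ k)"
proof -
  \<comment> \<open>\<open>ell\<close> has order six and its square is the matrix of
    \<open>be\<close>. The square of \<open>a\<close> is therefore \<open>be\<close> times a word,
    and a word fixed by it is conjugate to its own rotation.\<close>
  have "mat (a * a) = mat be" by (simp add: mat a mat_be)
  then obtain n where n: "a * a \<approx> word_elt n * be" using over_rotation by blast
  have "act (a * a) z = z" using z by simp
  then have "n * rot z * inverse n = z" by (simp add: eqz_act[OF n] act_word_elt act_be)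
  then have r: "conj_words (rot z) z" unfolding conj_words_def by metis
  obtain m i bs j where nf: "i < 3" "b \<approx> word_elt m * (be ^ i * steps bs * tail_elt j)"
    using nf unfolding nf_def by blast
  \<comment> \<open>Without a step and a tail, \<open>b\<close> would be a power of
    \<open>be\<close> times a word; up to sign its matrix would be a power of \<open>ell\<close> and
    commute with \<open>ell\<close>.\<close>
  have ne: "bs \<noteq> [] \<or> j"
  proof (rule ccontr)
    assume "\<not> ?thesis"
    then have "mat b = mat (word_elt m) * mat (be ^ i)"
      using eqz_mat[OF nf(2)] by (simp add: tail_elt_def mat)
    moreover have "i = 0 \<or> i = 1 \<or> i = 2" using nf(1) by auto
    ultimately have "mat b * ell = ell * mat b"
      by (auto simp: mat_word_elt mat mat_be one_mat2_def numeral_2_eq_2)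
    then show False using b by blast
  qed
  define x where "x = path bs (if j then flip z else z)"
  have "act b z = m * (rot ^^ i) x * inverse m"
    by (simp add: eqz_act[OF nf(2)] act_word_elt act_be_power act_steps tail_elt_def x_def act_al)
  then have "conj_words ((rot ^^ i) x) z" using z(3) unfolding conj_words_def by metis
  then have 1: "conj_words ((rot ^^ (3 - i)) ((rot ^^ i) x)) ((rot ^^ (3 - i)) z)"
  proof -
    have "conj_words ((rot ^^ k) x) ((rot ^^ k) y)" if "conj_words x y" for k x y
      by (induction k) (auto intro: that conj_words_morphism[OF rot.group_morphism_axioms])
    then show "conj_words ((rot ^^ i) x) z \<Longrightarrow> ?thesis" .
  qed
  have "(rot ^^ (3 - i)) ((rot ^^ i) x) = (rot ^^ 3) x"
    using nf(1) by (simp flip: funpow_add comp_apply[of "rot ^^ (3 - i)"])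
  also have "\<dots> = x" by (simp add: numeral_3_eq_3)
  finally have "conj_words x ((rot ^^ (3 - i)) z)" using 1 by simp
  then show ?thesis using rot_path_invariant[OF z(1) r _ ne] unfolding x_def by blast
qed

lemma word_elt_inject: "word_elt m \<approx> word_elt n \<Longrightarrow> m = n"
proof -
  assume "word_elt m \<approx> word_elt n"
  then have "m * gen a * inverse m = n * gen a * inverse n" for a
    using act_word_elt[of m "gen a"] act_word_elt[of n "gen a"] by (simp add: eqz_act)
  then have "inverse n * m * gen a = gen a * (inverse n * m)" for a
    by (metis eq_inv_mult_iff eq_mult_inv_iff mult.assoc)
  then have "inverse n * m = 1" by (rule rword_centerless)
  then show "m = n" using inv_unique by fastforce
qed

lemma word_elt_eqz_one: "word_elt n \<approx> 1 \<longleftrightarrow> n = 1"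
  using word_elt_inject[of n 1] by auto

lemma conj_word_elt_act: "y * word_elt n * inverse y \<approx> word_elt (act y n)"
proof (rule kernel_word_conj)
  have "mat y * adj (mat y) = 1" using adj_mult(2)[OF mat(1)] .
  then show "mat (y * word_elt n * inverse y) = 1 \<or> mat (y * word_elt n * inverse y) = neg 1"
    by (simp add: mat mat_inverse mat_word_elt)
  show "act (y * word_elt n * inverse y) (gen a) = act y n * gen a * inverse (act y n)" for a
    by (simp add: act_word_elt)
qed

lemma act_fixes_word:
  assumes "y * x = x * y" "x \<approx> word_elt n"
  shows "act y n = n"
proof -
  have "word_elt (act y n) \<approx> y * word_elt n * inverse y" by (rule eqz_sym[OF conj_word_elt_act])
  also have "\<dots> \<approx> y * x * inverse y" using eqz_sym[OF assms(2)] by (simp add: eqz_cancel)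
  also have "\<dots> = x" using assms(1) by (simp add: mult.assoc)
  also have "\<dots> \<approx> word_elt n" by (rule assms(2))
  finally show ?thesis by (rule word_elt_inject)
qed

lemma words_commute:
  assumes "y * x = x * y" "x \<approx> word_elt n" "y \<approx> word_elt m"
  shows "m * n = n * m"
  using act_fixes_word[OF assms(1,2)] by (simp add: eqz_act[OF assms(3)] act_word_elt eq_mult_inv_iff)
    (metis eq_mult_inv_iff)

lemma fixed_commuting_word:
  assumes "act y c = c" "c \<noteq> 1" "even_word x" "x * c = c * x"
  shows "act y x = x"
  using fixed_by_morphism[OF act_morphism] even_act assms by blast

lemma even_word_involution: "even_word x \<Longrightarrow> x * x = 1 \<Longrightarrow> x = 1"
  using even_word_torsion_free[of x 2] by (simp add: power2_eq_square)

section \<open>Endomorphisms up to automorphisms and transvections\<close>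

definition automorphism :: "(b4 \<Rightarrow> b4) \<Rightarrow> bool" where
  "automorphism \<chi> \<longleftrightarrow> group_morphism \<chi> \<and> bij \<chi>"

lemma automorphism_comp: "automorphism f \<Longrightarrow> automorphism g \<Longrightarrow> automorphism (f \<circ> g)"
  unfolding automorphism_def by (blast intro: group_morphism_comp bij_comp)

lemma automorphism_inv: "automorphism f \<Longrightarrow> automorphism (inv_into UNIV f)"
  unfolding automorphism_def group_morphism_def
  by (metis bij_imp_bij_inv bij_inv_eq_iff)

definition inner :: "b4 \<Rightarrow> b4 \<Rightarrow> b4" where "inner y x = y * x * inverse y"

lemma automorphism_inner: "automorphism (inner y)"
  unfolding automorphism_def
proof
  show "group_morphism (inner y)" by unfold_locales (simp add: inner_def mult.assoc)
  have "inner y \<circ> inner (inverse y) = id" "inner (inverse y) \<circ> inner y = id"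
    by (simp_all add: fun_eq_iff inner_def mult.assoc)
  then show "bij (inner y)" by (metis o_bij)
qed

lemma automorphism_id: "automorphism id"
  by (simp add: automorphism_def group_morphism_def)

definition b4_group :: "b4 monoid" where
  "b4_group = \<lparr>carrier = UNIV, monoid.mult = (*), one = 1\<rparr>"

lemma group_b4_group: "group b4_group"
  by (rule groupI) (auto simp: b4_group_def mult.assoc intro: exI[where P = "\<lambda>y. y * _ = 1", OF left_inv])

text \<open>Matrices of trace one form two classes under conjugation with determinant one,
  distinguished by the sign of the associated definite form. This outer automorphism exchanges
  them.\<close>

definition mirror :: "b4 \<Rightarrow> b4" where
  "mirror = b4_map b4_group (inverse s1) (inverse s2) (inverse s3)"

lemma mirror: "mirror (x * y) = mirror x * mirror y"
  "mirror s1 = inverse s1" "mirror s2 = inverse s2" "mirror s3 = inverse s3"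
proof -
  have "inverse (s1 * s2 * s1) = inverse (s2 * s1 * s2)" "inverse (s2 * s3 * s2) = inverse (s3 * s2 * s3)"
    "inverse (s1 * s3) = inverse (s3 * s1)"
    using s_relations by simp_all
  then show "mirror (x * y) = mirror x * mirror y"
    "mirror s1 = inverse s1" "mirror s2 = inverse s2" "mirror s3 = inverse s3"
    using b4_map[OF group_b4_group, of "inverse s1" "inverse s2" "inverse s3", folded mirror_def]
    by (simp_all add: b4_group_def)
qed

interpretation mirror: group_morphism mirror by unfold_locales (rule mirror)

lemma b4_morphism_eqI:
  assumes "group_morphism f" "group_morphism (g :: b4 \<Rightarrow> 'a::mult_group)"
    and "f s1 = g s1" "f s2 = g s2" "f s3 = g s3"
  shows "f x = g x"
proof -
  interpret f: group_morphism f by fact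
  interpret g: group_morphism g by fact
  show ?thesis by (induction x rule: b4_induct) (use assms in auto)
qed

lemma automorphism_mirror: "automorphism mirror"
proof -
  have "mirror (mirror x) = id x" for x
    using b4_morphism_eqI[OF group_morphism_comp[OF mirror.group_morphism_axioms
          mirror.group_morphism_axioms] group_morphism_id, of x]
    by (simp add: mirror(2-4))
  then have "bij mirror" by (metis id_apply involuntory_imp_bij)
  then show ?thesis unfolding automorphism_def using mirror.group_morphism_axioms by blast
qed

fun mirror_mat :: "mat2 \<Rightarrow> mat2" where "mirror_mat (Mat a b c d) = Mat a (- b) (- c) d"

lemma mat_mirror: "mat (mirror x) = mirror_mat (mat x)"
proof (induction x rule: b4_induct)
  case one
  show ?case by (simp add: one_mat2_def)
next
  case (mult s x)
  have m: "mirror_mat (x * y) = mirror_mat x * mirror_mat y" for x y by (cases x; cases y) simp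
  have "mat (mirror s) = mirror_mat (mat s)"
    using mult(1) by (auto simp: mirror mat mat_inverse)
  then show ?case using mult(2) by (simp add: mat m)
qed

text \<open>Inner automorphisms follow the reduction of the matrix, and \<open>mirror\<close> is
  applied at the end if the wrong one of the two normal forms is reached. Both kinds respect
  equality of matrices, which lets the case distinction on matrices survive the
  normalisation.\<close>

lemma normalize_elliptic:
  assumes "trc (mat w) = 1"
  shows "\<exists>\<chi>. automorphism \<chi> \<and> (\<forall>x y. mat (\<chi> x) = mat (\<chi> y) \<longleftrightarrow> mat x = mat y) \<and> mat (\<chi> w) = ell"
proof -
  define good where "good \<chi> \<longleftrightarrow> automorphism \<chi> \<and> (\<forall>x y. mat (\<chi> x) = mat (\<chi> y) \<longleftrightarrow> mat x = mat y)" for \<chi>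
  have comp: "good (f \<circ> g)" if "good f" "good g" for f g
    using that automorphism_comp unfolding good_def by auto
  have inner: "good (inner y)" for y
  proof -
    have "mat (inner y x) = mat (inner y z) \<longleftrightarrow> mat x = mat z" for x z
      by (simp add: inner_def mat mat_inverse mat2_left_cancel mat2_right_cancel)
    then show ?thesis using automorphism_inner by (simp add: good_def)
  qed
  have mirror: "good mirror"
  proof -
    have "mirror_mat x = mirror_mat y \<longleftrightarrow> x = y" for x y by (cases x; cases y) auto
    then show ?thesis using automorphism_mirror by (simp add: good_def mat_mirror)
  qed
  have "\<exists>\<chi>. good \<chi> \<and> (\<forall>w. mat w = x \<longrightarrow> mat (\<chi> w) = ell)" if "det x = 1" "trc x = 1" for x
    using that
  proof (induction x rule: elliptic_induct)
    case pos
    have "good id" unfolding good_def by (intro conjI automorphism_id) simp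
    then show ?case by (metis id_apply)
  next
    case neg
    show ?case using mirror by (intro exI[of _ mirror]) (simp add: mat_mirror)
  next
    case (conj x g)
    have "g \<in> {mat s1, mat (inverse s1), mat s2, mat (inverse s2)}"
      using conj(1) by (simp add: mat mat_inverse)
    then obtain y where y: "mat y = g" by blast
    obtain \<chi> where \<chi>: "good \<chi>" "\<And>w. mat w = g * x * adj g \<Longrightarrow> mat (\<chi> w) = ell"
      using conj(2) by blast
    have "mat ((\<chi> \<circ> inner y) w) = ell" if "mat w = x" for w
      using \<chi>(2)[of "inner y w"] that y by (simp add: inner_def mat mat_inverse)
    then show ?case using comp[OF \<chi>(1) inner] by blast
  qed
  then show ?thesis using assms mat(1) unfolding good_def by blast
qed

text \<open>The three types before transvection, by the images of the generators. Equality of the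
  first and third image means that the map factors through \<open>R_*\<close>; in the last type
  \<open>x1 * x2\<close> and \<open>x1 * x2 * x1\<close> are the images of \<open>alpha\<close> and
  \<open>beta\<close>, while \<open>al * s1\<close> and \<open>al * al\<close> are
  \<open>beta_4\<close> and the square of \<open>alpha_4\<close>.\<close>

definition standard_on :: "b4 \<Rightarrow> b4 \<Rightarrow> b4 \<Rightarrow> bool" where
  "standard_on x1 x2 x3 \<longleftrightarrow> x1 = s1 \<and> x2 = s2 \<and> x3 = s3 \<or>
    x3 = x1 \<and> x1 * x2 * x1 = x2 * x1 * x2 \<and>
      (x1 \<in> B3 \<and> x2 \<in> B3 \<or> (\<exists>g. x1 * x2 = g * (al * s1) * inverse g \<and> x1 * x2 * x1 = al * al))"

text \<open>The generators are conjugate to each other, so a homomorphism to the centre takes one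
  and the same value \<open>d\<close> on all of them.\<close>

definition standard :: "(b4 \<Rightarrow> b4) \<Rightarrow> bool" where
  "standard \<phi> \<longleftrightarrow> (\<exists>\<psi> d x1 x2 x3. automorphism \<psi> \<and> d \<in> Om_powers \<and> standard_on x1 x2 x3 \<and>
    \<phi> s1 = \<psi> (x1 * d) \<and> \<phi> s2 = \<psi> (x2 * d) \<and> \<phi> s3 = \<psi> (x3 * d))"

lemma standard_automorphism:
  assumes "automorphism \<chi>" "standard (\<chi> \<circ> \<phi>)"
  shows "standard \<phi>"
proof -
  obtain \<psi> d x1 x2 x3 where *: "automorphism \<psi>" "d \<in> Om_powers" "standard_on x1 x2 x3"
    "\<chi> (\<phi> s1) = \<psi> (x1 * d)" "\<chi> (\<phi> s2) = \<psi> (x2 * d)" "\<chi> (\<phi> s3) = \<psi> (x3 * d)"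
    using assms(2) unfolding standard_def by auto
  have inv: "inv_into UNIV \<chi> (\<chi> x) = x" for x
    using assms(1) by (simp add: automorphism_def bij_is_inj)
  have "automorphism (inv_into UNIV \<chi> \<circ> \<psi>)"
    using automorphism_comp[OF automorphism_inv[OF assms(1)] *(1)] .
  moreover have "\<phi> s1 = (inv_into UNIV \<chi> \<circ> \<psi>) (x1 * d)" "\<phi> s2 = (inv_into UNIV \<chi> \<circ> \<psi>) (x2 * d)"
    "\<phi> s3 = (inv_into UNIV \<chi> \<circ> \<psi>) (x3 * d)"
    using *(4-6) inv by (metis comp_apply)+
  ultimately show ?thesis unfolding standard_def using *(2,3) by blast
qed

locale b4_endo = group_morphism \<phi> for \<phi> :: "b4 \<Rightarrow> b4"
begin

lemma braid: "\<phi> s1 * \<phi> s2 * \<phi> s1 = \<phi> s2 * \<phi> s1 * \<phi> s2" "\<phi> s2 * \<phi> s3 * \<phi> s2 = \<phi> s3 * \<phi> s2 * \<phi> s3"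
  "\<phi> s1 * \<phi> s3 = \<phi> s3 * \<phi> s1"
  using s_relations by (simp_all flip: mult)

lemma expo_eq: "expo (\<phi> s2) = expo (\<phi> s1)" "expo (\<phi> s3) = expo (\<phi> s1)"
  using arg_cong[OF braid(1), of expo] arg_cong[OF braid(2), of expo] by (simp_all add: expo)

lemma comp_automorphism: "automorphism \<chi> \<Longrightarrow> b4_endo (\<chi> \<circ> \<phi>)"
  unfolding b4_endo_def automorphism_def using group_morphism_comp group_morphism_axioms by blast

text \<open>A nontrivial word representing \<open>\<phi> Om\<close> makes \<open>\<phi> (s1\<^sup>-\<^sup>1 s3)\<close> central in the image of \<open>\<phi>\<close>.\<close>

lemma image_Om_trivial:
  assumes m: "mat (\<phi> s3) = mat (\<phi> s1)" and c: "\<phi> Om \<approx> word_elt c" "even_word c" and ne: "\<phi> s1 \<noteq> \<phi> s3"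
  shows "c = 1"
proof (rule ccontr)
  assume "c \<noteq> 1"
  let ?x = "inverse (\<phi> s1) * \<phi> s3"
  have "mat ?x = 1" using m adj_mult(1)[OF mat(1)] by (simp add: mat mat_inverse)
  then obtain x where x: "?x \<approx> word_elt x" "even_word x" using kernel_word by blast
  have Om: "\<phi> y * \<phi> Om = \<phi> Om * \<phi> y" for y using Om_central[of y] by (simp flip: mult)
  have fc: "act (\<phi> y) c = c" for y using act_fixes_word[OF Om c(1)] .
  have "?x = \<phi> (inverse s1 * s3)" by simp
  then have "x * c = c * x" using words_commute[OF _ c(1) x(1)] Om by metis
  then have "act (\<phi> y) x = x" for y using fixed_commuting_word[OF fc \<open>c \<noteq> 1\<close> x(2)] by blast
  then have "\<phi> y * word_elt x * inverse (\<phi> y) \<approx> word_elt x" for y using conj_word_elt_act[of "\<phi> y" x] by simp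
  then have "\<phi> y * ?x * inverse (\<phi> y) \<approx> ?x" for y
    using x(1) by (meson eqz_cancel eqz_sym eqz_trans)
  then have "\<phi> y * ?x * inverse (\<phi> y) = ?x" for y by (rule eqz_expo) (simp add: expo)
  then have central: "?x * \<phi> y = \<phi> y * ?x" for y by (metis eq_mult_inv_iff)
  have s3: "\<phi> s3 = \<phi> s1 * ?x" by simp
  \<comment> \<open>With \<open>?x\<close> central, the second braid relation has one more factor
    \<open>?x\<close> on one side than on the other; the first relation cancels the rest.\<close>
  have "\<phi> s1 * ?x * \<phi> s2 * (\<phi> s1 * ?x) = \<phi> s2 * (\<phi> s1 * ?x) * \<phi> s2"
    using braid(2) s3 by metis
  moreover have "\<phi> s1 * ?x * \<phi> s2 * (\<phi> s1 * ?x) = \<phi> s1 * \<phi> s2 * \<phi> s1 * (?x * ?x)"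
    using central by (metis mult.assoc)
  moreover have "\<phi> s2 * (\<phi> s1 * ?x) * \<phi> s2 = \<phi> s2 * \<phi> s1 * \<phi> s2 * ?x"
    using central by (metis mult.assoc)
  ultimately have "\<phi> s2 * \<phi> s1 * \<phi> s2 * (?x * ?x) = \<phi> s2 * \<phi> s1 * \<phi> s2 * ?x" using braid(1) by metis
  then have "?x * ?x = ?x * 1" by (simp only: mult_left_cancel' mult_1_right)
  then have "?x = 1" by (simp only: mult_left_cancel')
  then show False using ne s3 by simp
qed

lemma delta_square: "\<phi> s1 * \<phi> s2 * \<phi> s1 * (\<phi> s1 * \<phi> s2 * \<phi> s1) = \<phi> s1 * \<phi> s2 * (\<phi> s1 * \<phi> s2) * (\<phi> s1 * \<phi> s2)"
  using braid(1) by (metis mult.assoc)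

lemma delta_central: "\<phi> s1 * (\<phi> s1 * \<phi> s2 * (\<phi> s1 * \<phi> s2) * (\<phi> s1 * \<phi> s2)) =
    \<phi> s1 * \<phi> s2 * (\<phi> s1 * \<phi> s2) * (\<phi> s1 * \<phi> s2) * \<phi> s1"
  "\<phi> s2 * (\<phi> s1 * \<phi> s2 * (\<phi> s1 * \<phi> s2) * (\<phi> s1 * \<phi> s2)) =
    \<phi> s1 * \<phi> s2 * (\<phi> s1 * \<phi> s2) * (\<phi> s1 * \<phi> s2) * \<phi> s2"
proof -
  define d where "d = \<phi> s1 * \<phi> s2 * \<phi> s1"
  have 1: "d * \<phi> s1 = \<phi> s2 * d" "d * \<phi> s2 = \<phi> s1 * d"
    unfolding d_def using braid(1) by (metis mult.assoc)+
  have "\<phi> s1 * (d * d) = d * d * \<phi> s1" "\<phi> s2 * (d * d) = d * d * \<phi> s2"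
    using 1 by (metis mult.assoc)+
  then show "\<phi> s1 * (\<phi> s1 * \<phi> s2 * (\<phi> s1 * \<phi> s2) * (\<phi> s1 * \<phi> s2)) =
    \<phi> s1 * \<phi> s2 * (\<phi> s1 * \<phi> s2) * (\<phi> s1 * \<phi> s2) * \<phi> s1"
    "\<phi> s2 * (\<phi> s1 * \<phi> s2 * (\<phi> s1 * \<phi> s2) * (\<phi> s1 * \<phi> s2)) =
    \<phi> s1 * \<phi> s2 * (\<phi> s1 * \<phi> s2) * (\<phi> s1 * \<phi> s2) * \<phi> s2"
    unfolding d_def delta_square by blast+
qed

abbreviation delta2 :: b4 where "delta2 \<equiv> \<phi> s1 * \<phi> s2 * (\<phi> s1 * \<phi> s2) * (\<phi> s1 * \<phi> s2)"

section \<open>The parallel case: equal matrices of the first two generators\<close>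

context
  assumes parallel: "mat (\<phi> s2) = mat (\<phi> s1)" and ne12: "\<phi> s1 \<noteq> \<phi> s2"
begin

text \<open>Put \<open>s = \<phi> s1\<close> and \<open>\<phi> s2 = s g\<close>. Multiplied by
  \<open>s^-3\<close> from the left, the braid relation reads
  \<open>s^-1 g s = (s^-2 g s^2) g\<close>. Since \<open>g\<close> has exponent sum zero, it is
  nontrivial even modulo \<open>Om\<close>.\<close>

lemma ex_difference_word:
  "\<exists>x. inverse (\<phi> s1) * \<phi> s2 \<approx> word_elt x \<and> even_word x \<and> x \<noteq> 1 \<and>
    act (inverse (\<phi> s1)) (act (inverse (\<phi> s1)) x) * x = act (inverse (\<phi> s1)) x"
proof -
  let ?s = "\<phi> s1" and ?g = "inverse (\<phi> s1) * \<phi> s2"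
  have "mat ?g = 1" using parallel adj_mult(1)[OF mat(1)] by (simp add: mat mat_inverse)
  then obtain x where x: "?g \<approx> word_elt x" "even_word x" using kernel_word by blast
  have "x \<noteq> 1"
  proof
    assume "x = 1"
    then have "?g \<approx> 1" using x(1) by simp
    then have "?g = 1" by (rule eqz_expo) (simp add: expo expo_eq)
    then show False using ne12 by (metis inv_inv inv_unique)
  qed
  have c: "inverse y * word_elt n * y \<approx> word_elt (act (inverse y) n)" for y n
    using conj_word_elt_act[of "inverse y" n] by simp
  have g: "inverse y * ?g * y \<approx> word_elt (act (inverse y) x)" for y
    using c[of y x] x(1) by (meson eqz_cancel eqz_trans)
  have "word_elt (act (inverse ?s) (act (inverse ?s) x) * x)
      \<approx> word_elt (act (inverse ?s) (act (inverse ?s) x)) * word_elt x" by (rule word_elt_mult)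
  also have "\<dots> \<approx> inverse ?s * (inverse ?s * ?g * ?s) * ?s * ?g"
  proof (rule eqz_mult[OF _ eqz_sym[OF x(1)]])
    have "inverse ?s * (inverse ?s * ?g * ?s) * ?s \<approx> inverse ?s * word_elt (act (inverse ?s) x) * ?s"
      using g by (simp only: eqz_cancel)
    also have "\<dots> \<approx> word_elt (act (inverse ?s) (act (inverse ?s) x))" by (rule c)
    finally show "word_elt (act (inverse ?s) (act (inverse ?s) x)) \<approx> inverse ?s * (inverse ?s * ?g * ?s) * ?s"
      by (rule eqz_sym)
  qed
  also have "\<dots> = inverse ?s * inverse ?s * inverse ?s * (\<phi> s2 * ?s * \<phi> s2)" by (simp add: mult.assoc)
  also have "\<dots> = inverse ?s * ?g * ?s" unfolding braid(1)[symmetric] by (simp add: mult.assoc)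
  also have "\<dots> \<approx> word_elt (act (inverse ?s) x)" by (rule g)
  finally have "act (inverse ?s) (act (inverse ?s) x) * x = act (inverse ?s) x" by (rule word_elt_inject)
  then show ?thesis using x \<open>x \<noteq> 1\<close> by blast
qed

text \<open>The word \<open>z\<close> of this element is fixed by \<open>\<phi> s1\<close> and
  commutes with the difference word \<open>x\<close>. If \<open>z\<close> were nontrivial, then
  \<open>x\<close> would be fixed as well, and the relation for \<open>x\<close> would shrink to
  \<open>x x = x\<close>.\<close>

lemma delta2_in_Om_powers:
  assumes "mat delta2 = 1"
  shows "delta2 \<in> Om_powers"
proof -
  obtain z where z: "delta2 \<approx> word_elt z" using kernel_word assms by blast
  obtain x where x: "inverse (\<phi> s1) * \<phi> s2 \<approx> word_elt x" "even_word x" "x \<noteq> 1"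
    "act (inverse (\<phi> s1)) (act (inverse (\<phi> s1)) x) * x = act (inverse (\<phi> s1)) x"
    using ex_difference_word by blast
  have "z = 1"
  proof (rule ccontr)
    assume "z \<noteq> 1"
    have 1: "act (\<phi> s1) z = z" using act_fixes_word[OF delta_central(1) z] .
    then have 2: "act (inverse (\<phi> s1)) z = z" by (metis act_inverse(1))
    have "inverse (\<phi> s1) * \<phi> s2 * delta2 = delta2 * (inverse (\<phi> s1) * \<phi> s2)"
      using delta_central commute_inv[OF delta_central(1)] by (metis mult.assoc)
    then have "x * z = z * x" using words_commute z x(1) by blast
    then have "act (inverse (\<phi> s1)) x = x" using fixed_commuting_word[OF 2 \<open>z \<noteq> 1\<close> x(2)] by blast
    then have "x * x = x * 1" using x(4) by simp
    then have "x = 1" by (simp only: mult_left_cancel')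
    then show False using x(3) by blast
  qed
  then show ?thesis using z by (simp add: eqz_one_iff)
qed

text \<open>If the trace is \<open>-1\<close>, the image of \<open>s1 s2 s1\<close> is an even word
  whose square is trivial modulo \<open>Om\<close>. It is then central by torsion freeness, so the
  images of \<open>s1\<close> and \<open>s2\<close> commute and coincide by the braid
  relation.\<close>

lemma parallel_trace: "trc (mat (\<phi> s1)) = 1"
proof -
  obtain x where x: "inverse (\<phi> s1) * \<phi> s2 \<approx> word_elt x" "even_word x" "x \<noteq> 1"
    "act (inverse (\<phi> s1)) (act (inverse (\<phi> s1)) x) * x = act (inverse (\<phi> s1)) x"
    using ex_difference_word by blast
  obtain a b c d where abcd: "mat (inverse (\<phi> s1)) = Mat a b c d" by (cases "mat (inverse (\<phi> s1))")
  have tr: "trc (mat (\<phi> s1)) = a + d"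
    using abcd mat_inverse[of "\<phi> s1"] by (cases "mat (\<phi> s1)") auto
  interpret E: even_automorphism "act (inverse (\<phi> s1))" a b c d
  proof (rule even_automorphism.intro[OF act_morphism], unfold_locales)
    show "a * d - b * c = 1" using mat(1)[of "inverse (\<phi> s1)"] abcd by simp
    show "word_vec (act (inverse (\<phi> s1)) y) = (a * fst (word_vec y) + b * snd (word_vec y),
        c * fst (word_vec y) + d * snd (word_vec y))" if "even_word y" for y
      using word_vec_act[OF that, of "inverse (\<phi> s1)"] abcd by (cases "word_vec y") simp
  qed simp
  have "a + d = 1 \<or> a + d = - 1" by (rule E.order_six_trace[OF x(2,4,3)])
  moreover have "a + d \<noteq> - 1"
  proof
    assume "a + d = - 1"
    then have cube: "mat (\<phi> s1) * mat (\<phi> s1) * mat (\<phi> s1) = 1"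
      using trc_neg_one_cube[OF mat(1)] tr by simp
    let ?b = "\<phi> s1 * \<phi> s2 * \<phi> s1"
    have mb: "mat ?b = 1" using cube parallel by (simp add: mat)
    have "mat delta2 = 1" unfolding delta_square[symmetric] using mb by (simp add: mat)
    then have d: "delta2 \<in> Om_powers" by (rule delta2_in_Om_powers)
    obtain m where m: "?b \<approx> word_elt m" "even_word m" using kernel_word mb by blast
    have "word_elt (m * m) \<approx> word_elt m * word_elt m" by (rule word_elt_mult)
    also have "\<dots> \<approx> ?b * ?b" by (intro eqz_mult eqz_sym[OF m(1)])
    also have "\<dots> \<approx> 1" unfolding delta_square using d by (simp add: eqz_one_iff)
    finally have "m * m = 1" by (simp add: word_elt_eqz_one)
    then have "m = 1" using even_word_involution m(2) by blast
    then have "?b \<in> Om_powers" using m(1) by (simp add: eqz_one_iff)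
    then have "?b * \<phi> s1 = \<phi> s1 * ?b" by (rule Om_powers_central)
    then have "\<phi> s1 * (\<phi> s2 * \<phi> s1 * \<phi> s1) = \<phi> s1 * (\<phi> s1 * \<phi> s2 * \<phi> s1)" by (simp add: mult.assoc)
    then have "\<phi> s2 * \<phi> s1 * \<phi> s1 = \<phi> s1 * \<phi> s2 * \<phi> s1" by (simp only: mult_left_cancel')
    then have comm: "\<phi> s2 * \<phi> s1 = \<phi> s1 * \<phi> s2" by (simp only: mult_right_cancel')
    then have "\<phi> s1 * \<phi> s2 * \<phi> s1 = \<phi> s1 * \<phi> s2 * \<phi> s2" using braid(1) by simp
    then show False using ne12 by (simp only: mult_left_cancel')
  qed
  ultimately show ?thesis using tr by simp
qed

end

end

lemma central_mult:
  fixes c :: "'a::mult_group"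
  assumes "\<And>y. c * y = y * c"
  shows "x * c * (y * d) = x * y * (c * d)"
proof -
  have "x * c * (y * d) = x * (c * y) * d" by (simp add: mult.assoc)
  also have "\<dots> = x * (y * c) * d" by (simp only: assms[of y])
  finally show ?thesis by (simp add: mult.assoc)
qed

lemma central_cube:
  fixes c :: "'a::mult_group"
  assumes "\<And>y. c * y = y * c"
  shows "x * c * (y * c) * (z * c) = x * y * z * (c * c * c)"
proof -
  have "c * c * y = y * (c * c)" for y using assms by (metis mult.assoc)
  from central_mult[OF this, of "x * y" z c] show ?thesis
    unfolding central_mult[OF assms, of x y c] .
qed

context b4_endo
begin

lemma equal_generators:
  assumes "\<phi> s1 = \<phi> s2"
  shows "\<phi> s3 = \<phi> s2"
proof -
  have "\<phi> s3 = \<phi> al * \<phi> s2 * inverse (\<phi> al)" by (subst s_al_be(3)) simp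
  also have "\<dots> = \<phi> al * \<phi> s1 * inverse (\<phi> al)" using assms by simp
  also have "\<dots> = \<phi> s2" by (subst s_al_be(2)) simp
  finally show ?thesis .
qed

text \<open>Writing \<open>a\<close> as a word \<open>n\<close> times \<open>be\<close>, the cube
  becomes the product of \<open>n\<close> with its two rotations. Thus \<open>n\<close> is a
  cocycle, hence a coboundary, and \<open>a\<close> is conjugate to \<open>be\<close> modulo
  \<open>Om\<close>.\<close>

lemma order_three_conj:
  assumes m: "mat a = mat be" and c: "a * a * a \<in> Om_powers"
  shows "\<exists>m. a \<approx> word_elt m * be * inverse (word_elt m)"
proof -
  obtain n where n: "a \<approx> word_elt n * be" using over_rotation m by metis
  have bn: "be * word_elt n \<approx> word_elt (rot n) * be" for n by (rule be_word_elt)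
  have "a * a * a \<approx> word_elt n * be * (word_elt n * be) * (word_elt n * be)"
    by (intro eqz_mult n)
  also have "\<dots> = word_elt n * (be * word_elt n) * (be * word_elt n) * be" by (simp add: mult.assoc)
  also have "\<dots> \<approx> word_elt n * (word_elt (rot n) * be) * (word_elt (rot n) * be) * be"
    by (intro eqz_mult eqz_refl bn)
  also have "\<dots> = word_elt n * word_elt (rot n) * (be * word_elt (rot n)) * (be * be)" by (simp add: mult.assoc)
  also have "\<dots> \<approx> word_elt n * word_elt (rot n) * (word_elt (rot (rot n)) * be) * (be * be)"
    by (intro eqz_mult eqz_refl bn)
  also have "\<dots> = word_elt n * word_elt (rot n) * word_elt (rot (rot n)) * Om"
    by (simp add: mult.assoc flip: be_cube)
  also have "\<dots> \<approx> word_elt n * word_elt (rot n) * word_elt (rot (rot n))"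
    unfolding eqz_def by (intro bexI[of _ Om]) simp_all
  also have "\<dots> \<approx> word_elt (n * rot n) * word_elt (rot (rot n))"
    by (intro eqz_mult eqz_sym[OF word_elt_mult] eqz_refl)
  also have "\<dots> \<approx> word_elt (n * rot n * rot (rot n))" by (rule eqz_sym[OF word_elt_mult])
  finally have "a * a * a \<approx> word_elt (n * rot n * rot (rot n))" .
  moreover have "a * a * a \<approx> 1" using c by (simp add: eqz_one_iff)
  ultimately have "word_elt (n * rot n * rot (rot n)) \<approx> 1" using eqz_sym eqz_trans by blast
  then have "n * rot n * rot (rot n) = 1" by (simp only: word_elt_eqz_one)
  then obtain m where m: "n = m * inverse (rot m)" using order_three_word by blast
  have "a \<approx> word_elt (m * inverse (rot m)) * be" using n m by simp
  also have "\<dots> \<approx> word_elt m * word_elt (rot (inverse m)) * be"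
    using eqz_mult[OF word_elt_mult[of m "rot (inverse m)"] eqz_refl[of be]] by simp
  also have "\<dots> = word_elt m * (word_elt (rot (inverse m)) * be)" by (simp add: mult.assoc)
  also have "\<dots> \<approx> word_elt m * (be * word_elt (inverse m))"
    by (intro eqz_mult eqz_refl eqz_sym[OF bn])
  also have "\<dots> \<approx> word_elt m * (be * inverse (word_elt m))"
    by (intro eqz_mult eqz_refl word_elt_inverse)
  finally have "a \<approx> word_elt m * be * inverse (word_elt m)" by (simp add: mult.assoc)
  then show ?thesis by blast
qed

lemma odd_square_trivial:
  assumes "b \<approx> word_elt q" "b * b \<in> Om_powers"
  shows "q * q = 1"
proof -
  have "word_elt (q * q) \<approx> word_elt q * word_elt q" by (rule word_elt_mult)
  also have "\<dots> \<approx> b * b" by (intro eqz_mult eqz_sym[OF assms(1)])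
  also have "\<dots> \<approx> 1" using assms(2) by (simp add: eqz_one_iff)
  finally show ?thesis by (simp only: word_elt_eqz_one)
qed

lemma inv_gen_conj: "\<exists>k. inv_gen c = be ^ k * (al * al) * inverse (be ^ k)"
proof (cases c)
  case U
  then show ?thesis by (intro exI[of _ 0]) simp
next
  case V
  then show ?thesis by (intro exI[of _ 1]) simp
next
  case W
  then show ?thesis by (intro exI[of _ 2]) (simp add: mult.assoc numeral_2_eq_2)
qed

text \<open>An odd involution is conjugate to a letter, and the three letters represent conjugates
  of \<open>al * al\<close> by powers of \<open>be\<close>.\<close>

lemma involution_conj:
  assumes "b \<approx> word_elt q" "\<not> even_word q" "b * b \<in> Om_powers"
  shows "\<exists>g. b \<approx> g * (al * al) * inverse g"
proof -
  obtain m c where q: "letters q = m @ [c] @ rev m"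
    using odd_involution odd_square_trivial assms by blast
  have "q = wd (m @ [c] @ rev m)" using q by (metis wd_letters)
  then have q': "q = wd m * gen c * inverse (wd m)" by (simp add: wd_rev mult.assoc)
  obtain k where k: "inv_gen c = be ^ k * (al * al) * inverse (be ^ k)" using inv_gen_conj by blast
  have "b \<approx> word_elt (wd m * gen c * inverse (wd m))" using assms(1) q' by simp
  also have "\<dots> \<approx> word_elt (wd m * gen c) * word_elt (inverse (wd m))" by (rule word_elt_mult)
  also have "\<dots> \<approx> word_elt (wd m) * word_elt (gen c) * inverse (word_elt (wd m))"
    by (intro eqz_mult word_elt_mult word_elt_inverse)
  also have "\<dots> = (word_elt (wd m) * be ^ k) * (al * al) * inverse (word_elt (wd m) * be ^ k)"
    unfolding word_elt_gen k by (simp only: mult.assoc inv_mult)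
  finally show ?thesis by blast
qed

lemma parallel_standard:
  assumes ell: "mat (\<phi> s1) = ell" "mat (\<phi> s2) = ell" "mat (\<phi> s3) = ell" and ne: "\<phi> s1 \<noteq> \<phi> s2"
  shows "standard \<phi>"
proof -
  let ?a = "\<phi> s1 * \<phi> s2" and ?b = "\<phi> s1 * \<phi> s2 * \<phi> s1"
  have par: "mat (\<phi> s2) = mat (\<phi> s1)" using ell by simp
  have "mat delta2 = 1" by (simp add: mat ell one_mat2_def)
  then have d: "delta2 \<in> Om_powers" by (rule delta2_in_Om_powers[OF par ne])
  have "mat ?a = mat be" by (simp add: mat ell mat_be)
  then obtain m where a: "?a \<approx> word_elt m * be * inverse (word_elt m)"
    using order_three_conj d by blast
  have bb: "?b * ?b \<in> Om_powers" unfolding delta_square using d .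
  have mb: "mat ?b = neg 1" by (simp add: mat ell one_mat2_def)
  then obtain q where q: "?b \<approx> word_elt q" "\<not> even_word q"
    using kernel_word[of ?b] by (auto simp: one_mat2_def)
  obtain g where b: "?b \<approx> g * (al * al) * inverse g" using involution_conj[OF q bb] by blast
  \<comment> \<open>Otherwise \<open>\<phi> Om\<close> is a power of \<open>Om\<close>, so the word
    \<open>r\<close> of \<open>\<phi> al\<close> satisfies \<open>r^4 = 1\<close>; the even word
    \<open>r^2\<close> is then trivial. But \<open>al^2\<close> conjugates \<open>s1\<close> to
    \<open>s3\<close>, so its image cannot be central.\<close>
  have s13: "\<phi> s3 = \<phi> s1"
  proof (rule ccontr)
    assume "\<phi> s3 \<noteq> \<phi> s1"
    then have ne13: "\<phi> s1 \<noteq> \<phi> s3" by simp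
    have mal: "mat (\<phi> al) = neg 1" by (simp add: al_def mat ell one_mat2_def)
    then have "mat (\<phi> Om) = 1" by (simp add: Om_alt mat)
    then obtain c where c: "\<phi> Om \<approx> word_elt c" "even_word c" using kernel_word by blast
    have "mat (\<phi> s3) = mat (\<phi> s1)" using ell by simp
    then have "c = 1" using image_Om_trivial c ne13 by blast
    then have Om: "\<phi> al * \<phi> al * (\<phi> al * \<phi> al) \<in> Om_powers"
      using c(1) by (simp add: eqz_one_iff Om_alt)
    obtain r where r: "\<phi> al \<approx> word_elt r" using kernel_word mal by blast
    have rr: "\<phi> al * \<phi> al \<approx> word_elt (r * r)"
      using eqz_mult[OF r r] eqz_sym[OF word_elt_mult] eqz_trans by blast
    then have "r * r * (r * r) = 1" using odd_square_trivial Om by blast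
    then have "r * r = 1" using even_word_involution[of "r * r"] by simp
    then have "\<phi> al * \<phi> al \<in> Om_powers" using rr by (simp add: eqz_one_iff)
    then have "\<phi> al * \<phi> al * \<phi> s1 = \<phi> s1 * (\<phi> al * \<phi> al)" by (rule Om_powers_central)
    moreover have "\<phi> al * \<phi> al * \<phi> s1 = \<phi> s3 * (\<phi> al * \<phi> al)"
      using al_s(3) by (simp flip: mult)
    ultimately show False using ne13 by simp
  qed
  obtain c1 where c1: "c1 \<in> Om_powers" "?a = word_elt m * be * inverse (word_elt m) * c1"
    using a unfolding eqz_def by blast
  obtain c2 where c2: "c2 \<in> Om_powers" "?b = g * (al * al) * inverse g * c2"
    using b unfolding eqz_def by blast
  note z1 = Om_powers_central[OF c1(1)] and z2 = Om_powers_central[OF c2(1)]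
  have "?a * ?a * ?a = Om * (c1 * c1 * c1)"
  proof -
    let ?y = "word_elt m * be * inverse (word_elt m)"
    have "?a * ?a * ?a = ?y * c1 * (?y * c1) * (?y * c1)" by (simp only: c1(2))
    also have "\<dots> = ?y * ?y * ?y * (c1 * c1 * c1)" by (rule central_cube[OF z1])
    also have "?y * ?y * ?y = word_elt m * be * be * be * inverse (word_elt m)"
      by (simp add: mult.assoc)
    finally have "?a * ?a * ?a = word_elt m * be * be * be * inverse (word_elt m) * (c1 * c1 * c1)" .
    also have "word_elt m * be * be * be * inverse (word_elt m) = word_elt m * Om * inverse (word_elt m)"
      by (simp add: mult.assoc flip: be_cube)
    also have "\<dots> = Om" by (simp add: mult.assoc flip: Om_central)
    finally show ?thesis .
  qed
  moreover have "?b * ?b = Om * (c2 * c2)"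
  proof -
    have "?b * ?b = g * (al * al) * inverse g * (g * (al * al) * inverse g) * (c2 * c2)"
      unfolding c2(2) by (rule central_mult[OF z2])
    also have "g * (al * al) * inverse g * (g * (al * al) * inverse g) = g * (al * al * (al * al)) * inverse g"
      by (simp add: mult.assoc)
    also have "g * (al * al * (al * al)) * inverse g = Om"
      unfolding Om_alt[symmetric] by (simp add: mult.assoc flip: Om_central)
    finally show ?thesis .
  qed
  ultimately have cc: "c1 * c1 * c1 = c2 * c2" using delta_square by (metis mult_left_cancel')
  \<comment> \<open>As \<open>c1^3 = c2^2\<close>, the corrections are \<open>c1 = d^2\<close> and
    \<open>c2 = d^3\<close> for this quotient. Dividing both generators by \<open>d\<close> removes
    them together.\<close>
  define d where "d = c2 * inverse c1"
  have dO: "d \<in> Om_powers" using c1 c2 by (simp add: d_def)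
  note zd = Om_powers_central[OF dO]
  have dd: "d * d = c1"
  proof -
    have "inverse c1 * y = y * inverse c1" for y
      by (rule Om_powers_central) (simp add: c1(1))
    then have "d * d = c2 * c2 * (inverse c1 * inverse c1)"
      unfolding d_def by (rule central_mult)
    then show ?thesis unfolding cc[symmetric] by (simp add: mult.assoc)
  qed
  have ddd: "d * d * d = c2"
  proof -
    have "d * d * d = c1 * c2 * inverse c1" unfolding dd by (simp add: d_def mult.assoc)
    then show ?thesis unfolding z1 by (simp add: mult.assoc)
  qed
  let ?x = "\<lambda>i. inverse g * i * g * inverse d"
  let ?x1 = "?x (\<phi> s1)" and ?x2 = "?x (\<phi> s2)"
  have zi: "inverse d * y = y * inverse d" for y
    by (rule Om_powers_central) (simp add: dO)
  have prod: "?x y * ?x z = inverse g * (y * z) * g * inverse (d * d)" for y z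
    using central_mult[OF zi, of "inverse g * y * g" "inverse g * z * g" "inverse d"]
    by (simp add: mult.assoc)
  have x12: "?x1 * ?x2 = inverse g * ?a * g * inverse (d * d)" by (rule prod)
  have prod3: "inverse g * y * g * inverse (d * d) * ?x z = inverse g * (y * z) * g * inverse (d * d * d)" for y z
  proof -
    have "inverse (d * d) * w = w * inverse (d * d)" for w
      by (rule Om_powers_central) (simp add: dO)
    from central_mult[OF this, of "inverse g * y * g" "inverse g * z * g" "inverse d"]
    have "inverse g * y * g * inverse (d * d) * ?x z =
      inverse g * y * g * (inverse g * z * g) * (inverse (d * d) * inverse d)" .
    also have "inverse (d * d) * inverse d = inverse (d * d * d)" by (simp add: mult.assoc)
    finally show ?thesis by (simp add: mult.assoc)
  qed
  \<comment> \<open>The last \<open>s1\<close> of the conjugator replaces \<open>be\<close> by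
    \<open>al * s1\<close>, which is \<open>beta_4\<close>.\<close>
  have 1: "?x1 * ?x2 = (inverse g * word_elt m * s1) * (al * s1) * inverse (inverse g * word_elt m * s1)"
  proof -
    have "?x1 * ?x2 = inverse g * (word_elt m * be * inverse (word_elt m) * c1) * g * inverse c1"
      unfolding x12 dd c1(2) ..
    also have "\<dots> = inverse g * word_elt m * be * inverse (word_elt m) * g"
      using z1[of g] by (simp add: mult.assoc)
    finally show ?thesis by (simp add: be_def mult.assoc)
  qed
  have 2: "?x1 * ?x2 * ?x1 = al * al"
  proof -
    have "?x1 * ?x2 * ?x1 = inverse g * ?b * g * inverse c2" unfolding x12 prod3 ddd ..
    also have "\<dots> = inverse g * (g * (al * al) * inverse g * c2) * g * inverse c2" unfolding c2(2) ..
    also have "\<dots> = al * al" using z2[of g] by (simp add: mult.assoc)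
    finally show ?thesis .
  qed
  have 3: "?x1 * ?x2 * ?x1 = ?x2 * ?x1 * ?x2"
    unfolding prod prod3 using braid(1) by simp
  have "standard_on ?x1 ?x2 ?x1" unfolding standard_on_def using 1 2 3 by blast
  moreover have "\<phi> y = inner g (?x (\<phi> y) * d)" for y by (simp add: inner_def mult.assoc)
  ultimately show ?thesis
    unfolding standard_def using automorphism_inner dO s13 by metis
qed

section \<open>The transverse case: non-commuting matrices of the first two generators\<close>

lemma transverse_matrices:
  assumes "mat (\<phi> s1) * mat (\<phi> s2) \<noteq> mat (\<phi> s2) * mat (\<phi> s1)"
  shows "mat (\<phi> s3) = mat (\<phi> s1)" "trc (mat (\<phi> (s1 * s2))) = 1" "trc (mat (\<phi> (s1 * s2 * s1))) = 0"
proof -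
  have b: "mat (\<phi> s1) * mat (\<phi> s2) * mat (\<phi> s1) = mat (\<phi> s2) * mat (\<phi> s1) * mat (\<phi> s2)"
    "mat (\<phi> s3) * mat (\<phi> s2) * mat (\<phi> s3) = mat (\<phi> s2) * mat (\<phi> s3) * mat (\<phi> s2)"
    "mat (\<phi> s1) * mat (\<phi> s3) = mat (\<phi> s3) * mat (\<phi> s1)"
    using braid by (simp_all flip: mat(2))
  show "mat (\<phi> s3) = mat (\<phi> s1)"
    using commuting_braid_partner_unique[OF b(1) assms b(2,3)] mat(1) by blast
  show "trc (mat (\<phi> (s1 * s2))) = 1" "trc (mat (\<phi> (s1 * s2 * s1))) = 0"
    using braid_trace[OF b(1) assms mat(1) mat(1)] by (simp_all add: mat)
qed

text \<open>The cube of \<open>ell\<close> is minus one, so \<open>delta2\<close> is an odd word,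
  fixed by everything commuting with it. If the matrices of the images of \<open>s1 s2 s1\<close>
  and \<open>s1 s2\<close> commuted, those of \<open>s1\<close> and \<open>s2\<close> would commute
  too.\<close>

lemma transverse_omega:
  assumes ne: "mat (\<phi> s1) * mat (\<phi> s2) \<noteq> mat (\<phi> s2) * mat (\<phi> s1)" and e: "mat (\<phi> (s1 * s2)) = ell"
  obtains z k where "delta2 \<approx> word_elt z" "k > 0" "conj_words z (omega ^ k) \<or> conj_words z (inverse omega ^ k)"
proof -
  have e': "mat (\<phi> s1) * mat (\<phi> s2) = ell" using e by (simp add: mat)
  then have "mat delta2 = neg 1" by (simp add: mat mult.assoc[symmetric] one_mat2_def) (simp add: mult.assoc)
  then obtain z where z: "delta2 \<approx> word_elt z" "\<not> even_word z"
    using kernel_word[of delta2] by (auto simp: one_mat2_def)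
  note f1 = act_fixes_word[OF delta_central(1) z(1)] and f2 = act_fixes_word[OF delta_central(2) z(1)]
  have fa: "act (\<phi> (s1 * s2)) z = z" and fb: "act (\<phi> (s1 * s2 * s1)) z = z" using f1 f2 by simp_all
  have "mat (\<phi> (s1 * s2 * s1)) * ell \<noteq> ell * mat (\<phi> (s1 * s2 * s1))"
  proof
    assume *: "mat (\<phi> (s1 * s2 * s1)) * ell = ell * mat (\<phi> (s1 * s2 * s1))"
    let ?x = "mat (\<phi> s1)" and ?y = "mat (\<phi> s2)"
    have "(?x * ?y) * (?x * (?x * ?y)) = (?x * ?y) * ((?x * ?y) * ?x)"
      using * unfolding e'[symmetric] by (simp add: mat mult.assoc)
    then have "?x * (?x * ?y) = ?x * ?y * ?x" using mat2_left_cancel[of "?x * ?y"] mat(1) by simp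
    then have "?x * (?x * ?y) = ?x * (?y * ?x)" by (simp add: mult.assoc)
    then show False using mat2_left_cancel[of ?x] mat(1) ne by blast
  qed
  from fixed_word_omega[OF z(2) fa fb e this] that z(1) show thesis by blast
qed

lemma B3_standard:
  assumes f: "act (\<phi> s1) (omega ^ k) = omega ^ k" "act (\<phi> s2) (omega ^ k) = omega ^ k" "k > 0"
    and s13: "\<phi> s3 = \<phi> s1"
  shows "standard \<phi>"
proof -
  obtain h where h: "h \<in> B3" "\<phi> s1 \<approx> h" using stabilizer_omega_power[OF f(1,3)] by blast
  obtain k where k: "k \<in> B3" "\<phi> s2 \<approx> k" using stabilizer_omega_power[OF f(2,3)] by blast
  obtain c where c: "c \<in> Om_powers" "\<phi> s1 = h * c" using h(2) unfolding eqz_def by blast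
  obtain c' where c': "c' \<in> Om_powers" "\<phi> s2 = k * c'" using k(2) unfolding eqz_def by blast
  note z = Om_powers_central[OF c(1)] and z' = Om_powers_central[OF c'(1)]
  \<comment> \<open>The correction factor of \<open>\<phi> s2\<close> may differ from that of \<open>\<phi> s1\<close>; conjugating \<open>\<phi> s1\<close> to \<open>\<phi> s2\<close>
    avoids comparing them.\<close>
  let ?k = "h * k * h * inverse (h * k)"
  have k': "?k \<in> B3" using h(1) k(1) by (intro B3_mult B3_inverse)
  have conj: "\<phi> s2 = (\<phi> s1 * \<phi> s2) * \<phi> s1 * inverse (\<phi> s1 * \<phi> s2)"
    using braid(1) by (metis eq_mult_inv_iff mult.assoc)
  have p: "\<phi> s1 * \<phi> s2 = h * k * (c * c')" unfolding c(2) c'(2) using z by (metis mult.assoc)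
  have "c * c' \<in> Om_powers" using c c' by simp
  note zz = Om_powers_central[OF this]
  have s2: "\<phi> s2 = ?k * c"
  proof -
    have "\<phi> s2 = h * k * (c * c') * (h * c) * inverse (h * k * (c * c'))"
      using conj unfolding p unfolding c(2) .
    also have "\<dots> = h * k * ((c * c') * (h * c) * inverse (c * c')) * inverse (h * k)"
      by (simp add: mult.assoc)
    also have "(c * c') * (h * c) * inverse (c * c') = h * c" unfolding zz by (simp add: mult.assoc)
    also have "h * k * (h * c) * inverse (h * k) = ?k * c"
      using z[of "inverse (h * k)"] by (simp add: mult.assoc)
    finally show ?thesis .
  qed
  have cube: "x * c * (y * c) * (w * c) = x * y * w * (c * c * c)" for x y w
    by (rule central_cube[OF z])
  have "h * ?k * h * (c * c * c) = ?k * h * ?k * (c * c * c)"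
    using braid(1) unfolding s2 unfolding c(2) cube .
  then have "h * ?k * h = ?k * h * ?k" by (simp only: mult_right_cancel')
  then have "standard_on h ?k h" unfolding standard_on_def using h(1) k' by blast
  then show ?thesis
    unfolding standard_def using automorphism_id c s2 s13 by (metis id_apply)
qed

lemma Om_powers_image:
  assumes "\<phi> Om \<in> Om_powers" "c \<in> Om_powers"
  shows "\<phi> c \<in> Om_powers"
proof -
  obtain n where "c = Om ^ n \<or> c = inverse (Om ^ n)" using assms(2) by (auto simp: Om_powers_alt inv_power)
  moreover have "\<phi> Om ^ n \<in> Om_powers" by (induction n) (simp_all add: assms(1))
  ultimately show ?thesis by auto
qed

lemma eqz_image: "\<phi> Om \<in> Om_powers \<Longrightarrow> x \<approx> y \<Longrightarrow> \<phi> x \<approx> \<phi> y"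
  unfolding eqz_def using Om_powers_image by (metis mult)

text \<open>The involutions are conjugates of \<open>al * al\<close> by powers of \<open>be\<close>,
  so \<open>\<phi>\<close> fixes all words modulo \<open>Om\<close>. Then \<open>\<phi> al\<close>
  acts on the words as \<open>al\<close> does and agrees with it modulo \<open>Om\<close> by
  faithfulness. Conjugation by \<open>al\<close> carries the central factor of \<open>s1\<close>
  over to \<open>s2\<close> and \<open>s3\<close>.\<close>

lemma fixed_be_u_standard:
  assumes Om: "\<phi> Om \<in> Om_powers" and be: "\<phi> be \<approx> be" and u: "\<phi> (al * al) \<approx> al * al"
  shows "standard \<phi>"
proof -
  have ig: "\<phi> (inv_gen a) \<approx> inv_gen a" for a
  proof (cases a)
    case U
    then show ?thesis using u by simp
  next
    case V
    have "\<phi> be * \<phi> (al * al) * inverse (\<phi> be) \<approx> be * (al * al) * inverse be"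
      by (intro eqz_mult eqz_inverse be u)
    then show ?thesis using V by simp
  next
    case W
    have "\<phi> be * (\<phi> be * \<phi> (al * al) * inverse (\<phi> be)) * inverse (\<phi> be)
        \<approx> be * (be * (al * al) * inverse be) * inverse be"
      by (intro eqz_mult eqz_inverse be u)
    then show ?thesis using W by simp
  qed
  have we: "\<phi> (word_elt x) \<approx> word_elt x" for x
  proof -
    have "\<phi> (prod_list (map inv_gen l)) \<approx> prod_list (map inv_gen l)" for l
      by (induction l) (simp_all del: inv_gen.simps add: eqz_mult ig)
    then show ?thesis by (simp add: word_elt_def)
  qed
  have alal: "act (\<phi> al) (gen a) = act al (gen a)" for a
  proof (rule word_elt_inject)
    have "word_elt (act (\<phi> al) (gen a)) \<approx> \<phi> al * word_elt (gen a) * inverse (\<phi> al)"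
      by (rule eqz_sym[OF conj_word_elt_act])
    also have "\<dots> \<approx> \<phi> al * \<phi> (inv_gen a) * inverse (\<phi> al)"
      unfolding word_elt_gen by (intro eqz_mult eqz_refl eqz_sym[OF ig])
    also have "\<dots> = \<phi> (al * inv_gen a * inverse al)" by simp
    also have "\<dots> \<approx> \<phi> (word_elt (alpha_letter a))" by (rule eqz_image[OF Om al_inv_gen])
    also have "\<dots> \<approx> word_elt (act al (gen a))" by (simp add: we act_al)
    finally show "word_elt (act (\<phi> al) (gen a)) \<approx> word_elt (act al (gen a))" .
  qed
  have "inverse al * \<phi> al \<in> Om_powers" by (rule act_faithful) (simp add: alal)
  then have al: "\<phi> al \<approx> al" unfolding eqz_def by (intro bexI[of _ "inverse al * \<phi> al"]) simp_all
  have "\<phi> s1 \<approx> s1"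
    unfolding s_al_be(1) mult inv by (intro eqz_mult eqz_inverse be al)
  then obtain d where d: "d \<in> Om_powers" "\<phi> s1 = s1 * d" unfolding eqz_def by blast
  obtain c where c: "c \<in> Om_powers" "\<phi> al = al * c" using al unfolding eqz_def by blast
  note zc = Om_powers_central[OF c(1)] and zd = Om_powers_central[OF d(1)]
  have conj: "\<phi> al * (x * d) * inverse (\<phi> al) = al * x * inverse al * d" for x
  proof -
    have "\<phi> al * (x * d) * inverse (\<phi> al) = al * (c * (x * d)) * inverse c * inverse al"
      unfolding c(2) by (simp add: mult.assoc)
    also have "\<dots> = al * x * (d * inverse al)" unfolding zc by (simp add: mult.assoc)
    finally show ?thesis unfolding zd by (simp add: mult.assoc)
  qed
  have s2: "\<phi> s2 = s2 * d"
  proof -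
    have "\<phi> s2 = \<phi> al * \<phi> s1 * inverse (\<phi> al)" by (subst s_al_be(2)) simp
    then show ?thesis unfolding d(2) conj s_al_be(2)[symmetric] .
  qed
  have s3: "\<phi> s3 = s3 * d"
  proof -
    have "\<phi> s3 = \<phi> al * \<phi> s2 * inverse (\<phi> al)" by (subst s_al_be(3)) simp
    then show ?thesis unfolding s2 conj s_al_be(3)[symmetric] .
  qed
  show ?thesis
    unfolding standard_def standard_on_def using automorphism_id d s2 s3 by (metis id_apply)
qed

end

lemma (in b4_endo) inner_comp: "b4_endo (inner y \<circ> \<phi>)"
  by (rule comp_automorphism[OF automorphism_inner])

lemma (in b4_endo) transverse_standard_normalized:
  assumes ne: "mat (\<phi> s1) * mat (\<phi> s2) \<noteq> mat (\<phi> s2) * mat (\<phi> s1)" and e: "mat (\<phi> (s1 * s2)) = ell"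
  shows "standard \<phi>"
proof -
  obtain z k where z: "delta2 \<approx> word_elt z" "k > 0"
    "conj_words z (omega ^ k) \<or> conj_words z (inverse omega ^ k)"
    using transverse_omega[OF ne e] by blast
  note tm = transverse_matrices[OF ne]
  show ?thesis
  proof (cases "\<phi> s3 = \<phi> s1")
    case True
    obtain m where m: "m * z * inverse m = omega ^ k \<or> m * z * inverse m = inverse omega ^ k"
      using z(3) unfolding conj_words_def by metis
    let ?\<chi> = "inner (word_elt m)"
    interpret E: b4_endo "?\<chi> \<circ> \<phi>" by (rule inner_comp)
    have fz: "act (\<phi> s1) z = z" "act (\<phi> s2) z = z"
      using act_fixes_word[OF delta_central(1) z(1)] act_fixes_word[OF delta_central(2) z(1)] by blast+
    have inn: "act (?\<chi> y) (m * z * inverse m) = m * z * inverse m" if "act y z = z" for y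
    proof -
      have "act (inverse (word_elt m)) x = inverse m * x * m" for x
        using act_word_elt[of m "inverse m * x * m"] act_inverse(1)[of "word_elt m" "inverse m * x * m"]
        by (simp add: mult.assoc)
      then have "act (inverse (word_elt m)) (m * z * inverse m) = z" by (simp add: mult.assoc)
      then show ?thesis using that act_word_elt[of m z] by (simp add: inner_def del: act.mult act.inv)
    qed
    have inv: "act y (omega ^ k) = omega ^ k" if "act y (inverse omega ^ k) = inverse omega ^ k" for y
    proof -
      have "inverse (act y (inverse omega ^ k)) = inverse (inverse omega ^ k)" using that by simp
      then have "act y (inverse (inverse omega ^ k)) = inverse (inverse omega ^ k)" by (simp only: act.inv)
      then show ?thesis by (simp add: inv_power del: act.power)
    qed
    have "act (?\<chi> (\<phi> s1)) (omega ^ k) = omega ^ k" "act (?\<chi> (\<phi> s2)) (omega ^ k) = omega ^ k"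
      using inn[OF fz(1)] inn[OF fz(2)] inv m by metis+
    then have "standard (?\<chi> \<circ> \<phi>)" using E.B3_standard[of k] z(2) True by simp
    then show ?thesis by (rule standard_automorphism[OF automorphism_inner])
  next
    case False
    have B: "mat (\<phi> s1) * mat (\<phi> s2) * mat (\<phi> s1) * (mat (\<phi> s1) * mat (\<phi> s2) * mat (\<phi> s1)) = neg 1"
      using trc_zero_square[OF mat(1) tm(3)] by (simp add: mat)
    have mal: "mat (\<phi> (al * al)) = neg 1" using B tm(1) by (simp add: al_def mat mult.assoc)
    then have "mat (\<phi> Om) = 1" by (simp add: Om_alt mat mult.assoc[symmetric])
    then obtain c where c: "\<phi> Om \<approx> word_elt c" "even_word c" using kernel_word by blast
    then have "c = 1" using image_Om_trivial tm(1) False by metis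
    then have Om: "\<phi> Om \<in> Om_powers" using c(1) by (simp add: eqz_one_iff)
    \<comment> \<open>As \<open>s1\<close> and \<open>s3\<close> have images with equal matrices,
      \<open>be\<close> gets the matrix of the image of
      \<open>s1 (s1 s2 s1) = (s1 s2)^2\<close>.\<close>
    have "mat (\<phi> be) = mat be"
    proof -
      have "mat (\<phi> be) = mat (\<phi> (s1 * s2)) * mat (\<phi> (s1 * s2))"
        using tm(1) arg_cong[OF braid(1), of "\<lambda>x. mat (\<phi> s1 * x)"] by (simp add: be_def al_def mat mult.assoc)
      then show ?thesis unfolding e by (simp add: mat_be)
    qed
    moreover have "\<phi> be * \<phi> be * \<phi> be \<in> Om_powers" using Om be_cube by (simp flip: mult)
    ultimately obtain m where m: "\<phi> be \<approx> word_elt m * be * inverse (word_elt m)"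
      using order_three_conj by blast
    define \<phi>1 where "\<phi>1 = inner (inverse (word_elt m)) \<circ> \<phi>"
    interpret E1: b4_endo \<phi>1 unfolding \<phi>1_def by (rule inner_comp)
    have be1: "\<phi>1 be \<approx> be"
    proof -
      have "inverse (word_elt m) * \<phi> be * word_elt m
          \<approx> inverse (word_elt m) * (word_elt m * be * inverse (word_elt m)) * word_elt m"
        using m by (simp only: eqz_cancel)
      then show ?thesis by (simp add: \<phi>1_def inner_def mult.assoc)
    qed
    have Om1: "\<phi>1 Om \<in> Om_powers"
      using Om Om_powers_central[OF Om, of "word_elt m"] by (simp add: \<phi>1_def inner_def mult.assoc)
    have "mat (inverse (word_elt m)) * mat (word_elt m) = 1"
      using adj_mult(1)[OF mat(1)] by (simp add: mat_inverse)
    then have "mat (\<phi>1 (al * al)) = neg 1"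
      using mal by (simp add: \<phi>1_def inner_def mat del: mult)
    then obtain q where q: "\<phi>1 (al * al) \<approx> word_elt q" "\<not> even_word q"
      using kernel_word[of "\<phi>1 (al * al)"] by (auto simp: one_mat2_def)
    have "\<phi>1 (al * al) * \<phi>1 (al * al) \<in> Om_powers" using Om1 by (simp add: Om_alt del: E1.mult flip: E1.mult)
    then have "q * q = 1" using odd_square_trivial q(1) by blast
    then obtain l b where lb: "letters q = l @ [b] @ rev l" using odd_involution q(2) by blast
    define z1 where "z1 = act (inverse (word_elt m)) z"
    have z1: "conj_words z1 (omega ^ k) \<or> conj_words z1 (inverse omega ^ k)"
    proof -
      have "word_elt m * word_elt (inverse m) \<approx> word_elt m * inverse (word_elt m)"
        by (intro eqz_mult eqz_refl word_elt_inverse)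
      then have "act (inverse (word_elt m)) = act (word_elt (inverse m))"
        using eqz_act[OF word_elt_inverse[of m]] by simp
      then have "z1 = inverse m * z * inverse (inverse m)" unfolding z1_def by (simp add: act_word_elt)
      then have "conj_words z z1" unfolding conj_words_def by blast
      then show ?thesis using z(3) conj_words_sym conj_words_trans by blast
    qed
    have d1: "\<phi>1 (s1 * s2 * (s1 * s2) * (s1 * s2)) \<approx> word_elt z1"
    proof -
      have "\<phi>1 (s1 * s2 * (s1 * s2) * (s1 * s2)) = inverse (word_elt m) * delta2 * word_elt m"
        by (simp add: \<phi>1_def inner_def)
      also have "\<dots> \<approx> inverse (word_elt m) * word_elt z * word_elt m"
        using z(1) by (simp only: eqz_cancel)
      also have "\<dots> \<approx> word_elt z1"
        using conj_word_elt_act[of "inverse (word_elt m)" z] by (simp add: z1_def)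
      finally show ?thesis .
    qed
    have gV: "\<phi>1 (inv_gen V) \<approx> word_elt (rot q)" and gW: "\<phi>1 (inv_gen W) \<approx> word_elt (rot (rot q))"
    proof -
      have step: "\<phi>1 be * x * inverse (\<phi>1 be) \<approx> word_elt (rot y)" if "x \<approx> word_elt y" for x y
      proof -
        have "\<phi>1 be * x * inverse (\<phi>1 be) \<approx> be * word_elt y * inverse be"
          by (intro eqz_mult eqz_inverse be1 that)
        also have "\<dots> \<approx> word_elt (rot y)" using conj_word_elt_act[of be y] by (simp add: act_be)
        finally show ?thesis .
      qed
      show "\<phi>1 (inv_gen V) \<approx> word_elt (rot q)" using step[OF q(1)] by simp
      show "\<phi>1 (inv_gen W) \<approx> word_elt (rot (rot q))" using step[OF step[OF q(1)]] by simp
    qed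
    have "word_elt z1 \<approx> \<phi>1 (word_elt omega)"
      using eqz_trans[OF eqz_sym[OF d1] E1.eqz_image[OF Om1 delta_word]] .
    also have "\<phi>1 (word_elt omega) \<approx> \<phi>1 (inv_gen W * inv_gen V * inv_gen U)"
    proof (rule E1.eqz_image[OF Om1])
      have "word_elt (gen W * gen V * gen U) \<approx> word_elt (gen W * gen V) * word_elt (gen U)"
        by (rule word_elt_mult)
      also have "\<dots> \<approx> word_elt (gen W) * word_elt (gen V) * word_elt (gen U)"
        by (rule eqz_mult[OF word_elt_mult eqz_refl])
      finally show "word_elt omega \<approx> inv_gen W * inv_gen V * inv_gen U"
        unfolding word_elt_gen by (simp add: omega_def mult.assoc del: inv_gen.simps)
    qed
    also have "\<dots> = \<phi>1 (inv_gen W) * \<phi>1 (inv_gen V) * \<phi>1 (inv_gen U)" by (simp only: E1.mult)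
    also have "\<dots> \<approx> word_elt (rot (rot q)) * word_elt (rot q) * word_elt q"
      using q(1) by (intro eqz_mult gV gW) simp
    also have "\<dots> \<approx> word_elt (rot (rot q) * rot q) * word_elt q"
      by (rule eqz_mult[OF eqz_sym[OF word_elt_mult] eqz_refl])
    also have "\<dots> \<approx> word_elt (rot (rot q) * rot q * q)" by (rule eqz_sym[OF word_elt_mult])
    finally have "z1 = rot (rot q) * rot q * q" by (rule word_elt_inject)
    \<comment> \<open>The word \<open>W V U\<close> of \<open>(s1 s2)^3\<close> is mapped to the
      product of the rotated copies of \<open>q\<close>. This product is conjugate to a power of
      \<open>omega\<close> or of its inverse, where letters two apart differ, so \<open>q\<close> is
      a single letter.\<close>
    then have "l = []" using involution_product_conj_omega[OF lb] z1 z(2) by blast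
    then have "letters q = letters (gen b)" using lb by simp
    then have "q = gen b" by (simp only: letters_inject)
    then have u1: "\<phi>1 (al * al) \<approx> inv_gen b" using q(1) by (simp del: E1.mult)
    \<comment> \<open>Which of the three letters \<open>q\<close> is remains open; conjugation by a
      power of \<open>be\<close> settles this without disturbing the normalised image of
      \<open>be\<close>.\<close>
    obtain i where i: "inv_gen b = be ^ i * (al * al) * inverse (be ^ i)" using inv_gen_conj by blast
    define \<phi>2 where "\<phi>2 = inner (inverse (be ^ i)) \<circ> \<phi>1"
    interpret E2: b4_endo \<phi>2 unfolding \<phi>2_def by (rule E1.inner_comp)
    have "\<phi>2 Om \<in> Om_powers"
      using Om1 Om_powers_central[OF Om1, of "be ^ i"] by (simp add: \<phi>2_def inner_def mult.assoc)
    moreover have "\<phi>2 be \<approx> be"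
    proof -
      have "inverse (be ^ i) * \<phi>1 be * be ^ i \<approx> inverse (be ^ i) * be * be ^ i"
        using be1 by (simp only: eqz_cancel)
      also have "\<dots> = be" by (simp add: mult.assoc power_commutes[symmetric])
      finally show ?thesis by (simp add: \<phi>2_def inner_def)
    qed
    moreover have "\<phi>2 (al * al) \<approx> al * al"
    proof -
      have "inverse (be ^ i) * \<phi>1 (al * al) * be ^ i \<approx> inverse (be ^ i) * inv_gen b * be ^ i"
        using u1 by (simp only: eqz_cancel)
      also have "\<dots> = al * al" unfolding i by (simp add: mult.assoc)
      finally show ?thesis by (simp add: \<phi>2_def inner_def del: E1.mult)
    qed
    ultimately have "standard \<phi>2" by (rule E2.fixed_be_u_standard)
    then have "standard \<phi>1" unfolding \<phi>2_def by (rule standard_automorphism[OF automorphism_inner])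
    then show ?thesis unfolding \<phi>1_def by (rule standard_automorphism[OF automorphism_inner])
  qed
qed

theorem (in b4_endo) noncyclic_standard:
  assumes "\<phi> s1 \<noteq> \<phi> s2"
  shows "standard \<phi>"
proof (cases "mat (\<phi> s1) * mat (\<phi> s2) = mat (\<phi> s2) * mat (\<phi> s1)")
  case True
  have "mat (\<phi> s1) * mat (\<phi> s2) * mat (\<phi> s1) = mat (\<phi> s2) * mat (\<phi> s1) * mat (\<phi> s2)"
    using braid(1) by (simp flip: mat(2))
  then have 12: "mat (\<phi> s2) = mat (\<phi> s1)" using braid_commute_eq True mat(1) by metis
  have 23: "mat (\<phi> s3) = mat (\<phi> s2)"
  proof -
    have "\<phi> s3 = \<phi> al * \<phi> s2 * inverse (\<phi> al)" "\<phi> s2 = \<phi> al * \<phi> s1 * inverse (\<phi> al)"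
      by (subst s_al_be(3), simp) (subst s_al_be(2), simp)
    then show ?thesis using 12 by (simp add: mat)
  qed
  obtain \<chi> where \<chi>: "automorphism \<chi>" "\<And>x y. mat (\<chi> x) = mat (\<chi> y) \<longleftrightarrow> mat x = mat y"
    "mat (\<chi> (\<phi> s1)) = ell"
    using normalize_elliptic[OF parallel_trace[OF 12 assms]] by blast
  interpret E: b4_endo "\<chi> \<circ> \<phi>" by (rule comp_automorphism[OF \<chi>(1)])
  have eq: "mat (\<chi> (\<phi> s2)) = ell" "mat (\<chi> (\<phi> s3)) = ell" using \<chi>(2,3) 12 23 by metis+
  have "\<chi> (\<phi> s1) \<noteq> \<chi> (\<phi> s2)" using \<chi>(1) assms by (metis automorphism_def bij_is_inj injD)
  then have "standard (\<chi> \<circ> \<phi>)" using E.parallel_standard \<chi>(3) eq by simp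
  then show ?thesis by (rule standard_automorphism[OF \<chi>(1)])
next
  case False
  obtain \<chi> where \<chi>: "automorphism \<chi>" "\<And>x y. mat (\<chi> x) = mat (\<chi> y) \<longleftrightarrow> mat x = mat y"
    "mat (\<chi> (\<phi> (s1 * s2))) = ell"
    using normalize_elliptic[OF transverse_matrices(2)[OF False]] by blast
  interpret \<chi>: group_morphism \<chi> using \<chi>(1) by (simp add: automorphism_def)
  interpret E: b4_endo "\<chi> \<circ> \<phi>" by (rule comp_automorphism[OF \<chi>(1)])
  have "mat (\<chi> (\<phi> s1)) * mat (\<chi> (\<phi> s2)) \<noteq> mat (\<chi> (\<phi> s2)) * mat (\<chi> (\<phi> s1))"
    using False \<chi>(2)[of "\<phi> s1 * \<phi> s2" "\<phi> s2 * \<phi> s1"] by (simp add: mat)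
  then have "standard (\<chi> \<circ> \<phi>)" using E.transverse_standard_normalized \<chi>(3) by simp
  then show ?thesis by (rule standard_automorphism[OF \<chi>(1)])
qed

section \<open>Presented braid groups\<close>

lemma braid_alpha_3: "braid_alpha 3 = braid_sigma 3 1 \<otimes>\<^bsub>braid_group 3\<^esub> braid_sigma 3 2"
proof -
  interpret group "braid_group 3" by (rule group_braid_group)
  have "[1..<3] = [1, 2::nat]" by (simp add: upt_rec)
  then show ?thesis by (simp add: braid_alpha_def braid_sigma_carrier)
qed

lemma braid_beta_3:
  "braid_beta 3 = braid_sigma 3 1 \<otimes>\<^bsub>braid_group 3\<^esub> braid_sigma 3 2 \<otimes>\<^bsub>braid_group 3\<^esub> braid_sigma 3 1"
  by (simp add: braid_beta_def braid_alpha_3)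

lemma braid_alpha_4: "braid_alpha 4 = Rep_b4 al"
proof -
  interpret group "braid_group 4" by (rule group_braid_group)
  have "[1..<4] = [1, 2, 3::nat]" by (simp add: upt_rec)
  then show ?thesis
    by (simp add: braid_alpha_def al_def Rep_b4_mult Rep_b4_s braid_sigma_carrier m_assoc)
qed

lemma braid_beta_4: "braid_beta 4 = Rep_b4 (al * s1)"
  by (simp add: braid_beta_def braid_alpha_4 Rep_b4_mult Rep_b4_s)

lemma b3_lift:
  assumes H: "group H" and car: "a \<in> carrier H" "b \<in> carrier H"
    and rel: "a \<otimes>\<^bsub>H\<^esub> (b \<otimes>\<^bsub>H\<^esub> a) = b \<otimes>\<^bsub>H\<^esub> (a \<otimes>\<^bsub>H\<^esub> b)"
  obtains f where "f \<in> hom (braid_group 3) H" "f (braid_sigma 3 1) = a" "f (braid_sigma 3 2) = b"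
proof -
  interpret H: group H by fact
  let ?f = "\<lambda>i::nat. if i = 1 then a else b"
  have r: "gword_eval H ?f r = gword_eval H ?f s" if "(r, s) \<in> braid_relations 3" for r s
  proof -
    from that have "r = [(1, True), (2, True), (1, True)]" "s = [(2, True), (1, True), (2, True)]"
      by (auto simp: braid_relations_def)
    then show ?thesis using rel car by simp
  qed
  have hom: "presented_lift H ?f \<in> hom (braid_group 3) H"
    unfolding braid_group_def
    by (rule presentation.presented_lift_hom[OF braid_presentation H]) (use car r in auto)
  have "presented_lift H ?f (braid_sigma 3 i) = ?f i" if "i \<in> {1..<3}" for i
    unfolding braid_sigma_def
    by (rule presentation.presented_lift_gen[OF braid_presentation H]) (use car r that in auto)
  from this[of 1] this[of 2] show thesis using that[OF hom] by simp
qed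

section \<open>From the type back to the presented groups\<close>

definition lift_endo :: "(nat gword set \<Rightarrow> nat gword set) \<Rightarrow> b4 \<Rightarrow> b4" where
  "lift_endo f x = Abs_b4 (f (Rep_b4 x))"

lemma Rep_lift_endo:
  "f \<in> hom (braid_group 4) (braid_group 4) \<Longrightarrow> Rep_b4 (lift_endo f x) = f (Rep_b4 x)"
  using Rep_b4_carrier[of x] unfolding lift_endo_def hom_def by (intro Abs_b4_inverse) (auto simp: Pi_iff)

lemma lift_endo_morphism:
  assumes "f \<in> hom (braid_group 4) (braid_group 4)"
  shows "group_morphism (lift_endo f)"
proof
  fix x y
  show "lift_endo f (x * y) = lift_endo f x * lift_endo f y"
    using assms by (simp add: Rep_lift_endo Rep_b4_mult hom_mult flip: Rep_b4_inject)
qed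

lemma drop_endo_hom:
  assumes "group_morphism f"
  shows "(\<lambda>X. Rep_b4 (f (Abs_b4 X))) \<in> hom (braid_group 4) (braid_group 4)"
proof (rule homI)
  interpret group_morphism f by fact
  fix X Y assume XY: "X \<in> carrier (braid_group 4)" "Y \<in> carrier (braid_group 4)"
  have "Abs_b4 (X \<otimes>\<^bsub>braid_group 4\<^esub> Y) = Abs_b4 X * Abs_b4 Y"
    using XY by (simp add: times_b4_def Abs_b4_inverse)
  then show "Rep_b4 (f (Abs_b4 (X \<otimes>\<^bsub>braid_group 4\<^esub> Y))) =
      Rep_b4 (f (Abs_b4 X)) \<otimes>\<^bsub>braid_group 4\<^esub> Rep_b4 (f (Abs_b4 Y))"
    by (simp add: Rep_b4_mult)
qed simp

text \<open>The value at \<open>x\<close> is the common value of the generators raised to the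
  exponent sum of \<open>x\<close>, so the image is a quotient of the integers. This serves both to
  exclude cyclic endomorphisms and to recognise the transvecting homomorphism as cyclic.\<close>

lemma cyclic_image:
  assumes t: "t \<in> hom (braid_group 4) (braid_group 4)"
    and eq: "lift_endo t s2 = lift_endo t s1" "lift_endo t s3 = lift_endo t s1"
  shows "cyclic_group ((braid_group 4)\<lparr>carrier := t ` carrier (braid_group 4)\<rparr>)"
proof -
  let ?G = "braid_group 4" and ?d = "t (Rep_b4 s1)"
  let ?I = "?G\<lparr>carrier := t ` carrier ?G\<rparr>"
  interpret G: group ?G by (rule group_braid_group)
  interpret t: group_hom ?G ?G t by unfold_locales (rule t)
  interpret T: group_morphism "lift_endo t" by (rule lift_endo_morphism[OF t])
  have I: "group ?I" using t.img_is_subgroup G.subgroup_imp_group by blast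
  have d: "?d \<in> carrier ?G" by simp
  have pow: "t (Rep_b4 x) = ?d [^]\<^bsub>?G\<^esub> expo x" for x
  proof (induction x rule: b4_induct)
    case one
    show ?case by (simp add: Rep_b4_one)
  next
    case (mult s x)
    have g: "t (Rep_b4 s2) = ?d" "t (Rep_b4 s3) = ?d" using eq Rep_lift_endo[OF t] by metis+
    have 1: "?d = ?d [^]\<^bsub>?G\<^esub> (1::int)" "inv\<^bsub>?G\<^esub> ?d = ?d [^]\<^bsub>?G\<^esub> (- 1::int)"
      using d by (simp_all add: G.int_pow_neg)
    have "t (Rep_b4 s) = ?d [^]\<^bsub>?G\<^esub> expo s"
      using mult(1) 1 g by (auto simp: expo Rep_b4_inverse_elt t.hom_inv)
    then show ?case using mult(2) d by (simp add: Rep_b4_mult t.hom_mult expo G.int_pow_mult)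
  qed
  have "(\<lambda>n. ?d [^]\<^bsub>?G\<^esub> (n::int)) \<in> epi integer_group ?I"
  proof -
    have in_I: "?d [^]\<^bsub>?G\<^esub> n \<in> t ` carrier ?G" for n :: int
      by (rule image_eqI[of _ _ "Rep_b4 s1 [^]\<^bsub>?G\<^esub> n"]) (simp_all add: t.hom_int_pow G.int_pow_closed)
    moreover have "t X \<in> range (\<lambda>n. ?d [^]\<^bsub>?G\<^esub> (n::int))" if "X \<in> carrier ?G" for X
      using pow[of "Abs_b4 X"] that by (simp add: Abs_b4_inverse)
    ultimately show ?thesis
      using d by (auto simp: epi_def hom_def integer_group_def G.int_pow_mult)
  qed
  then show ?thesis
    using group.cyclic_group_epimorphic_image[OF group_integer_group _ cyclic_integer_group I] by blast
qed

lemma B3_incl: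
  assumes "x \<in> B3"
  shows "\<exists>k\<in>carrier (braid_group 3). Rep_b4 x = braid_incl_3_4 k"
proof -
  interpret G3: group "braid_group 3" by (rule group_braid_group)
  interpret i: group_hom "braid_group 3" "braid_group 4" braid_incl_3_4
    by (simp add: group_hom_def group_hom_axioms_def group_braid_group braid_incl_3_4_hom)
  have step: "\<exists>k\<in>carrier (braid_group 3). Rep_b4 (s * x) = braid_incl_3_4 k"
    if hyp: "\<exists>k\<in>carrier (braid_group 3). Rep_b4 x = braid_incl_3_4 k" "Rep_b4 s = braid_incl_3_4 g"
      "g \<in> carrier (braid_group 3)" for s x g
  proof -
    obtain k where k: "k \<in> carrier (braid_group 3)" "Rep_b4 x = braid_incl_3_4 k"
      using hyp(1) by blast
    have "Rep_b4 (s * x) = braid_incl_3_4 (g \<otimes>\<^bsub>braid_group 3\<^esub> k)"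
      unfolding Rep_b4_mult i.hom_mult[OF hyp(3) k(1)] hyp(2) k(2) ..
    then show ?thesis using G3.m_closed[OF hyp(3) k(1)] by (rule bexI)
  qed
  have g: "braid_sigma 3 1 \<in> carrier (braid_group 3)" "braid_sigma 3 2 \<in> carrier (braid_group 3)"
    by (simp_all add: braid_sigma_carrier)
  have s: "Rep_b4 s1 = braid_incl_3_4 (braid_sigma 3 1)" "Rep_b4 s2 = braid_incl_3_4 (braid_sigma 3 2)"
    by (simp_all add: Rep_b4_s braid_incl_3_4_sigma)
  have si: "Rep_b4 (inverse s1) = braid_incl_3_4 (inv\<^bsub>braid_group 3\<^esub> braid_sigma 3 1)"
    "Rep_b4 (inverse s2) = braid_incl_3_4 (inv\<^bsub>braid_group 3\<^esub> braid_sigma 3 2)"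
    unfolding Rep_b4_inverse_elt s using g by (simp_all only: i.hom_inv)
  from assms show ?thesis
  proof induction
    case one
    show ?case
      unfolding Rep_b4_one using G3.one_closed i.hom_one by metis
  next
    case (s1 x)
    show ?case by (rule step[OF s1.IH s(1) g(1)])
  next
    case (s1_inv x)
    show ?case by (rule step[OF s1_inv.IH si(1) G3.inv_closed[OF g(1)]])
  next
    case (s2 x)
    show ?case by (rule step[OF s2.IH s(2) g(2)])
  next
    case (s2_inv x)
    show ?case by (rule step[OF s2_inv.IH si(2) G3.inv_closed[OF g(2)]])
  qed
qed

text \<open>The retraction shows that the standard inclusion is injective, and a braid relation
  between elements of its image can be pulled back to three strands.\<close>

lemma R_star_incl:
  assumes "k \<in> carrier (braid_group 3)"
  shows "R_star (braid_incl_3_4 k) = k"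
proof -
  interpret presentation "{1..<3}" "braid_relations 3" by (rule braid_presentation)
  interpret G3: group "braid_group 3" by (rule group_braid_group)
  interpret h: group_hom "braid_group 3" "braid_group 3" "R_star \<circ> braid_incl_3_4"
    using Group.hom_compose[OF braid_incl_3_4_hom R_star_hom] by unfold_locales
  have gen: "(R_star \<circ> braid_incl_3_4) (braid_sigma 3 i) = braid_sigma 3 i" if "i \<in> {1..<3}" for i
  proof -
    have "i = 1 \<or> i = 2" using that by auto
    then show ?thesis using R_star_sigma by (auto simp: braid_incl_3_4_sigma)
  qed
  have "(R_star \<circ> braid_incl_3_4) (cls w) = cls w" if "w \<in> gwords {1..<3}" for w
    using that
  proof (induction w)
    case Nil
    have "cls [] = \<one>\<^bsub>braid_group 3\<^esub>" by (simp add: braid_group_def one_cls del: One_nat_def)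
    then show ?case using h.hom_one by metis
  next
    case (Cons p w)
    obtain i b where p: "p = (i, b)" by (cases p)
    with Cons.prems have i: "i \<in> {1..<3}" and w: "w \<in> gwords {1..<3}" by auto
    have cw: "cls w \<in> carrier (braid_group 3)" using w by (simp add: braid_group_def del: One_nat_def)
    have sg: "cls [(i, True)] = braid_sigma 3 i"
      by (simp add: braid_sigma_def presented_gen_def del: One_nat_def)
    have "cls [(i, False)] \<otimes>\<^bsub>braid_group 3\<^esub> cls [(i, True)] = \<one>\<^bsub>braid_group 3\<^esub>"
      using i gword_cancel[of "[]" "{1..<3}" "[]" i "braid_relations 3" False]
      by (simp add: braid_group_def mult_cls one_cls cls_eq del: One_nat_def)
    moreover have car: "cls [(i, c)] \<in> carrier (braid_group 3)" for c
      using i by (simp add: braid_group_def del: One_nat_def)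
    ultimately have inv: "cls [(i, False)] = inv\<^bsub>braid_group 3\<^esub> braid_sigma 3 i"
      using G3.inv_equality[of "cls [(i, False)]" "cls [(i, True)]"] sg by simp
    have sc: "braid_sigma 3 i \<in> carrier (braid_group 3)" using car sg by metis
    have "(R_star \<circ> braid_incl_3_4) (cls [(i, b)]) = cls [(i, b)]"
    proof (cases b)
      case True
      then show ?thesis using sg gen[OF i] by simp
    next
      case False
      then have "cls [(i, b)] = inv\<^bsub>braid_group 3\<^esub> braid_sigma 3 i" using inv by simp
      then show ?thesis using h.hom_inv[OF sc] gen[OF i] by metis
    qed
    moreover have "cls (p # w) = cls [(i, b)] \<otimes>\<^bsub>braid_group 3\<^esub> cls w"
      using w i by (simp add: braid_group_def mult_cls p del: One_nat_def)
    ultimately show ?case using h.hom_mult[OF car cw, of b] Cons.IH[OF w] by metis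
  qed
  moreover obtain w where "w \<in> gwords {1..<3}" "k = cls w"
    using assms unfolding braid_group_def by (rule carrier_cases)
  ultimately show ?thesis by simp
qed

definition model_endo :: "(nat gword set \<Rightarrow> nat gword set) \<Rightarrow> bool" where
  "model_endo \<theta> \<longleftrightarrow> \<theta> = id \<or>
     (\<exists>f \<in> hom (braid_group 3) (braid_group 3). \<theta> = braid_incl_3_4 \<circ> f \<circ> R_star) \<or>
     (\<exists>f \<in> hom (braid_group 3) (braid_group 4). \<exists>g \<in> carrier (braid_group 4).
        f (braid_alpha 3) =
          g \<otimes>\<^bsub>braid_group 4\<^esub> braid_beta 4 \<otimes>\<^bsub>braid_group 4\<^esub> inv\<^bsub>braid_group 4\<^esub> g \<and>
        f (braid_beta 3) = braid_alpha 4 [^]\<^bsub>braid_group 4\<^esub> (2::nat) \<and>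
        \<theta> = f \<circ> R_star)"

lemma standard_on_model:
  assumes "standard_on x1 x2 x3"
  shows "\<exists>\<theta>. model_endo \<theta> \<and> \<theta> \<in> hom (braid_group 4) (braid_group 4) \<and>
    \<theta> (Rep_b4 s1) = Rep_b4 x1 \<and> \<theta> (Rep_b4 s2) = Rep_b4 x2 \<and> \<theta> (Rep_b4 s3) = Rep_b4 x3"
proof -
  interpret G3: group "braid_group 3" by (rule group_braid_group)
  interpret G4: group "braid_group 4" by (rule group_braid_group)
  note R = R_star_sigma[folded Rep_b4_s]
  have c3: "braid_sigma 3 1 \<in> carrier (braid_group 3)" "braid_sigma 3 2 \<in> carrier (braid_group 3)"
    by (simp_all add: braid_sigma_carrier)
  consider "x1 = s1" "x2 = s2" "x3 = s3"
    | "x3 = x1" "x1 * x2 * x1 = x2 * x1 * x2" "x1 \<in> B3" "x2 \<in> B3"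
    | g where "x3 = x1" "x1 * x2 * x1 = x2 * x1 * x2" "x1 * x2 = g * (al * s1) * inverse g"
      "x1 * x2 * x1 = al * al"
    using assms unfolding standard_on_def by blast
  then show ?thesis
  proof cases
    case 1
    then show ?thesis by (intro exI[of _ id]) (simp add: model_endo_def hom_def)
  next
    case 2
    obtain k1 where k1: "k1 \<in> carrier (braid_group 3)" "Rep_b4 x1 = braid_incl_3_4 k1"
      using B3_incl 2(3) by blast
    obtain k2 where k2: "k2 \<in> carrier (braid_group 3)" "Rep_b4 x2 = braid_incl_3_4 k2"
      using B3_incl 2(4) by blast
    interpret i: group_hom "braid_group 3" "braid_group 4" braid_incl_3_4
      by unfold_locales (rule braid_incl_3_4_hom)
    have "Rep_b4 (x1 * x2 * x1) = Rep_b4 (x2 * x1 * x2)" using 2(2) by simp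
    then have "braid_incl_3_4 (k1 \<otimes>\<^bsub>braid_group 3\<^esub> (k2 \<otimes>\<^bsub>braid_group 3\<^esub> k1)) =
        braid_incl_3_4 (k2 \<otimes>\<^bsub>braid_group 3\<^esub> (k1 \<otimes>\<^bsub>braid_group 3\<^esub> k2))"
      using k1 k2 by (simp add: Rep_b4_mult G4.m_assoc)
    then have "k1 \<otimes>\<^bsub>braid_group 3\<^esub> (k2 \<otimes>\<^bsub>braid_group 3\<^esub> k1) = k2 \<otimes>\<^bsub>braid_group 3\<^esub> (k1 \<otimes>\<^bsub>braid_group 3\<^esub> k2)"
      using R_star_incl k1(1) k2(1) by (metis G3.m_closed)
    then obtain f where f: "f \<in> hom (braid_group 3) (braid_group 3)"
      "f (braid_sigma 3 1) = k1" "f (braid_sigma 3 2) = k2"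
      using b3_lift[OF group_braid_group k1(1) k2(1)] by blast
    have "braid_incl_3_4 \<circ> f \<circ> R_star \<in> hom (braid_group 4) (braid_group 4)"
      using Group.hom_compose[OF R_star_hom Group.hom_compose[OF f(1) braid_incl_3_4_hom]]
      by (simp add: comp_assoc)
    then show ?thesis
      using f R 2(1) k1(2) k2(2) unfolding model_endo_def
      by (intro exI[of _ "braid_incl_3_4 \<circ> f \<circ> R_star"]) auto
  next
    case (3 g)
    have "Rep_b4 (x1 * x2 * x1) = Rep_b4 (x2 * x1 * x2)" using 3(2) by simp
    then have "Rep_b4 x1 \<otimes>\<^bsub>braid_group 4\<^esub> (Rep_b4 x2 \<otimes>\<^bsub>braid_group 4\<^esub> Rep_b4 x1) =
        Rep_b4 x2 \<otimes>\<^bsub>braid_group 4\<^esub> (Rep_b4 x1 \<otimes>\<^bsub>braid_group 4\<^esub> Rep_b4 x2)"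
      by (simp add: Rep_b4_mult G4.m_assoc)
    then obtain f where f: "f \<in> hom (braid_group 3) (braid_group 4)"
      "f (braid_sigma 3 1) = Rep_b4 x1" "f (braid_sigma 3 2) = Rep_b4 x2"
      using b3_lift[OF group_braid_group Rep_b4_carrier Rep_b4_carrier] by blast
    have "f (braid_alpha 3) = Rep_b4 (x1 * x2)"
      using hom_mult[OF f(1) c3] f by (simp add: braid_alpha_3 Rep_b4_mult)
    then have a: "f (braid_alpha 3) =
        Rep_b4 g \<otimes>\<^bsub>braid_group 4\<^esub> braid_beta 4 \<otimes>\<^bsub>braid_group 4\<^esub> inv\<^bsub>braid_group 4\<^esub> Rep_b4 g"
      unfolding 3(3) by (simp add: Rep_b4_mult Rep_b4_inverse_elt braid_beta_4)
    have "f (braid_beta 3) = Rep_b4 (x1 * x2 * x1)"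
      using hom_mult[OF f(1) c3] hom_mult[OF f(1), of "braid_sigma 3 1 \<otimes>\<^bsub>braid_group 3\<^esub> braid_sigma 3 2" "braid_sigma 3 1"]
        c3 f by (simp add: braid_beta_3 Rep_b4_mult)
    then have b: "f (braid_beta 3) = braid_alpha 4 [^]\<^bsub>braid_group 4\<^esub> (2::nat)"
      unfolding 3(4) by (simp add: Rep_b4_mult braid_alpha_4 numeral_2_eq_2)
    have "f \<circ> R_star \<in> hom (braid_group 4) (braid_group 4)"
      using Group.hom_compose[OF R_star_hom f(1)] .
    moreover have "model_endo (f \<circ> R_star)"
      unfolding model_endo_def using a b f(1) Rep_b4_carrier[of g] by blast
    ultimately show ?thesis using f R 3(1) by (intro exI[of _ "f \<circ> R_star"]) simp
  qed
qed

theorem theorem5p3: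
  fixes \<phi> :: "nat gword set \<Rightarrow> nat gword set"
  assumes "\<phi> \<in> hom (braid_group 4) (braid_group 4)"
    and "\<not> cyclic_hom (braid_group 4) (braid_group 4) \<phi>"
  shows "\<exists>\<theta> t \<psi>.
    t \<in> hom (braid_group 4) ((braid_group 4)\<lparr>carrier := group_center (braid_group 4)\<rparr>) \<and>
    t \<in> transvectors (braid_group 4) (braid_group 4) \<theta> \<and>
    \<psi> \<in> iso (braid_group 4) (braid_group 4) \<and>
    (\<forall>x\<in>carrier (braid_group 4). \<phi> x = \<psi> (transvection (braid_group 4) \<theta> t x)) \<and>
    (\<theta> = id \<or>
     (\<exists>f \<in> hom (braid_group 3) (braid_group 3). \<theta> = braid_incl_3_4 \<circ> f \<circ> R_star) \<or>
     (\<exists>f \<in> hom (braid_group 3) (braid_group 4). \<exists>g \<in> carrier (braid_group 4).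
        f (braid_alpha 3) =
          g \<otimes>\<^bsub>braid_group 4\<^esub> braid_beta 4 \<otimes>\<^bsub>braid_group 4\<^esub> inv\<^bsub>braid_group 4\<^esub> g \<and>
        f (braid_beta 3) = braid_alpha 4 [^]\<^bsub>braid_group 4\<^esub> (2::nat) \<and>
        \<theta> = f \<circ> R_star))"
proof -
  let ?G = "braid_group 4"
  interpret G: group ?G by (rule group_braid_group)
  interpret E: b4_endo "lift_endo \<phi>"
    unfolding b4_endo_def using assms(1) by (rule lift_endo_morphism)
  \<comment> \<open>If two neighbouring generators have equal images, conjugation by
    \<open>al\<close> forces the third to agree, and the image is cyclic.\<close>
  have "lift_endo \<phi> s1 \<noteq> lift_endo \<phi> s2"
  proof
    assume "lift_endo \<phi> s1 = lift_endo \<phi> s2"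
    then have "cyclic_group (?G\<lparr>carrier := \<phi> ` carrier ?G\<rparr>)"
      using cyclic_image[OF assms(1)] E.equal_generators by simp
    then show False using assms by (simp add: cyclic_hom_def)
  qed
  then obtain \<psi> d x1 x2 x3 where \<psi>: "automorphism \<psi>" and d: "d \<in> Om_powers" and x: "standard_on x1 x2 x3"
    and eq: "lift_endo \<phi> s1 = \<psi> (x1 * d)" "lift_endo \<phi> s2 = \<psi> (x2 * d)" "lift_endo \<phi> s3 = \<psi> (x3 * d)"
    using E.noncyclic_standard unfolding standard_def by blast
  obtain \<theta> where \<theta>: "model_endo \<theta>" "\<theta> \<in> hom ?G ?G"
    "\<theta> (Rep_b4 s1) = Rep_b4 x1" "\<theta> (Rep_b4 s2) = Rep_b4 x2" "\<theta> (Rep_b4 s3) = Rep_b4 x3"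
    using standard_on_model[OF x] by blast
  interpret \<psi>: group_morphism \<psi> using \<psi> by (simp add: automorphism_def)
  interpret \<Theta>: group_morphism "lift_endo \<theta>" by (rule lift_endo_morphism[OF \<theta>(2)])
  define \<tau> where "\<tau> = b4_map b4_group d d d"
  have \<tau>: "\<tau> (x * y) = \<tau> x * \<tau> y" "\<tau> s1 = d" "\<tau> s2 = d" "\<tau> s3 = d" for x y
    using b4_map[OF group_b4_group, of d d d, folded \<tau>_def] by (simp_all add: b4_group_def)
  interpret \<tau>: group_morphism \<tau> by unfold_locales (rule \<tau>)
  have \<tau>O: "\<tau> x \<in> Om_powers" for x
    by (induction x rule: b4_induct) (use d \<tau> in auto)
  have \<Theta>s: "lift_endo \<theta> s1 = x1" "lift_endo \<theta> s2 = x2" "lift_endo \<theta> s3 = x3"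
    using \<theta> by (simp_all add: lift_endo_def Rep_b4_inverse)
  have factor: "lift_endo \<phi> x = \<psi> (lift_endo \<theta> x * \<tau> x)" for x
  proof (rule b4_morphism_eqI[OF E.group_morphism_axioms])
    show "group_morphism (\<lambda>x. \<psi> (lift_endo \<theta> x * \<tau> x))"
    proof
      show "\<psi> (lift_endo \<theta> (x * y) * \<tau> (x * y)) = \<psi> (lift_endo \<theta> x * \<tau> x) * \<psi> (lift_endo \<theta> y * \<tau> y)" for x y
        using central_mult[OF Om_powers_central[OF \<tau>O[of x]], of "lift_endo \<theta> x" "lift_endo \<theta> y" "\<tau> y"]
        by (simp add: \<tau>(1) flip: \<psi>.mult)
    qed
  qed (simp_all add: eq \<Theta>s \<tau>)
  define t where "t = (\<lambda>X. Rep_b4 (\<tau> (Abs_b4 X)))"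
  define \<psi>' where "\<psi>' = (\<lambda>X. Rep_b4 (\<psi> (Abs_b4 X)))"
  have t_hom: "t \<in> hom ?G ?G" unfolding t_def by (rule drop_endo_hom[OF \<tau>.group_morphism_axioms])
  have central: "t X \<otimes>\<^bsub>?G\<^esub> Y = Y \<otimes>\<^bsub>?G\<^esub> t X" if "Y \<in> carrier ?G" for X Y
  proof -
    have "Rep_b4 (\<tau> (Abs_b4 X) * Abs_b4 Y) = Rep_b4 (Abs_b4 Y * \<tau> (Abs_b4 X))"
      by (rule arg_cong[where f = Rep_b4]) (rule Om_powers_central[OF \<tau>O])
    then show ?thesis unfolding Rep_b4_mult t_def Abs_b4_inverse[OF that] .
  qed
  have t_carrier: "t X \<in> carrier ?G" for X by (simp add: t_def)
  have t_into: "t \<in> hom ?G (?G\<lparr>carrier := S\<rparr>)" if "\<And>X. X \<in> carrier ?G \<Longrightarrow> t X \<in> S" for S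
    using t_hom that by (auto simp: hom_def)
  have t_centralizes: "t X \<in> centralizer ?G S" if "S \<subseteq> carrier ?G" for S X
    unfolding centralizer_def using that central t_carrier by blast
  have t_center: "t \<in> hom ?G (?G\<lparr>carrier := group_center ?G\<rparr>)"
    unfolding group_center_def by (rule t_into) (rule t_centralizes[OF subset_refl])
  have "\<theta> ` carrier ?G \<subseteq> carrier ?G"
    using \<theta>(2) by (auto simp: hom_def)
  then have "t \<in> hom ?G (?G\<lparr>carrier := centralizer ?G (\<theta> ` carrier ?G)\<rparr>)"
    using t_into t_centralizes by metis
  moreover have "cyclic_group (?G\<lparr>carrier := t ` carrier ?G\<rparr>)"
    by (rule cyclic_image[OF t_hom]) (simp_all add: lift_endo_def t_def Rep_b4_inverse \<tau>)
  ultimately have t_transv: "t \<in> transvectors ?G ?G \<theta>"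
    by (simp add: transvectors_def cyclic_hom_def)
  have \<psi>_iso: "\<psi>' \<in> iso ?G ?G"
  proof (rule isoI)
    show "\<psi>' \<in> hom ?G ?G" unfolding \<psi>'_def by (rule drop_endo_hom[OF \<psi>.group_morphism_axioms])
    show "bij_betw \<psi>' (carrier ?G) (carrier ?G)"
    proof (rule bij_betw_byWitness[where f' = "\<lambda>X. Rep_b4 (inv_into UNIV \<psi> (Abs_b4 X))"])
      show "\<forall>X\<in>carrier ?G. Rep_b4 (inv_into UNIV \<psi> (Abs_b4 (\<psi>' X))) = X"
        "\<forall>X\<in>carrier ?G. \<psi>' (Rep_b4 (inv_into UNIV \<psi> (Abs_b4 X))) = X"
        using \<psi> by (simp_all add: \<psi>'_def Rep_b4_inverse Abs_b4_inverse automorphism_def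
            bij_is_inj bij_is_surj surj_f_inv_f)
    qed (auto simp: \<psi>'_def)
  qed
  have "\<phi> X = \<psi>' (transvection ?G \<theta> t X)" if X: "X \<in> carrier ?G" for X
  proof -
    have "\<phi> X = Rep_b4 (lift_endo \<phi> (Abs_b4 X))"
      using Rep_lift_endo[OF assms(1)] X by (simp add: Abs_b4_inverse)
    also have "\<dots> = Rep_b4 (\<psi> (lift_endo \<theta> (Abs_b4 X) * \<tau> (Abs_b4 X)))" by (simp only: factor)
    also have "lift_endo \<theta> (Abs_b4 X) * \<tau> (Abs_b4 X) = Abs_b4 (transvection ?G \<theta> t X)"
      using Rep_lift_endo[OF \<theta>(2), of "Abs_b4 X"] X
      by (simp add: times_b4_def transvection_def t_def Abs_b4_inverse)
    finally show ?thesis unfolding \<psi>'_def .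
  qed
  then show ?thesis
    by (intro exI conjI ballI) (rule t_center t_transv \<psi>_iso \<theta>(1)[unfolded model_endo_def] | assumption | simp only:)+
qed

end
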